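(* Let $f:[0,1]\to\mathbb{R}$ be a computable function of bounded variation. The following are equivalent: (1) $f$ has Luzin's (N); (2) $f$ reflects weak-2-randomness; (3) $f$ reflects $\emptyset'$-Kurtz randomness; (4) $f$ reflects $\Delta^1_1(\mathcal{O})$-randomness; (5) $f$ reflects $Z$-Kurtz randomness for every oracle $Z\geq_T\emptyset'$.
   Context: $f$ has bounded variation if there is $M$ with $\sum_{i<k}|f(x_{i+1})-f(x_i)|<M$ for all $x_0<\dots<x_k$ in $[0,1]$. Luzin's (N): images of Lebesgue null sets are null. $f$ reflects $R$-randomness if $f(x)$ $R$-random implies $x$ $R$-random for all $x$. Weak-2-random: in no Lebesgue null $\Pi^0_2$ set. $Z$-Kurtz random: in no Lebesgue null $\Pi^0_1(Z)$ (i.e. $Z$-effectively closed) subset. $\mathcal{O}$ is Kleene's $\mathcal{O}$; $\Delta^1_1(\mathcal{O})$-random means lying in no Lebesgue null set that is $\Delta^1_1(\mathcal{O})$ (Borel with code hyperarithmetic in $\mathcal{O}$). *)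

theory Defs
  imports "HOL-Analysis.Analysis" "HOL-Library.Nat_Bijection"
begin

datatype prog =
    PZero | PSucc | PLeft | PRight | PQuery
  | PPair prog prog | PComp prog prog | PRec prog prog | PMu prog

text \<open>
  Programs compute partial functions of one natural number; several arguments are packed by the
  pairing function \<open>prod_encode\<close>. The function \<open>g\<close> is the oracle. Minimisation requires all values
  before the first zero to be defined.
\<close>

primrec run :: "(nat \<Rightarrow> nat) \<Rightarrow> prog \<Rightarrow> nat \<Rightarrow> nat option" where
  "run g PZero = (\<lambda>n. Some 0)"
| "run g PSucc = (\<lambda>n. Some (Suc n))"
| "run g PLeft = (\<lambda>n. Some (fst (prod_decode n)))"
| "run g PRight = (\<lambda>n. Some (snd (prod_decode n)))"
| "run g PQuery = (\<lambda>n. Some (g n))"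
| "run g (PPair p q) = (\<lambda>n. Option.bind (run g p n)
     (\<lambda>a. map_option (\<lambda>b. prod_encode (a, b)) (run g q n)))"
| "run g (PComp p q) = (\<lambda>n. Option.bind (run g q n) (run g p))"
| "run g (PRec p q) = (\<lambda>n. case prod_decode n of (a, k) \<Rightarrow>
     rec_nat (run g p a)
       (\<lambda>i r. Option.bind r (\<lambda>b. run g q (prod_encode (a, prod_encode (i, b))))) k)"
| "run g (PMu p) = (\<lambda>a.
     if \<exists>k. run g p (prod_encode (a, k)) = Some 0 \<and>
            (\<forall>j<k. run g p (prod_encode (a, j)) \<noteq> None)
     then Some (LEAST k. run g p (prod_encode (a, k)) = Some 0)
     else None)"

primrec prog_num :: "prog \<Rightarrow> nat" where
  "prog_num PZero = 0"
| "prog_num PSucc = 1"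
| "prog_num PLeft = 2"
| "prog_num PRight = 3"
| "prog_num PQuery = 4"
| "prog_num (PPair p q) = 5 + 4 * prod_encode (prog_num p, prog_num q)"
| "prog_num (PComp p q) = 6 + 4 * prod_encode (prog_num p, prog_num q)"
| "prog_num (PRec p q) = 7 + 4 * prod_encode (prog_num p, prog_num q)"
| "prog_num (PMu p) = 8 + 4 * prog_num p"

lemma inj_prog_num: "prog_num p = prog_num q \<Longrightarrow> p = q"
proof (induction p arbitrary: q)
  case PZero
  then show ?case by (cases q) auto
next
  case PSucc
  then show ?case by (cases q) auto
next
  case PLeft
  then show ?case by (cases q) auto
next
  case PRight
  then show ?case by (cases q) auto
next
  case PQuery
  then show ?case by (cases q) auto
next
  case (PPair p1 p2)
  then show ?case by (cases q) (simp_all, presburger+)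
next
  case (PComp p1 p2)
  then show ?case by (cases q) (simp_all, presburger+)
next
  case (PRec p1 p2)
  then show ?case by (cases q) (simp_all, presburger+)
next
  case (PMu p)
  then show ?case by (cases q) (simp_all, presburger+)
qed

lemma surj_prog_num: "\<exists>p. prog_num p = n"
proof (induction n rule: less_induct)
  case (less n)
  show ?case
  proof (cases "n < 5")
    case True
    then consider "n = 0" | "n = 1" | "n = 2" | "n = 3" | "n = 4" by linarith
    then show ?thesis by cases (metis prog_num.simps)+
  next
    case False
    define m where "m = (n - 5) div 4"
    obtain a b where ab: "m = prod_encode (a, b)"
      by (metis prod_decode_inverse surj_pair)
    have "m < n" using False unfolding m_def by linarith
    moreover have "a \<le> m" "b \<le> m" using ab le_prod_encode_1 le_prod_encode_2 by auto
    ultimately obtain p q r where pqr: "prog_num p = a" "prog_num q = b" "prog_num r = m"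
      using less.IH by (meson le_less_trans)
    consider "n = 5 + 4 * m" | "n = 6 + 4 * m" | "n = 7 + 4 * m" | "n = 8 + 4 * m"
    proof -
      obtain d where d: "n = 5 + d" using False by (metis le_Suc_ex not_le)
      have "d = 4 * (d div 4) + d mod 4" by simp
      moreover have "d mod 4 = 0 \<or> d mod 4 = 1 \<or> d mod 4 = 2 \<or> d mod 4 = 3" by presburger
      ultimately show thesis using that d unfolding m_def by fastforce
    qed
    then show ?thesis
    proof cases
      case 1 then show ?thesis using ab pqr by (intro exI[of _ "PPair p q"]) simp
    next
      case 2 then show ?thesis using ab pqr by (intro exI[of _ "PComp p q"]) simp
    next
      case 3 then show ?thesis using ab pqr by (intro exI[of _ "PRec p q"]) simp
    next
      case 4 then show ?thesis using pqr by (intro exI[of _ "PMu r"]) simp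
    qed
  qed
qed

lemma bij_prog_num: "bij prog_num"
  using inj_prog_num surj_prog_num unfolding bij_def inj_def surj_def by metis

definition char_fun :: "nat set \<Rightarrow> nat \<Rightarrow> nat" where
  "char_fun Z n = (if n \<in> Z then 1 else 0)"

definition phi :: "nat set \<Rightarrow> nat \<Rightarrow> nat \<Rightarrow> nat option" where
  "phi Z e = run (char_fun Z) (inv prog_num e)"

definition computable_in :: "nat set \<Rightarrow> (nat \<Rightarrow> nat) \<Rightarrow> bool" where
  "computable_in Z h \<longleftrightarrow> (\<exists>e. \<forall>n. phi Z e n = Some (h n))"

definition turing_le :: "nat set \<Rightarrow> nat set \<Rightarrow> bool" where
  "turing_le A B \<longleftrightarrow> computable_in B (char_fun A)"

definition ce_in :: "nat set \<Rightarrow> nat set \<Rightarrow> bool" where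
  "ce_in Z W \<longleftrightarrow> (\<exists>e. W = {n. phi Z e n \<noteq> None})"

definition jump :: "nat set \<Rightarrow> nat set" where
  "jump Z = {e. phi Z e e \<noteq> None}"

text \<open>
  Kleene's system of ordinal notations relative to \<open>Z\<close>: \<open>kleene_less Z a b\<close> is the relation
  usually written \<open>a <\<^sub>O b\<close>.
\<close>

inductive kleene_O :: "nat set \<Rightarrow> nat \<Rightarrow> bool"
  and kleene_less :: "nat set \<Rightarrow> nat \<Rightarrow> nat \<Rightarrow> bool"
  for Z :: "nat set" where
  O_zero: "kleene_O Z 1"
| O_suc: "kleene_O Z a \<Longrightarrow> kleene_O Z (2 ^ a)"
| O_lim: "\<lbrakk>\<And>n. phi Z e n = Some (h n); \<And>n. kleene_O Z (h n); \<And>n. kleene_less Z (h n) (h (Suc n))\<rbrakk>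
    \<Longrightarrow> kleene_O Z (3 * 5 ^ e)"
| less_suc: "kleene_O Z a \<Longrightarrow> kleene_less Z a (2 ^ a)"
| less_lim: "\<lbrakk>\<And>n. phi Z e n = Some (h n); \<And>n. kleene_O Z (h n); \<And>n. kleene_less Z (h n) (h (Suc n))\<rbrakk>
    \<Longrightarrow> kleene_less Z (h m) (3 * 5 ^ e)"
| less_trans: "\<lbrakk>kleene_less Z a b; kleene_less Z b c\<rbrakk> \<Longrightarrow> kleene_less Z a c"

definition KleeneO :: "nat set" where
  "KleeneO = {a. kleene_O {} a}"

text \<open>
  The hyperarithmetical hierarchy over \<open>Z\<close>: \<open>hset Z a H\<close> says that \<open>H\<close> is the set obtained by
  iterating the jump along the notation \<open>a\<close>, starting from \<open>Z\<close> and taking effective joins along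
  fundamental sequences at limits.
\<close>

inductive hset :: "nat set \<Rightarrow> nat \<Rightarrow> nat set \<Rightarrow> bool" for Z :: "nat set" where
  hset_zero: "hset Z 1 Z"
| hset_suc: "\<lbrakk>kleene_O Z a; hset Z a H\<rbrakk> \<Longrightarrow> hset Z (2 ^ a) (jump H)"
| hset_lim: "\<lbrakk>kleene_O Z (3 * 5 ^ e); \<And>n. phi Z e n = Some (h n); \<And>n. hset Z (h n) (H n)\<rbrakk>
    \<Longrightarrow> hset Z (3 * 5 ^ e) {prod_encode (n, m) | n m. m \<in> H n}"

definition hyperarithmetic_in :: "nat set \<Rightarrow> (nat \<Rightarrow> nat) \<Rightarrow> bool" where
  "hyperarithmetic_in Z c \<longleftrightarrow> (\<exists>a H. hset Z a H \<and> computable_in H c)"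

definition rat_num :: "nat \<Rightarrow> real" where
  "rat_num n = (case prod_decode n of (i, j) \<Rightarrow> of_int (int_decode i) / of_nat (Suc j))"

definition basic_open :: "nat \<Rightarrow> real set" where
  "basic_open n = (case prod_decode n of (a, b) \<Rightarrow> {rat_num a <..< rat_num b})"

definition eff_closed :: "nat set \<Rightarrow> real set \<Rightarrow> bool" where
  "eff_closed Z S \<longleftrightarrow> (\<exists>W. ce_in Z W \<and> S = - (\<Union>i\<in>W. basic_open i))"

text \<open>Lightface \<open>\<Pi>\<^sup>0\<^sub>2\<close>: intersections of uniformly effectively open sequences.\<close>

definition Pi02 :: "real set \<Rightarrow> bool" where
  "Pi02 S \<longleftrightarrow> (\<exists>W. ce_in {} W \<and> S = (\<Inter>n. \<Union>i\<in>{i. prod_encode (n, i) \<in> W}. basic_open i))"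

text \<open>\<open>borel_code c S\<close>: the function \<open>c\<close> is a Borel code of \<open>S\<close>; its first value is the tag.\<close>

inductive borel_code :: "(nat \<Rightarrow> nat) \<Rightarrow> real set \<Rightarrow> bool" where
  code_basic: "c 0 = 0 \<Longrightarrow> borel_code c (basic_open (c 1))"
| code_compl: "\<lbrakk>c 0 = 1; borel_code (\<lambda>k. c (Suc k)) S\<rbrakk> \<Longrightarrow> borel_code c (- S)"
| code_union: "\<lbrakk>c 0 \<ge> 2; \<And>n. borel_code (\<lambda>k. c (Suc (prod_encode (n, k)))) (S n)\<rbrakk>
    \<Longrightarrow> borel_code c (\<Union>n. S n)"

text \<open>
  \<open>\<Delta>\<^sup>1\<^sub>1\<close> relative to \<open>Z\<close> is taken in the form: Borel with a code that is hyperarithmetic in \<open>Z\<close>.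
\<close>

definition Delta11 :: "nat set \<Rightarrow> real set \<Rightarrow> bool" where
  "Delta11 Z S \<longleftrightarrow> (\<exists>c. hyperarithmetic_in Z c \<and> borel_code c S)"

definition weak2_random :: "real \<Rightarrow> bool" where
  "weak2_random x \<longleftrightarrow> (\<forall>S. Pi02 S \<and> S \<in> null_sets lebesgue \<longrightarrow> x \<notin> S)"

definition kurtz_random :: "nat set \<Rightarrow> real \<Rightarrow> bool" where
  "kurtz_random Z x \<longleftrightarrow> (\<forall>S. eff_closed Z S \<and> S \<in> null_sets lebesgue \<longrightarrow> x \<notin> S)"

definition Delta11_random :: "nat set \<Rightarrow> real \<Rightarrow> bool" where
  "Delta11_random Z x \<longleftrightarrow> (\<forall>S. Delta11 Z S \<and> S \<in> null_sets lebesgue \<longrightarrow> x \<notin> S)"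

text \<open>
  A function from the unit interval to the reals is represented by a total function on the reals
  whose values outside the interval are never used.
\<close>

definition cauchy_name :: "(nat \<Rightarrow> nat) \<Rightarrow> real \<Rightarrow> bool" where
  "cauchy_name g x \<longleftrightarrow> (\<forall>n. \<bar>rat_num (g n) - x\<bar> \<le> 1 / 2 ^ n)"

definition computable_unit :: "(real \<Rightarrow> real) \<Rightarrow> bool" where
  "computable_unit f \<longleftrightarrow> (\<exists>p. \<forall>x\<in>{0..1}. \<forall>g. cauchy_name g x \<longrightarrow>
     (\<exists>h. (\<forall>n. run g p n = Some (h n)) \<and> cauchy_name h (f x)))"

definition bounded_variation_unit :: "(real \<Rightarrow> real) \<Rightarrow> bool" where
  "bounded_variation_unit f \<longleftrightarrow> (\<exists>M. \<forall>k (x :: nat \<Rightarrow> real).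
     (\<forall>i\<le>k. x i \<in> {0..1}) \<and> (\<forall>i<k. x i < x (Suc i)) \<longrightarrow>
     (\<Sum>i<k. \<bar>f (x (Suc i)) - f (x i)\<bar>) < M)"

definition luzin_N :: "(real \<Rightarrow> real) \<Rightarrow> bool" where
  "luzin_N f \<longleftrightarrow> (\<forall>E. E \<subseteq> {0..1} \<and> E \<in> null_sets lebesgue \<longrightarrow> f ` E \<in> null_sets lebesgue)"

definition reflects :: "(real \<Rightarrow> bool) \<Rightarrow> (real \<Rightarrow> real) \<Rightarrow> bool" where
  "reflects R f \<longleftrightarrow> (\<forall>x\<in>{0..1}. R (f x) \<longrightarrow> R x)"

end

(*
  Write N(y) for the number of preimages of y under f. Bounded variation makes N integrable, by
  Fatou applied to the counts of dyadic cells whose image contains y (Banach's indicatrix), so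
  almost every y has only finitely many preimages.

  Suppose f has Luzin's (N). The image of a Z-effectively closed null set is Z-effectively closed,
  by compactness, and null. For a null intersection of decreasing effectively open U_n, pigeonhole
  on finite fibres shows that the intersection of the f(U_n) is null, hence so is that of suitable
  effectively open supersets of the f(U_n). For a Borel null set S, if y = f(x) is random
  then x is the only preimage of y in some dyadic cell I; replacing each leaf U of a Borel code of
  S by the image of the intersection of U and I is a computable transformation of codes, and it
  yields a set that agrees with f(S) on the points having exactly one preimage in I.

  Suppose f fails (N). Then for some c > 0 there are finite unions U_n of dyadic cells of measure
  below 2^-n over which f varies by more than c, and a computable search finds them. By dominated
  convergence the limsup of the U_n, a null lightface Pi^0_2 set, has an image of positive measure.
  The halting problem bounds how much variation the tail of the sequence still contributes, which
  lets it shrink the limsup to a null effectively closed set whose image has positive measure.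
*)

theory Submission
  imports Defs
begin

subsection \<open>Computable functions between encodable types\<close>

text \<open>Images commute with unions but not with complements or intersections, and this shapes
  all three reflection arguments. For closed sets compactness helps, for decreasing intersections
  finite fibres do, and for Borel sets the image becomes a preimage under an inverse branch of f on
  a cell where the value is taken once. Values for which no such cell exists must form a coded null
  set, because randomness of f(x) is all that excludes them; \<open>everywhere_multi\<close> serves
  this purpose.

  For the converse, one null test with a non-null image is enough: there are countably many tests,
  so the non-random reals form a null set and some value of f on that test is random. The difficulty
  is to have a closed test. A limsup is not closed, and cutting each of its tails after finitely
  many stages could destroy its image. The cut after stage m therefore has to lose at most 2^-(m+q)
  of variation, an amount that is summable in m, and whether a cut loses more is a question that the
  halting problem answers.\<close>

class enc =
  fixes enc :: "'a \<Rightarrow> nat" and dec :: "nat \<Rightarrow> 'a"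
  assumes dec_enc [simp]: "dec (enc x) = x"
    and dec_prog: "\<exists>p. \<forall>g n. run g p n = Some (enc (dec n))"

lemma enc_eq_iff [simp]: "enc x = enc y \<longleftrightarrow> x = y"
  by (metis dec_enc)

primrec const_prog :: "nat \<Rightarrow> prog" where
  "const_prog 0 = PZero"
| "const_prog (Suc n) = PComp PSucc (const_prog n)"

lemma run_const_prog [simp]: "run g (const_prog n) m = Some n"
  by (induction n) auto

lemma run_PRec_step:
  assumes "run g p a = Some u"
    and "\<And>i b. run g q (prod_encode (a, prod_encode (i, b))) = Some (s i b)"
  shows "run g (PRec p q) (prod_encode (a, k)) = Some (rec_nat u s k)"
proof -
  have "rec_nat (run g p a)
      (\<lambda>i r. Option.bind r (\<lambda>b. run g q (prod_encode (a, prod_encode (i, b))))) k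
      = Some (rec_nat u s k)"
    by (induction k) (auto simp: assms)
  then show ?thesis by simp
qed

instantiation nat :: enc
begin
definition enc_nat :: "nat \<Rightarrow> nat" where [simp]: "enc_nat n = n"
definition dec_nat :: "nat \<Rightarrow> nat" where [simp]: "dec_nat n = n"
instance
proof
  have "run g (PPair PLeft PRight) n = Some n" for g n by simp
  then show "\<exists>p. \<forall>g n. run g p n = Some (enc (dec n :: nat))"
    unfolding enc_nat_def dec_nat_def by blast
qed simp
end

instantiation bool :: enc
begin
definition enc_bool :: "bool \<Rightarrow> nat" where "enc_bool b = (if b then 1 else 0)"
definition dec_bool :: "nat \<Rightarrow> bool" where "dec_bool n = (n \<noteq> 0)"
instance
proof
  show "dec (enc x) = x" for x :: bool by (simp add: enc_bool_def dec_bool_def)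
  have "run g (PComp (PRec PZero (const_prog 1)) (PPair PZero (PPair PLeft PRight))) n
      = Some (enc (dec n :: bool))" for g n
    using run_PRec_step[where u = 0 and s = "\<lambda>i b. 1" and g = g and p = PZero and a = 0 and k = n
        and q = "const_prog 1"]
    by (cases n) (simp_all add: enc_bool_def dec_bool_def del: run.simps(8))
  then show "\<exists>p. \<forall>g n. run g p n = Some (enc (dec n :: bool))" by blast
qed
end

instantiation prod :: (enc, enc) enc
begin
definition enc_prod :: "'a \<times> 'b \<Rightarrow> nat" where "enc_prod x = prod_encode (enc (fst x), enc (snd x))"
definition dec_prod :: "nat \<Rightarrow> 'a \<times> 'b" where
  "dec_prod n = (dec (fst (prod_decode n)), dec (snd (prod_decode n)))"
instance
proof
  show "dec (enc x) = x" for x :: "'a \<times> 'b" by (simp add: enc_prod_def dec_prod_def)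
  obtain p where p: "\<forall>g n. run g p n = Some (enc (dec n :: 'a))" using dec_prog by blast
  obtain q where q: "\<forall>g n. run g q n = Some (enc (dec n :: 'b))" using dec_prog by blast
  have "run g (PPair (PComp p PLeft) (PComp q PRight)) n = Some (enc (dec n :: 'a \<times> 'b))" for g n
    using p q by (simp add: enc_prod_def dec_prod_def)
  then show "\<exists>p. \<forall>g n. run g p n = Some (enc (dec n :: 'a \<times> 'b))" by blast
qed
end

instantiation option :: (enc) enc
begin
definition enc_option :: "'a option \<Rightarrow> nat" where
  "enc_option x = (case x of None \<Rightarrow> 0 | Some v \<Rightarrow> Suc (enc v))"
definition dec_option :: "nat \<Rightarrow> 'a option" where
  "dec_option n = (case n of 0 \<Rightarrow> None | Suc m \<Rightarrow> Some (dec m))"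
instance
proof
  show "dec (enc x) = x" for x :: "'a option"
    by (simp add: enc_option_def dec_option_def split: option.split)
  obtain p where p: "\<And>g n. run g p n = Some (enc (dec n :: 'a))" using dec_prog by blast
  have "run g (PComp (PRec PZero (PComp PSucc (PComp p (PComp PLeft PRight))))
      (PPair PZero (PPair PLeft PRight))) n = Some (enc (dec n :: 'a option))" for g n
    using run_PRec_step[where u = 0 and s = "\<lambda>i b. Suc (enc (dec i :: 'a))" and g = g and p = PZero
        and a = 0 and k = n and q = "PComp PSucc (PComp p (PComp PLeft PRight))"]
    by (cases n) (simp_all add: p enc_option_def dec_option_def del: run.simps(8))
  then show "\<exists>p. \<forall>g n. run g p n = Some (enc (dec n :: 'a option))" by blast
qed
end

definition cmp :: "(nat \<Rightarrow> nat) \<Rightarrow> ('a::enc \<Rightarrow> 'b::enc) \<Rightarrow> bool" where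
  "cmp g f \<longleftrightarrow> (\<exists>p. \<forall>x. run g p (enc x) = Some (enc (f x)))"

named_theorems cmp_intros

lemma cmpI: "(\<And>x. run g p (enc x) = Some (enc (f x))) \<Longrightarrow> cmp g f"
  unfolding cmp_def by blast

lemma cmp_id [cmp_intros]: "cmp g (\<lambda>x. x)"
  by (rule cmpI[where p = "PPair PLeft PRight"]) simp

lemma cmp_const [cmp_intros]: "cmp g (\<lambda>x. c)"
  by (rule cmpI[where p = "const_prog (enc c)"]) simp

lemma cmp_compose: assumes "cmp g f" "cmp g h" shows "cmp g (\<lambda>x. f (h x))"
proof -
  obtain p q where "\<forall>x. run g p (enc x) = Some (enc (f x))" "\<forall>x. run g q (enc x) = Some (enc (h x))"
    using assms unfolding cmp_def by blast
  then show ?thesis by (intro cmpI[where p = "PComp p q"]) simp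
qed

lemma cmp_pair [cmp_intros]: assumes "cmp g a" "cmp g b" shows "cmp g (\<lambda>x. (a x, b x))"
proof -
  obtain p q where "\<forall>x. run g p (enc x) = Some (enc (a x))" "\<forall>x. run g q (enc x) = Some (enc (b x))"
    using assms unfolding cmp_def by blast
  then show ?thesis by (intro cmpI[where p = "PPair p q"]) (simp add: enc_prod_def)
qed

lemma cmp_fst [cmp_intros]: assumes "cmp g a" shows "cmp g (\<lambda>x. fst (a x))"
  by (rule cmp_compose[OF _ assms], rule cmpI[where p = PLeft]) (simp add: enc_prod_def)

lemma cmp_snd [cmp_intros]: assumes "cmp g a" shows "cmp g (\<lambda>x. snd (a x))"
  by (rule cmp_compose[OF _ assms], rule cmpI[where p = PRight]) (simp add: enc_prod_def)

text \<open>Rules for binders take the body as a function of one packed argument, the context paired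
  with the bound variable. The rules here lead from packed functions back to curried terms, so that
  \<open>cmp_intros\<close> can follow the syntax of a term.\<close>

lemma cmp2:
  assumes "cmp g (\<lambda>p. F (fst p) (snd p))" "cmp g a" "cmp g b" shows "cmp g (\<lambda>x. F (a x) (b x))"
  using cmp_compose[OF assms(1) cmp_pair[OF assms(2,3)]] by simp

lemma cmp3:
  assumes "cmp g (\<lambda>p. F (fst p) (fst (snd p)) (snd (snd p)))" "cmp g a" "cmp g b" "cmp g c"
  shows "cmp g (\<lambda>x. F (a x) (b x) (c x))"
  using cmp_compose[OF assms(1) cmp_pair[OF assms(2) cmp_pair[OF assms(3,4)]]] by simp

lemma cmp4:
  assumes "cmp g (\<lambda>p. F (fst p) (fst (snd p)) (fst (snd (snd p))) (snd (snd (snd p))))"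
    "cmp g a" "cmp g b" "cmp g c" "cmp g d"
  shows "cmp g (\<lambda>x. F (a x) (b x) (c x) (d x))"
  using cmp_compose[OF assms(1) cmp_pair[OF assms(2) cmp_pair[OF assms(3) cmp_pair[OF assms(4,5)]]]]
  by simp

lemma cmp_enc_iff: "cmp g (\<lambda>x. enc (f x)) \<longleftrightarrow> cmp g f"
  unfolding cmp_def by simp

lemma cmp_encI: "cmp g h \<Longrightarrow> (\<And>x. enc (f x) = h x) \<Longrightarrow> cmp g f"
  unfolding cmp_def by simp

text \<open>The purpose of \<open>dec_prog\<close>: \<open>enc\<close> need not be onto, and a
  search over an encodable type runs over all numbers, so decoding has to be computable on every
  number.\<close>

lemma cmp_dec [cmp_intros]: assumes "cmp g a" shows "cmp g (\<lambda>x. dec (a x) :: 'b::enc)"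
proof -
  have "cmp g (dec :: nat \<Rightarrow> 'b)" unfolding cmp_def using dec_prog[where 'a = 'b] by auto
  then show ?thesis by (rule cmp_compose[OF _ assms])
qed

lemma cmp_Suc [cmp_intros]: assumes "cmp g a" shows "cmp g (\<lambda>x. Suc (a x))"
  by (rule cmp_compose[OF _ assms], rule cmpI[where p = PSucc]) simp

lemma cmp_oracle: "cmp g g"
  by (rule cmpI[where p = PQuery]) simp

lemma cmp_rec_nat [cmp_intros]:
  assumes "cmp g k" "cmp g z" "cmp g (\<lambda>p. s (fst p) (fst (snd p)) (snd (snd p)))"
  shows "cmp g (\<lambda>x. rec_nat (z x) (s x) (k x))"
proof -
  obtain pk pz ps where p: "\<And>x. run g pk (enc x) = Some (enc (k x))"
    "\<And>x. run g pz (enc x) = Some (enc (z x))"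
    "\<And>x. run g ps (enc x) = Some (enc (s (fst x) (fst (snd x)) (snd (snd x))))"
    using assms unfolding cmp_def by blast
  have "rec_nat (run g pz (enc x))
      (\<lambda>i r. Option.bind r (\<lambda>b. run g ps (prod_encode (enc x, prod_encode (i, b))))) n
      = Some (enc (rec_nat (z x) (s x) n))" for x n
  proof (induction n)
    case 0 then show ?case by (simp add: p)
  next
    case (Suc n)
    then show ?case using p(3)[of "(x, n, rec_nat (z x) (s x) n)"]
      by (simp add: enc_prod_def)
  qed
  then show ?thesis
    by (intro cmpI[where p = "PComp (PRec pz ps) (PPair (PPair PLeft PRight) pk)"])
       (simp add: p)
qed

lemma cmp_case_nat [cmp_intros]:
  assumes "cmp g a" "cmp g b" "cmp g (\<lambda>p. c (fst p) (snd p))"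
  shows "cmp g (\<lambda>x. case a x of 0 \<Rightarrow> b x | Suc n \<Rightarrow> c x n)"
proof -
  have "cmp g (\<lambda>x. rec_nat (b x) (\<lambda>i r. c x i) (a x))"
    by (intro cmp_rec_nat cmp2[OF assms(3)] assms(1,2) cmp_intros)
  moreover have "(\<lambda>x. rec_nat (b x) (\<lambda>i r. c x i) (a x)) = (\<lambda>x. case a x of 0 \<Rightarrow> b x | Suc n \<Rightarrow> c x n)"
    by (auto split: nat.split)
  ultimately show ?thesis by simp
qed

lemma cmp_if [cmp_intros]:
  assumes "cmp g P" "cmp g a" "cmp g b" shows "cmp g (\<lambda>x. if P x then a x else b x)"
proof -
  have "cmp g (\<lambda>x. enc (P x))" using assms(1) by (simp add: cmp_enc_iff)
  then have "cmp g (\<lambda>x. case enc (P x) of 0 \<Rightarrow> b x | Suc n \<Rightarrow> a x)"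
    by (intro cmp_case_nat assms(2,3) cmp_compose[OF assms(2)] cmp_intros)
  moreover have "(\<lambda>x. case enc (P x) of 0 \<Rightarrow> b x | Suc n \<Rightarrow> a x) = (\<lambda>x. if P x then a x else b x)"
    by (auto simp: enc_bool_def)
  ultimately show ?thesis by simp
qed

lemma cmp_not [cmp_intros]: assumes "cmp g P" shows "cmp g (\<lambda>x. \<not> P x)"
proof -
  have "cmp g (\<lambda>x. if P x then False else True)" by (intro cmp_intros assms)
  moreover have "(\<lambda>x. if P x then False else True) = (\<lambda>x. \<not> P x)" by auto
  ultimately show ?thesis by simp
qed

lemma cmp_conj [cmp_intros]: assumes "cmp g P" "cmp g Q" shows "cmp g (\<lambda>x. P x \<and> Q x)"
proof -
  have "cmp g (\<lambda>x. if P x then Q x else False)" by (intro cmp_intros assms)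
  moreover have "(\<lambda>x. if P x then Q x else False) = (\<lambda>x. P x \<and> Q x)" by auto
  ultimately show ?thesis by simp
qed

lemma cmp_disj [cmp_intros]: assumes "cmp g P" "cmp g Q" shows "cmp g (\<lambda>x. P x \<or> Q x)"
proof -
  have "cmp g (\<lambda>x. if P x then True else Q x)" by (intro cmp_intros assms)
  moreover have "(\<lambda>x. if P x then True else Q x) = (\<lambda>x. P x \<or> Q x)" by auto
  ultimately show ?thesis by simp
qed

lemma cmp_imp [cmp_intros]: assumes "cmp g P" "cmp g Q" shows "cmp g (\<lambda>x. P x \<longrightarrow> Q x)"
proof -
  have "cmp g (\<lambda>x. if P x then Q x else True)" by (intro cmp_intros assms)
  moreover have "(\<lambda>x. if P x then Q x else True) = (\<lambda>x. P x \<longrightarrow> Q x)" by auto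
  ultimately show ?thesis by simp
qed

lemma cmp_plus [cmp_intros]:
  fixes a b :: "'a::enc \<Rightarrow> nat"
  assumes "cmp g a" "cmp g b" shows "cmp g (\<lambda>x. a x + b x)"
proof -
  have "cmp g (\<lambda>x. rec_nat (a x) (\<lambda>i r. Suc r) (b x))" by (intro cmp_intros assms)
  moreover have "rec_nat u (\<lambda>i r. Suc r) v = u + v" for u v :: nat by (induction v) auto
  ultimately show ?thesis by simp
qed

lemma cmp_minus [cmp_intros]:
  fixes a b :: "'a::enc \<Rightarrow> nat"
  assumes "cmp g a" "cmp g b" shows "cmp g (\<lambda>x. a x - b x)"
proof -
  have "cmp g (\<lambda>x. rec_nat (a x) (\<lambda>i r. case r of 0 \<Rightarrow> 0 | Suc m \<Rightarrow> m) (b x))"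
    by (intro cmp_intros assms)
  moreover have "rec_nat u (\<lambda>i r. case r of 0 \<Rightarrow> 0 | Suc m \<Rightarrow> m) v = u - v" for u v :: nat
    by (induction v) (auto split: nat.split)
  ultimately show ?thesis by simp
qed

lemma cmp_times [cmp_intros]:
  fixes a b :: "'a::enc \<Rightarrow> nat"
  assumes "cmp g a" "cmp g b" shows "cmp g (\<lambda>x. a x * b x)"
proof -
  have "cmp g (\<lambda>x. rec_nat 0 (\<lambda>i r. r + a x) (b x))"
    by (intro cmp_intros cmp_compose[OF assms(1)] assms)
  moreover have "rec_nat 0 (\<lambda>i r. r + u) v = u * v" for u v :: nat by (induction v) auto
  ultimately show ?thesis by simp
qed

lemma cmp_power [cmp_intros]:
  fixes a b :: "'a::enc \<Rightarrow> nat"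
  assumes "cmp g a" "cmp g b" shows "cmp g (\<lambda>x. a x ^ b x)"
proof -
  have "cmp g (\<lambda>x. rec_nat 1 (\<lambda>i r. r * a x) (b x))"
    by (intro cmp_intros cmp_compose[OF assms(1)] assms)
  moreover have "rec_nat 1 (\<lambda>i r. r * u) v = u ^ v" for u v :: nat by (induction v) auto
  ultimately show ?thesis by simp
qed

lemma cmp_le [cmp_intros]:
  fixes a b :: "'a::enc \<Rightarrow> nat"
  assumes "cmp g a" "cmp g b" shows "cmp g (\<lambda>x. a x \<le> b x)"
  by (rule cmp_encI[where h = "\<lambda>x. case a x - b x of 0 \<Rightarrow> 1 | Suc n \<Rightarrow> 0"], intro cmp_intros assms)
     (auto simp: enc_bool_def split: nat.split)

lemma cmp_less [cmp_intros]:
  fixes a b :: "'a::enc \<Rightarrow> nat"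
  assumes "cmp g a" "cmp g b" shows "cmp g (\<lambda>x. a x < b x)"
  unfolding Suc_le_eq[symmetric] by (intro cmp_intros assms)

lemma cmp_eq [cmp_intros]:
  assumes "cmp g a" "cmp g b" shows "cmp g (\<lambda>x. a x = b x)"
proof -
  have "cmp g (\<lambda>x. enc (a x) \<le> enc (b x) \<and> enc (b x) \<le> enc (a x))"
    by (intro cmp_intros) (simp_all add: assms cmp_enc_iff)
  moreover have "(\<lambda>x. enc (a x) \<le> enc (b x) \<and> enc (b x) \<le> enc (a x)) = (\<lambda>x. a x = b x)"
    by (metis (no_types, opaque_lifting) antisym enc_eq_iff order_refl)
  ultimately show ?thesis by simp
qed

lemma cmp_bex [cmp_intros]:
  fixes b :: "'a::enc \<Rightarrow> nat"
  assumes "cmp g b" "cmp g (\<lambda>p. P (fst p) (snd p))" shows "cmp g (\<lambda>x. \<exists>i<b x. P x i)"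
proof -
  have "cmp g (\<lambda>x. rec_nat False (\<lambda>i r. r \<or> P x i) (b x))"
    by (intro cmp_intros assms(1) cmp2[OF assms(2)])
  moreover have "rec_nat False (\<lambda>i r. r \<or> Q i) v = (\<exists>i<v. Q i)" for v Q
    by (induction v) (auto simp: less_Suc_eq)
  ultimately show ?thesis by simp
qed

lemma cmp_ball [cmp_intros]:
  fixes b :: "'a::enc \<Rightarrow> nat"
  assumes "cmp g b" "cmp g (\<lambda>p. P (fst p) (snd p))" shows "cmp g (\<lambda>x. \<forall>i<b x. P x i)"
proof -
  have "cmp g (\<lambda>x. \<not> (\<exists>i<b x. \<not> P x i))" by (intro cmp_intros assms)
  then show ?thesis by simp
qed

text \<open>\<open>PMu\<close> demands that all values before the first zero be defined. A total
  decision procedure for \<open>P\<close> guarantees this, which leaves only the existence of a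
  witness as a hypothesis.\<close>

lemma cmp_Least [cmp_intros]:
  assumes "cmp g (\<lambda>p. P (fst p) (snd p))" "\<And>x. \<exists>k::nat. P x k"
  shows "cmp g (\<lambda>x. LEAST k. P x k)"
proof -
  have "cmp g (\<lambda>p. if P (fst p) (snd p) then 0 else (1::nat))"
    by (intro cmp_intros assms)
  then obtain p where p: "\<And>x. run g p (enc x) = Some (if P (fst x) (snd x) then 0 else 1)"
    unfolding cmp_def enc_nat_def by blast
  have q: "run g p (prod_encode (enc x, k)) = Some (if P x k then 0 else 1)" for x k
    using p[of "(x, k)"] by (simp add: enc_prod_def)
  show ?thesis
    by (intro cmpI[where p = "PMu p"]) (simp add: q assms(2))
qed

lemma cmp_div [cmp_intros]:
  fixes a b :: "'a::enc \<Rightarrow> nat"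
  assumes "cmp g a" "cmp g b" shows "cmp g (\<lambda>x. a x div b x)"
proof -
  \<comment> \<open>The disjunct \<open>v = 0\<close> ends the search at once and so reproduces
    \<open>u div 0 = 0\<close>.\<close>
  have eq: "(LEAST k. v = 0 \<or> u < Suc k * v) = u div v" for u v :: nat
  proof (cases "v = 0")
    case False
    then show ?thesis
      using dividend_less_div_times[of v u] less_mult_imp_div_less[of u _ v]
      by (intro Least_equality) (auto simp flip: less_Suc_eq_le)
  qed (simp add: Least_equality)
  have "\<exists>k. v = 0 \<or> u < Suc k * v" for u v :: nat
    using dividend_less_div_times[of v u] by (intro exI[of _ "u div v"]) auto
  then have "cmp g (\<lambda>x. LEAST k. b x = 0 \<or> a x < Suc k * b x)"
    by (intro cmp_intros cmp_compose[OF assms(1)] cmp_compose[OF assms(2)])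
  then show ?thesis by (simp only: eq)
qed

lemma cmp_mod [cmp_intros]:
  fixes a b :: "'a::enc \<Rightarrow> nat"
  assumes "cmp g a" "cmp g b" shows "cmp g (\<lambda>x. a x mod b x)"
  unfolding minus_div_mult_eq_mod[symmetric] by (intro cmp_intros assms)

lemma cmp_odd [cmp_intros]:
  fixes a :: "'a::enc \<Rightarrow> nat"
  assumes "cmp g a" shows "cmp g (\<lambda>x. odd (a x))"
  unfolding odd_iff_mod_2_eq_one by (intro cmp_intros assms)

lemma cmp_sum [cmp_intros]:
  fixes b :: "'a::enc \<Rightarrow> nat" and e :: "'a \<Rightarrow> nat \<Rightarrow> nat"
  assumes "cmp g b" "cmp g (\<lambda>p. e (fst p) (snd p))" shows "cmp g (\<lambda>x. \<Sum>i<b x. e x i)"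
proof -
  have "cmp g (\<lambda>x. rec_nat 0 (\<lambda>i r. r + e x i) (b x))"
    by (intro cmp_intros assms(1) cmp2[OF assms(2)])
  moreover have "rec_nat 0 (\<lambda>i r. r + q i) v = (\<Sum>i<v. q i)" for v and q :: "nat \<Rightarrow> nat"
    by (induction v) auto
  ultimately show ?thesis by simp
qed

lemma cmp_funpow [cmp_intros]:
  fixes s :: "'a::enc \<Rightarrow> 'b::enc \<Rightarrow> 'b"
  assumes "cmp g k" "cmp g z" "cmp g (\<lambda>p. s (fst p) (snd p))"
  shows "cmp g (\<lambda>x. (s x ^^ k x) (z x))"
proof -
  have "cmp g (\<lambda>x. rec_nat (z x) (\<lambda>i r. s x r) (k x))"
    by (intro cmp_intros assms(1,2) cmp2[OF assms(3)])
  moreover have "rec_nat u (\<lambda>i. t) v = (t ^^ v) u" for u :: 'b and t v by (induction v) auto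
  ultimately show ?thesis by simp
qed

lemma cmp_Some [cmp_intros]: assumes "cmp g a" shows "cmp g (\<lambda>x. Some (a x))"
  by (rule cmp_encI[where h = "\<lambda>x. Suc (enc (a x))"])
     (intro cmp_intros, simp_all add: cmp_enc_iff assms enc_option_def)

lemma cmp_case_option [cmp_intros]:
  assumes "cmp g a" "cmp g b" "cmp g (\<lambda>p. c (fst p) (snd p))"
  shows "cmp g (\<lambda>x. case a x of None \<Rightarrow> b x | Some v \<Rightarrow> c x v)"
proof -
  have "cmp g (\<lambda>x. enc (a x))" using assms(1) by (simp add: cmp_enc_iff)
  then have "cmp g (\<lambda>x. case enc (a x) of 0 \<Rightarrow> b x | Suc n \<Rightarrow> c x (dec n))"
    by (intro cmp_case_nat assms(2) cmp2[OF assms(3)] cmp_intros)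
  moreover have "(\<lambda>x. case enc (a x) of 0 \<Rightarrow> b x | Suc n \<Rightarrow> c x (dec n))
      = (\<lambda>x. case a x of None \<Rightarrow> b x | Some v \<Rightarrow> c x v)"
    by (auto simp: enc_option_def split: option.split)
  ultimately show ?thesis by simp
qed

lemma cmp_bind [cmp_intros]:
  assumes "cmp g a" "cmp g (\<lambda>p. c (fst p) (snd p))"
  shows "cmp g (\<lambda>x. Option.bind (a x) (c x))"
proof -
  have "cmp g (\<lambda>x. case a x of None \<Rightarrow> None | Some v \<Rightarrow> c x v)" by (intro cmp_intros assms)
  moreover have "(\<lambda>x. case a x of None \<Rightarrow> None | Some v \<Rightarrow> c x v) = (\<lambda>x. Option.bind (a x) (c x))"
    by (auto split: option.split)
  ultimately show ?thesis by simp
qed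

lemma cmp_the [cmp_intros]: assumes "cmp g a" shows "cmp g (\<lambda>x. the (a x))"
proof -
  have "cmp g (\<lambda>x. case a x of None \<Rightarrow> the None | Some v \<Rightarrow> v)" by (intro cmp_intros assms)
  moreover have "(\<lambda>x. case a x of None \<Rightarrow> the None | Some v \<Rightarrow> v) = (\<lambda>x. the (a x))"
    by (auto split: option.split)
  ultimately show ?thesis by simp
qed

lemma cmp_prod_encode [cmp_intros]: assumes "cmp g a" shows "cmp g (\<lambda>x. prod_encode (a x))"
  using assms unfolding cmp_enc_iff[of g a, symmetric] by (simp add: enc_prod_def)

lemma cmp_prod_decode [cmp_intros]: assumes "cmp g a" shows "cmp g (\<lambda>x. prod_decode (a x))"
  using cmp_dec[OF assms, where 'b = "nat \<times> nat"] by (simp add: dec_prod_def)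

lemma computable_in_iff: "computable_in Z h \<longleftrightarrow> cmp (char_fun Z) h"
proof
  assume "computable_in Z h"
  then show "cmp (char_fun Z) h" unfolding computable_in_def phi_def cmp_def by auto
next
  assume "cmp (char_fun Z) h"
  then obtain p where "\<forall>n. run (char_fun Z) p n = Some (h n)" unfolding cmp_def by auto
  then show "computable_in Z h" unfolding computable_in_def phi_def
    by (intro exI[of _ "prog_num p"]) (simp add: bij_prog_num bij_is_inj)
qed

section \<open>Computable functions with rational values\<close>

definition crat :: "(nat \<Rightarrow> nat) \<Rightarrow> ('a::enc \<Rightarrow> real) \<Rightarrow> bool" where
  "crat g q \<longleftrightarrow> (\<exists>h. cmp g h \<and> (\<forall>x. q x = rat_num (h x)))"

lemma crat_rat_num [cmp_intros]: "cmp g a \<Longrightarrow> crat g (\<lambda>x. rat_num (a x))"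
  unfolding crat_def by blast

lemma rat_num_eq:
  "rat_num n = (let (i, j) = prod_decode n in
     (real (if even i then i div 2 else 0) - real (if even i then 0 else Suc (i div 2))) / real (Suc j))"
proof -
  obtain i j where ij: "prod_decode n = (i, j)" by fastforce
  have "real_of_int (int_decode i)
      = real (if even i then i div 2 else 0) - real (if even i then 0 else Suc (i div 2))"
    by (auto simp: int_decode_def sum_decode_def)
  then show ?thesis by (simp add: rat_num_def ij)
qed

lemma rat_num_encode:
  "rat_num (prod_encode (if b \<le> a then 2 * (a - b) else Suc (2 * (b - a - 1)), c))
     = (real a - real b) / real (Suc c)"
  by (auto simp: rat_num_eq of_nat_diff)

text \<open>Differences of natural numbers over a positive denominator: arithmetic on rationals
  reduces to sums and products of natural numbers. The values are exact, so comparisons are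
  decidable, which they would not be for reals given by approximations.\<close>

lemma crat_iff:
  "crat g q \<longleftrightarrow> (\<exists>a b c. cmp g a \<and> cmp g b \<and> cmp g c \<and>
     (\<forall>x. q x = (real (a x) - real (b x)) / real (Suc (c x))))" (is "_ \<longleftrightarrow> ?R")
proof
  assume "crat g q"
  then obtain h where h: "cmp g h" "\<And>x. q x = rat_num (h x)" unfolding crat_def by blast
  define a where "a x = (if even (fst (prod_decode (h x))) then fst (prod_decode (h x)) div 2 else 0)" for x
  define b where "b x = (if even (fst (prod_decode (h x))) then 0 else Suc (fst (prod_decode (h x)) div 2))" for x
  define c where "c x = snd (prod_decode (h x))" for x
  have eo: "cmp g (\<lambda>x. even (fst (prod_decode (h x))))"
    using cmp_not[OF cmp_odd[OF cmp_fst[OF cmp_prod_decode[OF h(1)]]]] by simp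
  have "cmp g a" "cmp g b" "cmp g c"
    unfolding a_def b_def c_def by (intro cmp_intros h(1) eo)+
  moreover have "q x = (real (a x) - real (b x)) / real (Suc (c x))" for x
    unfolding a_def b_def c_def h(2) rat_num_eq by (simp add: case_prod_beta)
  ultimately show ?R by blast
next
  assume ?R
  then obtain a b c where abc: "cmp g a" "cmp g b" "cmp g c"
    "\<And>x. q x = (real (a x) - real (b x)) / real (Suc (c x))" by blast
  have "cmp g (\<lambda>x. prod_encode (if b x \<le> a x then 2 * (a x - b x) else Suc (2 * (b x - a x - 1)), c x))"
    by (intro cmp_intros abc(1-3))
  then show "crat g q" unfolding crat_def abc(4) rat_num_encode[symmetric] by blast
qed

lemma crat_fracI:
  assumes "cmp g a" "cmp g b" "cmp g c"
    and "\<And>x. q x = (real (a x) - real (b x)) / real (Suc (c x))"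
  shows "crat g q"
  using assms unfolding crat_iff by blast

lemma crat_of_nat [cmp_intros]: assumes "cmp g a" shows "crat g (\<lambda>x. real (a x))"
  by (rule crat_fracI[OF assms cmp_const[of g 0] cmp_const[of g 0]]) simp

lemma crat_const_of_nat: "crat g (\<lambda>x. real n)"
  by (intro cmp_intros)

lemma crat_0 [cmp_intros]: "crat g (\<lambda>x. 0)" and crat_1 [cmp_intros]: "crat g (\<lambda>x. 1)"
  and crat_numeral [cmp_intros]: "crat g (\<lambda>x. numeral w)"
  using crat_const_of_nat[of g 0] crat_const_of_nat[of g 1] crat_const_of_nat[of g "numeral w"]
  by simp_all

lemma crat_add [cmp_intros]: assumes "crat g q" "crat g r" shows "crat g (\<lambda>x. q x + r x)"
proof -
  obtain a b c where abc: "cmp g a" "cmp g b" "cmp g c"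
    "\<And>x. q x = (real (a x) - real (b x)) / real (Suc (c x))" using assms(1) unfolding crat_iff by blast
  obtain a' b' c' where abc': "cmp g a'" "cmp g b'" "cmp g c'"
    "\<And>x. r x = (real (a' x) - real (b' x)) / real (Suc (c' x))" using assms(2) unfolding crat_iff by blast
  \<comment> \<open>The successor of \<open>c x * c' x + c x + c' x\<close> is the product of the
    two denominators.\<close>
  show ?thesis
    by (rule crat_fracI[where a = "\<lambda>x. a x * Suc (c' x) + a' x * Suc (c x)"
          and b = "\<lambda>x. b x * Suc (c' x) + b' x * Suc (c x)" and c = "\<lambda>x. c x * c' x + c x + c' x"])
       ((intro cmp_intros abc(1-3) abc'(1-3))+, simp add: abc(4) abc'(4) field_simps)
qed

lemma crat_mult [cmp_intros]: assumes "crat g q" "crat g r" shows "crat g (\<lambda>x. q x * r x)"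
proof -
  obtain a b c where abc: "cmp g a" "cmp g b" "cmp g c"
    "\<And>x. q x = (real (a x) - real (b x)) / real (Suc (c x))" using assms(1) unfolding crat_iff by blast
  obtain a' b' c' where abc': "cmp g a'" "cmp g b'" "cmp g c'"
    "\<And>x. r x = (real (a' x) - real (b' x)) / real (Suc (c' x))" using assms(2) unfolding crat_iff by blast
  show ?thesis
    by (rule crat_fracI[where a = "\<lambda>x. a x * a' x + b x * b' x"
          and b = "\<lambda>x. b x * a' x + b' x * a x" and c = "\<lambda>x. c x * c' x + c x + c' x"])
       ((intro cmp_intros abc(1-3) abc'(1-3))+, simp add: abc(4) abc'(4) field_simps)
qed

lemma crat_minus [cmp_intros]: assumes "crat g q" shows "crat g (\<lambda>x. - q x)"
proof -
  obtain a b c where abc: "cmp g a" "cmp g b" "cmp g c"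
    "\<And>x. q x = (real (a x) - real (b x)) / real (Suc (c x))" using assms(1) unfolding crat_iff by blast
  show ?thesis
    by (rule crat_fracI[OF abc(2,1,3)]) (simp add: abc(4) field_simps)
qed

lemma crat_diff [cmp_intros]: assumes "crat g q" "crat g r" shows "crat g (\<lambda>x. q x - r x)"
  using crat_add[OF assms(1) crat_minus[OF assms(2)]] by simp

lemma crat_divide_power2 [cmp_intros]:
  assumes "crat g q" "cmp g n" shows "crat g (\<lambda>x. q x / 2 ^ n x)"
proof -
  have "crat g (\<lambda>x. 1 / 2 ^ n x)"
    by (rule crat_fracI[where a = "\<lambda>x. 1" and b = "\<lambda>x. 0" and c = "\<lambda>x. 2 ^ n x - 1"])
       ((intro cmp_intros assms(2))+, simp add: of_nat_diff)
  from crat_mult[OF assms(1) this] show ?thesis by simp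
qed

lemma crat_power2 [cmp_intros]: assumes "cmp g n" shows "crat g (\<lambda>x. 2 ^ n x)"
  using crat_of_nat[OF cmp_power[OF cmp_const[of g 2] assms]] by simp

lemma cmp_crat_le [cmp_intros]:
  assumes "crat g q" "crat g r" shows "cmp g (\<lambda>x. q x \<le> r x)"
proof -
  obtain a b c where abc: "cmp g a" "cmp g b" "cmp g c"
    "\<And>x. r x - q x = (real (a x) - real (b x)) / real (Suc (c x))"
    using crat_diff[OF assms(2,1)] unfolding crat_iff by blast
  have "cmp g (\<lambda>x. b x \<le> a x)" by (intro cmp_intros abc)
  moreover have "b x \<le> a x \<longleftrightarrow> q x \<le> r x" for x
  proof -
    have "b x \<le> a x \<longleftrightarrow> 0 \<le> r x - q x"
      unfolding abc(4) by (simp add: zero_le_divide_iff)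
    then show ?thesis by simp
  qed
  ultimately show ?thesis by simp
qed

lemma cmp_crat_less [cmp_intros]:
  assumes "crat g q" "crat g r" shows "cmp g (\<lambda>x. q x < r x)"
  using cmp_not[OF cmp_crat_le[OF assms(2,1)]] by (simp add: not_le)

lemma crat_if [cmp_intros]:
  assumes "cmp g P" "crat g q" "crat g r" shows "crat g (\<lambda>x. if P x then q x else r x)"
proof -
  obtain h k where hk: "cmp g h" "\<And>x. q x = rat_num (h x)" "cmp g k" "\<And>x. r x = rat_num (k x)"
    using assms(2,3) unfolding crat_def by blast
  have "crat g (\<lambda>x. rat_num (if P x then h x else k x))"
    by (intro cmp_intros assms(1) hk)
  moreover have "(\<lambda>x. rat_num (if P x then h x else k x)) = (\<lambda>x. if P x then q x else r x)"
    by (auto simp: hk)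
  ultimately show ?thesis by simp
qed

lemma crat_abs [cmp_intros]: assumes "crat g q" shows "crat g (\<lambda>x. \<bar>q x\<bar>)"
  unfolding abs_if by (intro cmp_intros assms)

lemma prod_decode_0 [simp]: "prod_decode 0 = (0, 0)"
proof -
  have "prod_encode (0, 0) = 0" by (simp add: prod_encode_def)
  then show ?thesis by (metis prod_encode_inverse)
qed

lemma rat_num_0 [simp]: "rat_num 0 = 0"
  by (simp add: rat_num_eq)

lemma crat_sum [cmp_intros]:
  fixes e :: "'a::enc \<Rightarrow> nat \<Rightarrow> real"
  assumes "cmp g b" "crat g (\<lambda>p. e (fst p) (snd p))" shows "crat g (\<lambda>x. \<Sum>i<b x. e x i)"
proof -
  obtain h where h: "cmp g h" "\<And>p. e (fst p) (snd p) = rat_num (h p)"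
    using assms(2) unfolding crat_def by blast
  \<comment> \<open>Summation takes place on indices: \<open>ad\<close> sends indices of two
    rationals to an index of their sum, and the recursion starts at 0, an index of the rational
    0.\<close>
  have "crat g (\<lambda>p. rat_num (fst p) + rat_num (snd p))" by (intro cmp_intros)
  then obtain ad where ad: "cmp g ad" "\<And>p. rat_num (fst p) + rat_num (snd p) = rat_num (ad p)"
    unfolding crat_def by blast
  have "cmp g (\<lambda>x. rec_nat 0 (\<lambda>i r. ad (r, h (x, i))) (b x))"
    by (intro cmp_intros assms(1) cmp_compose[OF ad(1)] cmp_compose[OF h(1)])
  moreover have "rat_num (rec_nat 0 (\<lambda>i r. ad (r, h (x, i))) v) = (\<Sum>i<v. e x i)" for x v
  proof (induction v)
    case 0
    then show ?case by simp
  next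
    case (Suc v)
    then show ?case using ad(2)[of "(rec_nat 0 (\<lambda>i r. ad (r, h (x, i))) v, h (x, v))"] h(2)[of "(x, v)"]
      by simp
  qed
  ultimately show ?thesis unfolding crat_def
    by (intro exI[of _ "\<lambda>x. rec_nat 0 (\<lambda>i r. ad (r, h (x, i))) (b x)"]) simp
qed

section \<open>Rational intervals as a base of the topology\<close>

lemma rat_num_surj: "q \<in> \<rat> \<Longrightarrow> \<exists>n. rat_num n = q"
proof -
  assume "q \<in> \<rat>"
  then obtain a :: int and b :: nat where ab: "b > 0" "q = of_int a / of_nat b"
    by (metis Rats_cases' of_int_of_nat_eq zero_less_imp_eq_int of_nat_0_less_iff)
  then have "rat_num (prod_encode (int_encode a, b - 1)) = q"
    by (simp add: rat_num_def)
  then show ?thesis by blast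
qed

lemma rat_num_dense: "a < b \<Longrightarrow> \<exists>n. a < rat_num n \<and> rat_num n < b"
  using Rats_dense_in_real[of a b] rat_num_surj by metis

abbreviation lo :: "nat \<Rightarrow> real" where "lo j \<equiv> rat_num (fst (prod_decode j))"
abbreviation hi :: "nat \<Rightarrow> real" where "hi j \<equiv> rat_num (snd (prod_decode j))"

lemma basic_open_eq: "basic_open j = {lo j <..< hi j}"
  by (simp add: basic_open_def case_prod_beta)

lemma open_basic_open [simp]: "open (basic_open j)"
  by (simp add: basic_open_eq)

lemma basic_open_0 [simp]: "basic_open 0 = {}"
  by (simp add: basic_open_eq)

lemma basic_open_within:
  assumes "a < x" "x < b"
  obtains j where "x \<in> basic_open j" "a \<le> lo j" "hi j \<le> b"
proof -
  obtain m n where "a < rat_num m" "rat_num m < x" "x < rat_num n" "rat_num n < b"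
    using rat_num_dense[OF assms(1)] rat_num_dense[OF assms(2)] by auto
  then show thesis by (intro that[of "prod_encode (m, n)"]) (auto simp: basic_open_eq)
qed

lemma basic_open_around:
  assumes "open S" "x \<in> S" shows "\<exists>j. x \<in> basic_open j \<and> basic_open j \<subseteq> S"
proof -
  obtain e where e: "e > 0" "\<And>y. \<bar>y - x\<bar> < e \<Longrightarrow> y \<in> S"
    using assms by (auto simp: open_dist dist_real_def)
  obtain j where j: "x \<in> basic_open j" "x - e \<le> lo j" "hi j \<le> x + e"
    using basic_open_within[of "x - e" x "x + e"] e(1) by auto
  have "basic_open j \<subseteq> S"
  proof
    fix y assume "y \<in> basic_open j"
    then show "y \<in> S" using j(2,3) by (intro e(2)) (simp add: basic_open_eq abs_less_iff)
  qed
  then show ?thesis using j(1) by blast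
qed

subsection \<open>Clocked evaluation\<close>

text \<open>
  The bound \<open>s\<close> limits both the oracle queries and the searches, so that the outcome depends on
  finitely many values of the oracle only.
\<close>

primrec runs :: "(nat \<Rightarrow> nat) \<Rightarrow> nat \<Rightarrow> prog \<Rightarrow> nat \<Rightarrow> nat option" where
  "runs g s PZero = (\<lambda>n. Some 0)"
| "runs g s PSucc = (\<lambda>n. Some (Suc n))"
| "runs g s PLeft = (\<lambda>n. Some (fst (prod_decode n)))"
| "runs g s PRight = (\<lambda>n. Some (snd (prod_decode n)))"
| "runs g s PQuery = (\<lambda>n. if n < s then Some (g n) else None)"
| "runs g s (PPair p q) = (\<lambda>n. Option.bind (runs g s p n)
     (\<lambda>a. Option.bind (runs g s q n) (\<lambda>b. Some (prod_encode (a, b)))))"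
| "runs g s (PComp p q) = (\<lambda>n. Option.bind (runs g s q n) (runs g s p))"
| "runs g s (PRec p q) = (\<lambda>n.
     rec_nat (runs g s p (fst (prod_decode n)))
       (\<lambda>i r. Option.bind r (\<lambda>b. runs g s q (prod_encode (fst (prod_decode n), prod_encode (i, b)))))
       (snd (prod_decode n)))"
| "runs g s (PMu p) = (\<lambda>a.
     let k = (LEAST k. s \<le> k \<or> runs g s p (prod_encode (a, k)) = None \<or>
                       runs g s p (prod_encode (a, k)) = Some 0)
     in if k < s \<and> runs g s p (prod_encode (a, k)) = Some 0 then Some k else None)"

text \<open>The program is fixed, so induction on it takes the place of a universal machine. The
  oracle \<open>G\<close> depends on a parameter; this later allows a number that codes a finite
  string to act as the oracle.\<close>

lemma cmp_runs:
  fixes G :: "'a::enc \<Rightarrow> nat \<Rightarrow> nat"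
  assumes G: "cmp h (\<lambda>z. G (fst z) (snd z))"
  shows "cmp h (\<lambda>z. runs (G (fst z)) (fst (snd z)) p (snd (snd z)))"
proof (induction p)
  case PQuery
  show ?case by (simp, intro cmp_intros cmp2[OF G])
next
  case (PPair p q)
  note I = cmp3[where F = "\<lambda>a b c. runs (G a) b p c", OF PPair.IH(1)]
    cmp3[where F = "\<lambda>a b c. runs (G a) b q c", OF PPair.IH(2)]
  show ?case by (simp, intro cmp_intros I)
next
  case (PComp p q)
  note I = cmp3[where F = "\<lambda>a b c. runs (G a) b p c", OF PComp.IH(1)]
    cmp3[where F = "\<lambda>a b c. runs (G a) b q c", OF PComp.IH(2)]
  show ?case by (simp, intro cmp_intros I)
next
  case (PRec p q)
  note I = cmp3[where F = "\<lambda>a b c. runs (G a) b p c", OF PRec.IH(1)]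
    cmp3[where F = "\<lambda>a b c. runs (G a) b q c", OF PRec.IH(2)]
  show ?case by (simp, intro cmp_intros I)
next
  case (PMu p)
  note I = cmp3[where F = "\<lambda>a b c. runs (G a) b p c", OF PMu.IH]
  \<comment> \<open>The bounded search is total because \<open>k = s\<close> always ends it.\<close>
  show ?case by (simp add: Let_def, intro cmp_intros I) (rule exI, rule disjI1, rule order_refl)+
qed (simp, intro cmp_intros)+

lemma runs_cong: "(\<And>n. n < s \<Longrightarrow> g n = g' n) \<Longrightarrow> runs g s p = runs g' s p"
  by (induction p) auto

lemma runs_sound: "runs g s p n = Some v \<Longrightarrow> run g p n = Some v"
proof (induction p arbitrary: n v)
  case (PRec p q)
  obtain a k where nk: "prod_decode n = (a, k)" by fastforce
  have "rec_nat (runs g s p a)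
       (\<lambda>i r. Option.bind r (\<lambda>b. runs g s q (prod_encode (a, prod_encode (i, b))))) k = Some v
     \<Longrightarrow> rec_nat (run g p a)
       (\<lambda>i r. Option.bind r (\<lambda>b. run g q (prod_encode (a, prod_encode (i, b))))) k = Some v"
    by (induction k arbitrary: v) (auto simp: bind_eq_Some_conv PRec.IH)
  then show ?case using PRec.prems by (simp add: nk)
next
  case (PMu p)
  define k where "k = (LEAST k. s \<le> k \<or> runs g s p (prod_encode (n, k)) = None \<or>
    runs g s p (prod_encode (n, k)) = Some 0)"
  have k: "k < s" "runs g s p (prod_encode (n, k)) = Some 0" "v = k"
    using PMu.prems by (auto simp: k_def Let_def split: if_splits)
  have j: "\<exists>w. runs g s p (prod_encode (n, j)) = Some w \<and> w \<noteq> 0" if "j < k" for j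
    using not_less_Least[OF that[unfolded k_def]] by auto
  have r: "run g p (prod_encode (n, k)) = Some 0" using k PMu.IH by blast
  have rj: "\<exists>w. run g p (prod_encode (n, j)) = Some w \<and> w \<noteq> 0" if "j < k" for j
    using j[OF that] PMu.IH by blast
  have "(LEAST k. run g p (prod_encode (n, k)) = Some 0) = k"
  proof (rule Least_equality)
    fix y assume "run g p (prod_encode (n, y)) = Some 0"
    then show "k \<le> y" using rj[of y] by (cases "y < k") auto
  qed (rule r)
  moreover have "\<exists>k. run g p (prod_encode (n, k)) = Some 0 \<and> (\<forall>j<k. run g p (prod_encode (n, j)) \<noteq> None)"
    using r rj by (intro exI[of _ k]) fastforce
  ultimately show ?case using k(3) by simp
qed (auto simp: bind_eq_Some_conv split: if_splits)

text \<open>Claiming success for all large bounds, rather than for some bound, lets the bounds of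
  subcomputations be merged by a maximum.\<close>

lemma runs_complete: "run g p n = Some v \<Longrightarrow> \<exists>s0. \<forall>s\<ge>s0. runs g s p n = Some v"
proof (induction p arbitrary: n v)
  case PQuery
  then show ?case by (intro exI[of _ "Suc n"]) auto
next
  case (PPair p q)
  then obtain a b where ab: "run g p n = Some a" "run g q n = Some b" "v = prod_encode (a, b)"
    by (auto simp: bind_eq_Some_conv)
  obtain s1 s2 where "\<forall>s\<ge>s1. runs g s p n = Some a" "\<forall>s\<ge>s2. runs g s q n = Some b"
    using PPair.IH ab by blast
  then show ?case using ab(3) by (intro exI[of _ "max s1 s2"]) auto
next
  case (PComp p q)
  then obtain a where ab: "run g q n = Some a" "run g p a = Some v"
    by (auto simp: bind_eq_Some_conv)
  obtain s1 s2 where "\<forall>s\<ge>s1. runs g s q n = Some a" "\<forall>s\<ge>s2. runs g s p a = Some v"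
    using PComp.IH ab by blast
  then show ?case by (intro exI[of _ "max s1 s2"]) auto
next
  case (PRec p q)
  obtain a k where nk: "prod_decode n = (a, k)" by fastforce
  have "rec_nat (run g p a)
       (\<lambda>i r. Option.bind r (\<lambda>b. run g q (prod_encode (a, prod_encode (i, b))))) k = Some v
     \<Longrightarrow> \<exists>s0. \<forall>s\<ge>s0. rec_nat (runs g s p a)
       (\<lambda>i r. Option.bind r (\<lambda>b. runs g s q (prod_encode (a, prod_encode (i, b))))) k = Some v"
  proof (induction k arbitrary: v)
    case 0
    then show ?case using PRec.IH by simp
  next
    case (Suc k)
    then obtain u where u: "rec_nat (run g p a)
       (\<lambda>i r. Option.bind r (\<lambda>b. run g q (prod_encode (a, prod_encode (i, b))))) k = Some u"
      "run g q (prod_encode (a, prod_encode (k, u))) = Some v"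
      by (auto simp: bind_eq_Some_conv)
    obtain s1 where s1: "\<forall>s\<ge>s1. rec_nat (runs g s p a)
       (\<lambda>i r. Option.bind r (\<lambda>b. runs g s q (prod_encode (a, prod_encode (i, b))))) k = Some u"
      using Suc.IH[OF u(1)] by blast
    obtain s2 where s2: "\<forall>s\<ge>s2. runs g s q (prod_encode (a, prod_encode (k, u))) = Some v"
      using PRec.IH(2)[OF u(2)] by blast
    show ?case using s1 s2 by (intro exI[of _ "max s1 s2"]) auto
  qed
  then show ?case using PRec.prems by (simp add: nk)
next
  case (PMu p)
  have ex: "\<exists>k. run g p (prod_encode (n, k)) = Some 0 \<and> (\<forall>j<k. run g p (prod_encode (n, j)) \<noteq> None)"
    using PMu.prems by (auto split: if_splits)
  have v: "v = (LEAST k. run g p (prod_encode (n, k)) = Some 0)"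
    using PMu.prems by (auto split: if_splits)
  have r: "run g p (prod_encode (n, v)) = Some 0"
    unfolding v by (rule LeastI_ex) (use ex in blast)
  have rj: "\<exists>w. run g p (prod_encode (n, j)) = Some w \<and> w \<noteq> 0" if "j < v" for j
  proof -
    have ne: "run g p (prod_encode (n, j)) \<noteq> Some 0" using that not_less_Least v by blast
    obtain k where k: "run g p (prod_encode (n, k)) = Some 0" "\<forall>j<k. run g p (prod_encode (n, j)) \<noteq> None"
      using ex by blast
    have "v \<le> k" using k(1) v by (simp add: Least_le)
    then have "run g p (prod_encode (n, j)) \<noteq> None" using k(2) that by simp
    then show ?thesis using ne by auto
  qed
  obtain s0 where s0: "\<forall>s\<ge>s0. runs g s p (prod_encode (n, v)) = Some 0"
    using PMu.IH r by blast
  have "\<forall>j<v. \<exists>s1. \<forall>s\<ge>s1. \<exists>w. runs g s p (prod_encode (n, j)) = Some w \<and> w \<noteq> 0"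
    using PMu.IH rj by meson
  then obtain s1 where s1: "\<And>j s. j < v \<Longrightarrow> s1 j \<le> s \<Longrightarrow> \<exists>w. runs g s p (prod_encode (n, j)) = Some w \<and> w \<noteq> 0"
    by metis
  \<comment> \<open>The sum dominates every \<open>s1 j\<close> with \<open>j < v\<close>, and
    \<open>Suc v\<close> lets the clocked search reach \<open>v\<close>.\<close>
  define t where "t = max (Suc v) (max s0 (\<Sum>j<v. s1 j))"
  have "runs g s (PMu p) n = Some v" if "t \<le> s" for s
  proof -
    have sj: "\<exists>w. runs g s p (prod_encode (n, j)) = Some w \<and> w \<noteq> 0" if "j < v" for j
    proof (rule s1[OF that])
      have "s1 j \<le> (\<Sum>j<v. s1 j)" using that by (intro member_le_sum) auto
      then show "s1 j \<le> s" using \<open>t \<le> s\<close> by (simp add: t_def)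
    qed
    have v0: "runs g s p (prod_encode (n, v)) = Some 0" "v < s"
      using s0 \<open>t \<le> s\<close> by (auto simp: t_def)
    have "(LEAST k. s \<le> k \<or> runs g s p (prod_encode (n, k)) = None \<or>
      runs g s p (prod_encode (n, k)) = Some 0) = v"
    proof (rule Least_equality)
      fix y assume "s \<le> y \<or> runs g s p (prod_encode (n, y)) = None \<or> runs g s p (prod_encode (n, y)) = Some 0"
      then show "v \<le> y" using sj[of y] v0 by (cases "y < v") auto
    qed (simp add: v0)
    then show ?thesis using v0 by (simp add: Let_def)
  qed
  then show ?case by blast
qed auto

section \<open>Computably enumerable sets and the jump\<close>

lemma ce_inI:
  fixes R :: "nat \<Rightarrow> 'b::enc \<Rightarrow> bool"
  assumes "cmp (char_fun Z) (\<lambda>p. R (fst p) (snd p))"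
  shows "ce_in Z {n. \<exists>s. R n s}"
proof -
  \<comment> \<open>\<open>PMu\<close> counts through the natural numbers, so witnesses are reached
    by decoding the counter. As the test is total, the search halts exactly when a witness
    exists.\<close>
  have "cmp (char_fun Z) (\<lambda>p. if R (fst p) (dec (snd p)) then 0 else (1::nat))"
    by (intro cmp_intros cmp2[OF assms])
  then obtain p where p: "\<And>x. run (char_fun Z) p (enc x) = Some (if R (fst x) (dec (snd x)) then 0 else 1)"
    unfolding cmp_def enc_nat_def by blast
  have q: "run (char_fun Z) p (prod_encode (n, k)) = Some (if R n (dec k) then 0 else 1)" for n k
    using p[of "(n, k)"] by (simp add: enc_prod_def)
  have ex: "(\<exists>s. R n s) \<longleftrightarrow> (\<exists>k. R n (dec k))" for n
    by (metis dec_enc)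
  have "{n. \<exists>s. R n s} = {n. phi Z (prog_num (PMu p)) n \<noteq> None}"
    unfolding phi_def inv_f_f[OF bij_is_inj[OF bij_prog_num]] by (simp add: q ex)
  then show ?thesis unfolding ce_in_def by blast
qed

text \<open>The stage \<open>s\<close> stands for all clock bounds up to \<open>s\<close>. This
  makes \<open>R\<close> monotone, so that finitely many enumerations can be awaited at one common
  stage.\<close>

lemma ce_inE:
  assumes "ce_in Z W"
  obtains R where "cmp (char_fun Z) (\<lambda>p. R (fst p) (snd p))" "W = {n. \<exists>s::nat. R n s}"
    "\<And>n s t. R n s \<Longrightarrow> s \<le> t \<Longrightarrow> R n t"
proof -
  obtain p where W: "W = {n. run (char_fun Z) p n \<noteq> None}"
    using assms unfolding ce_in_def phi_def by blast
  have 1: "cmp (char_fun Z) (\<lambda>z :: nat \<times> nat. char_fun Z (snd z))"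
    by (rule cmp_compose[OF cmp_oracle]) (intro cmp_intros)
  note I = cmp3[where F = "\<lambda>a b c. runs (char_fun Z) b p c", OF cmp_runs[where G = "\<lambda>_. char_fun Z", OF 1]]
  define R where "R n s = (\<exists>t<Suc s. runs (char_fun Z) t p n \<noteq> None)" for n s
  have "cmp (char_fun Z) (\<lambda>x. R (fst x) (snd x))"
    unfolding R_def by (intro cmp_intros I[where a = "\<lambda>_. 0"])
  moreover have "W = {n. \<exists>s. R n s}"
  proof -
    have "run (char_fun Z) p n \<noteq> None \<longleftrightarrow> (\<exists>s. runs (char_fun Z) s p n \<noteq> None)" for n
    proof
      assume "run (char_fun Z) p n \<noteq> None"
      then obtain v where "run (char_fun Z) p n = Some v" by blast
      from runs_complete[OF this] show "\<exists>s. runs (char_fun Z) s p n \<noteq> None" by auto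
    next
      assume "\<exists>s. runs (char_fun Z) s p n \<noteq> None"
      then show "run (char_fun Z) p n \<noteq> None" using runs_sound by fastforce
    qed
    then show ?thesis unfolding W R_def by (auto simp: less_Suc_eq_le)
  qed
  moreover have "R n t" if "R n s" "s \<le> t" for n s t
    using that unfolding R_def by (auto simp: less_Suc_eq_le) (meson order_trans not_None_eq)
  ultimately show thesis using that by blast
qed

lemma turing_le_refl: "turing_le A A"
  unfolding turing_le_def computable_in_iff by (rule cmp_oracle)

text \<open>The program \<open>PComp p (const_prog n)\<close> ignores its input. It therefore halts
  on its own index exactly when \<open>p\<close> halts on \<open>n\<close>, and that index is
  computable from \<open>n\<close>.\<close>

lemma ce_decidable_jump:
  assumes "ce_in {} W" shows "cmp (char_fun (jump {})) (\<lambda>n. n \<in> W)"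
proof -
  obtain p where W: "W = {n. run (char_fun {}) p n \<noteq> None}"
    using assms unfolding ce_in_def phi_def by blast
  define e where "e n = prog_num (PComp p (const_prog n))" for n
  \<comment> \<open>The recursion mirrors the numbering: 6 and 4 come from the clause for
    \<open>PComp\<close>, and 1 is the number of \<open>PSucc\<close>.\<close>
  define c where "c n = rec_nat 0 (\<lambda>i r. 6 + 4 * prod_encode (1, r)) n" for n :: nat
  have c: "prog_num (const_prog n) = c n" for n by (induction n) (auto simp: c_def)
  have "n \<in> W \<longleftrightarrow> e n \<in> jump {}" for n
    unfolding jump_def phi_def W e_def
    by (simp add: inv_f_f[OF bij_is_inj[OF bij_prog_num]] del: prog_num.simps)
  then have eq: "n \<in> W \<longleftrightarrow> char_fun (jump {}) (6 + 4 * prod_encode (prog_num p, c n)) = 1" for n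
    by (simp add: char_fun_def e_def c)
  show ?thesis unfolding eq c_def
    by (intro cmp_intros cmp_compose[OF cmp_oracle])
qed

subsection \<open>Dyadic cells\<close>

lemma pow_half_less:
  assumes "e > (0 :: real)" shows "\<exists>n\<ge>m. 1 / 2 ^ n < e"
proof -
  obtain n where n: "(1/2) ^ n < e" using assms real_arch_pow_inv[of e "1/2"] by auto
  have "1 / 2 ^ (max m n) \<le> (1 / 2 ^ n :: real)" by (intro frac_le power_increasing) auto
  then show ?thesis using n by (intro exI[of _ "max m n"]) (auto simp: power_one_over)
qed

text \<open>Two kinds of cells are kept side by side. Closed cells cover the unit interval and have
  compact images; open cells of one level are disjoint, which makes preimages found in different
  cells different.\<close>

definition cell :: "nat \<Rightarrow> nat \<Rightarrow> real set" where
  "cell l k = {real k / 2 ^ l .. (real k + 1) / 2 ^ l}"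

definition ocell :: "nat \<Rightarrow> nat \<Rightarrow> real set" where
  "ocell l k = {real k / 2 ^ l <..< (real k + 1) / 2 ^ l}"

lemma ocell_subset_cell: "ocell l k \<subseteq> cell l k"
  by (auto simp: ocell_def cell_def)

lemma compact_cell [simp]: "compact (cell l k)" and connected_cell [simp]: "connected (cell l k)"
  by (auto simp: cell_def)

lemma cell_nonempty [simp]: "cell l k \<noteq> {}"
  by (auto simp: cell_def divide_simps)

lemma cell_endpoints: "real k / 2 ^ l \<in> cell l k" "(real k + 1) / 2 ^ l \<in> cell l k"
  by (simp_all add: cell_def divide_right_mono)

lemma cell_dist:
  assumes "x \<in> cell l k" "y \<in> cell l k" "m \<le> l" shows "\<bar>x - y\<bar> \<le> 1 / 2 ^ m"
proof -
  have "\<bar>x - y\<bar> \<le> 1 / 2 ^ l" using assms(1,2) by (auto simp: cell_def add_divide_distrib)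
  also have "\<dots> \<le> 1 / 2 ^ m" using assms(3) by (simp add: frac_le)
  finally show ?thesis .
qed

lemma cell_subset_unit: "k < 2 ^ l \<Longrightarrow> cell l k \<subseteq> {0..1}"
proof -
  assume "k < 2 ^ l"
  then have "real (Suc k) \<le> real (2 ^ l)" unfolding of_nat_le_iff by simp
  then have "real k + 1 \<le> 2 ^ l" by simp
  then have "(real k + 1) / 2 ^ l \<le> 1" by simp
  moreover have "0 \<le> real k / 2 ^ l" by simp
  ultimately show ?thesis unfolding cell_def by (meson atLeastatMost_subset_iff)
qed

lemma cell_ex:
  assumes "x \<in> {0..1}" shows "\<exists>k<2 ^ l. x \<in> cell l k"
proof (cases "x = 1")
  case True
  \<comment> \<open>At \<open>x = 1\<close> the floor used below would give \<open>2 ^ l\<close>,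
    one more than the last index.\<close>
  then show ?thesis by (intro exI[of _ "2 ^ l - 1"]) (simp add: cell_def of_nat_diff)
next
  case False
  define k where "k = nat \<lfloor>x * 2 ^ l\<rfloor>"
  have x: "0 \<le> x" "x < 1" using assms False by auto
  have k: "real k \<le> x * 2 ^ l" "x * 2 ^ l < real k + 1"
    using x by (auto simp: k_def)
  have "real k < 2 ^ l" using k(1) x by (smt (verit) mult_le_cancel_right1 zero_less_power)
  then have "k < 2 ^ l" by (metis of_nat_less_iff of_nat_numeral of_nat_power)
  then show ?thesis using k by (intro exI[of _ k]) (simp add: cell_def field_simps)
qed

text \<open>\<open>k' div 2 ^ d\<close> is the index of the ancestor, \<open>d\<close> levels up, of
  the cell with index \<open>k'\<close>.\<close>

lemma cell_refine:
  "real k' / 2 ^ (l + d) \<ge> real (k' div 2 ^ d) / 2 ^ l"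
  "(real k' + 1) / 2 ^ (l + d) \<le> (real (k' div 2 ^ d) + 1) / 2 ^ l"
proof -
  have "k' div 2 ^ d * 2 ^ d \<le> k'" by simp
  then have "real (k' div 2 ^ d) * 2 ^ d \<le> real k'"
    by (metis of_nat_le_iff of_nat_mult of_nat_numeral of_nat_power)
  then show "real k' / 2 ^ (l + d) \<ge> real (k' div 2 ^ d) / 2 ^ l"
    by (simp add: power_add field_simps)
  have "Suc k' \<le> Suc (k' div 2 ^ d) * 2 ^ d"
    using dividend_less_div_times[of "2 ^ d" k'] by simp
  then have "real (Suc k') \<le> real (Suc (k' div 2 ^ d) * 2 ^ d)" unfolding of_nat_le_iff .
  then have "real k' + 1 \<le> (real (k' div 2 ^ d) + 1) * 2 ^ d" by (simp add: algebra_simps)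
  then have "(real k' + 1) / 2 ^ (l + d) \<le> (real (k' div 2 ^ d) + 1) * 2 ^ d / 2 ^ (l + d)"
    by (intro divide_right_mono) auto
  then show "(real k' + 1) / 2 ^ (l + d) \<le> (real (k' div 2 ^ d) + 1) / 2 ^ l"
    by (simp add: power_add)
qed

lemma cell_refine_subset: "cell (l + d) k' \<subseteq> cell l (k' div 2 ^ d)"
  and ocell_refine_subset: "ocell (l + d) k' \<subseteq> ocell l (k' div 2 ^ d)"
  using cell_refine(1)[where k' = k' and d = d and l = l] cell_refine(2)[where k' = k' and d = d and l = l]
  by (auto simp: cell_def ocell_def)

lemma cell_sub_ex:
  assumes "x \<in> cell l k"
  shows "\<exists>k'. k' div 2 ^ d = k \<and> x \<in> cell (l + d) k'"
proof -
  define y where "y = x * 2 ^ l - real k"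
  have y: "y \<in> {0..1}" using assms by (auto simp: y_def cell_def field_simps)
  then obtain j where j: "j < 2 ^ d" "y \<in> cell d j" using cell_ex by blast
  have x: "x * 2 ^ (l + d) = y * 2 ^ d + real k * 2 ^ d"
    by (simp add: y_def power_add algebra_simps)
  have "real j \<le> y * 2 ^ d" "y * 2 ^ d \<le> real j + 1"
    using j(2) by (auto simp: cell_def field_simps)
  then have "real (k * 2 ^ d + j) \<le> x * 2 ^ (l + d)" "x * 2 ^ (l + d) \<le> real (k * 2 ^ d + j) + 1"
    unfolding x by simp_all
  then have "x \<in> cell (l + d) (k * 2 ^ d + j)"
    unfolding cell_def by (simp add: divide_le_eq le_divide_eq)
  then show ?thesis using j(1) by (intro exI[of _ "k * 2 ^ d + j"]) simp
qed

lemma cell_around: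
  assumes "open S" "x \<in> S" "x \<in> {0..1}"
  shows "\<exists>m. \<forall>l\<ge>m. \<forall>k. x \<in> cell l k \<longrightarrow> cell l k \<subseteq> S"
proof -
  obtain e where e: "e > 0" "\<And>y. \<bar>y - x\<bar> < e \<Longrightarrow> y \<in> S"
    using assms by (auto simp: open_dist dist_real_def)
  obtain m where m: "1 / 2 ^ m < e" using pow_half_less[OF e(1), of 0] by blast
  have "cell l k \<subseteq> S" if "m \<le> l" "x \<in> cell l k" for l k
  proof
    fix y assume "y \<in> cell l k"
    then have "\<bar>y - x\<bar> \<le> 1 / 2 ^ m" using cell_dist that by blast
    then show "y \<in> S" using m by (intro e(2)) simp
  qed
  then show ?thesis by blast
qed

lemma ocell_disjoint: "x \<in> ocell l k \<Longrightarrow> x \<in> ocell l k' \<Longrightarrow> k = k'"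
proof (rule ccontr)
  assume x: "x \<in> ocell l k" "x \<in> ocell l k'" and "k \<noteq> k'"
  then have "real k + 1 \<le> real k' \<or> real k' + 1 \<le> real k" by linarith
  then have "(real k + 1) / 2 ^ l \<le> real k' / 2 ^ l \<or> (real k' + 1) / 2 ^ l \<le> real k / 2 ^ l"
    by (auto simp: divide_right_mono)
  then show False using x by (auto simp: ocell_def)
qed

section \<open>Dyadic variation and the measure of images of cells\<close>

definition inc :: "(real \<Rightarrow> real) \<Rightarrow> nat \<Rightarrow> nat \<Rightarrow> real" where
  "inc f l k = \<bar>f ((real k + 1) / 2 ^ l) - f (real k / 2 ^ l)\<bar>"

abbreviation Var :: "(real \<Rightarrow> real) \<Rightarrow> nat \<Rightarrow> nat set \<Rightarrow> real" where
  "Var f l X \<equiv> (\<Sum>k\<in>X. inc f l k)"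

lemma inc_nonneg [simp]: "0 \<le> inc f l k"
  by (simp add: inc_def)

lemma inc_telescope:
  "m \<le> n \<Longrightarrow> \<bar>f (real n / 2 ^ l) - f (real m / 2 ^ l)\<bar> \<le> Var f l {m..<n}"
proof (induction rule: dec_induct)
  case (step n)
  have "\<bar>f (real (Suc n) / 2 ^ l) - f (real n / 2 ^ l)\<bar> = inc f l n"
    by (simp add: inc_def add.commute)
  moreover have "Var f l {m..<Suc n} = Var f l {m..<n} + inc f l n"
    using step by (simp add: sum.atLeastLessThan_Suc)
  ultimately show ?case using step by linarith
qed simp

lemma interval_image:
  fixes f :: "real \<Rightarrow> real"
  assumes "continuous_on S f" "compact S" "connected S" "S \<noteq> {}"
  obtains a b where "a \<in> S" "b \<in> S" "f ` S = {f a .. f b}" "f a \<le> f b"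
proof -
  obtain u v where uv: "f ` S = {u..v}"
    using connected_compact_interval_1[of "f ` S"] assms compact_continuous_image
      connected_continuous_image by (metis)
  moreover have "u \<le> v" using assms(4) uv by (metis atLeastatMost_empty_iff2 image_is_empty not_le)
  ultimately have "u \<in> f ` S" "v \<in> f ` S" by auto
  then obtain a b where "a \<in> S" "b \<in> S" "u = f a" "v = f b" by blast
  then show thesis using that[of a b] uv \<open>u \<le> v\<close> by simp
qed

text \<open>Variation is recorded along dyadic partitions: by continuity, increments over fine
  dyadic cells recover the length of the image of a cell (\<open>osc_le\<close>).\<close>

locale bv_fun =
  fixes f :: "real \<Rightarrow> real" and V :: real
  assumes cont: "continuous_on {0..1} f"
    and bv: "\<And>l. Var f l {..<2 ^ l} \<le> V"
begin

lemma cont_cell: "k < 2 ^ l \<Longrightarrow> continuous_on (cell l k) f"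
  using cont cell_subset_unit continuous_on_subset by blast

lemma compact_image_cell: "k < 2 ^ l \<Longrightarrow> compact (f ` cell l k)"
  by (intro compact_continuous_image cont_cell) auto

lemma emeasure_image_cell:
  "k < 2 ^ l \<Longrightarrow> emeasure lborel (f ` cell l k) = ennreal (measure lborel (f ` cell l k))"
  using emeasure_compact_finite[OF compact_image_cell]
  by (metis emeasure_eq_ennreal_measure infinity_ennreal_def less_irrefl)

lemma image_cell_borel [measurable]: "k < 2 ^ l \<Longrightarrow> f ` cell l k \<in> sets borel"
  using compact_image_cell by (simp add: borel_compact)

text \<open>The image is an interval from \<open>f a\<close> to \<open>f b\<close>. By uniform
  continuity \<open>a\<close> and \<open>b\<close> may be moved to points of a fine grid at a cost
  of \<open>\<eta> / 2\<close> each, and between grid points the increments telescope. The claim for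
  all large \<open>d\<close> lets finitely many cells share one refinement.\<close>

lemma osc_le:
  assumes "k < 2 ^ l" "\<eta> > 0"
  shows "\<exists>D. \<forall>d\<ge>D. measure lborel (f ` cell l k) \<le> Var f (l + d) {k * 2 ^ d..<Suc k * 2 ^ d} + \<eta>"
proof -
  obtain a b where ab: "a \<in> cell l k" "b \<in> cell l k" "f ` cell l k = {f a .. f b}" "f a \<le> f b"
    using interval_image[OF cont_cell[OF assms(1)]] by auto
  have m: "measure lborel (f ` cell l k) = f b - f a" using ab by simp
  have "uniformly_continuous_on {0..1} f" using cont compact_uniformly_continuous by blast
  then obtain \<delta> where d: "\<delta> > 0" "\<And>x y. x \<in> {0..1} \<Longrightarrow> y \<in> {0..1} \<Longrightarrow> \<bar>y - x\<bar> < \<delta> \<Longrightarrow> \<bar>f y - f x\<bar> < \<eta> / 2"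
    using assms(2) unfolding uniformly_continuous_on_def dist_real_def by (metis half_gt_zero)
  obtain D where D: "1 / 2 ^ D < \<delta>" using pow_half_less[OF d(1), of 0] by blast
  have "measure lborel (f ` cell l k) \<le> Var f (l + d) {k * 2 ^ d..<Suc k * 2 ^ d} + \<eta>" if "D \<le> d" for d
  proof -
    have near: "\<exists>i. k * 2 ^ d \<le> i \<and> i \<le> Suc k * 2 ^ d \<and> \<bar>f (real i / 2 ^ (l + d)) - f x\<bar> < \<eta> / 2"
      if x: "x \<in> cell l k" for x
    proof -
      obtain i where i: "i div 2 ^ d = k" "x \<in> cell (l + d) i" using cell_sub_ex[OF x] by blast
      have "k * 2 ^ d \<le> i" "i \<le> Suc k * 2 ^ d"
        using i(1) dividend_less_div_times[of "2 ^ d" i] by auto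
      moreover have "\<bar>real i / 2 ^ (l + d) - x\<bar> \<le> 1 / 2 ^ (l + d)"
        using i(2) by (auto simp: cell_def add_divide_distrib)
      moreover have "1 / 2 ^ (l + d) \<le> (1 / 2 ^ D :: real)" using \<open>D \<le> d\<close> by (simp add: frac_le)
      moreover note D
      moreover have "real i / 2 ^ (l + d) \<in> cell (l + d) i" by (rule cell_endpoints)
      then have "real i / 2 ^ (l + d) \<in> {0..1}"
        using cell_refine_subset[of l d i] cell_subset_unit[OF assms(1)] i(1) by blast
      moreover have "x \<in> {0..1}" using x cell_subset_unit[OF assms(1)] by blast
      ultimately show ?thesis using d(2)[of x "real i / 2 ^ (l + d)"] by (intro exI[of _ i]) auto
    qed
    obtain i where i: "k * 2 ^ d \<le> i" "i \<le> Suc k * 2 ^ d" "\<bar>f (real i / 2 ^ (l + d)) - f a\<bar> < \<eta> / 2"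
      using near[OF ab(1)] by blast
    obtain j where j: "k * 2 ^ d \<le> j" "j \<le> Suc k * 2 ^ d" "\<bar>f (real j / 2 ^ (l + d)) - f b\<bar> < \<eta> / 2"
      using near[OF ab(2)] by blast
    have mono: "Var f (l + d) {u..<v} \<le> Var f (l + d) {k * 2 ^ d..<Suc k * 2 ^ d}"
      if "k * 2 ^ d \<le> u" "v \<le> Suc k * 2 ^ d" for u v
      using that by (intro sum_mono2) auto
    have "\<bar>f (real j / 2 ^ (l + d)) - f (real i / 2 ^ (l + d))\<bar> \<le> Var f (l + d) {k * 2 ^ d..<Suc k * 2 ^ d}"
    proof (cases "i \<le> j")
      case True
      then show ?thesis using inc_telescope[of i j f "l + d"] mono[of i j] i j by linarith
    next
      case False
      then show ?thesis using inc_telescope[of j i f "l + d"] mono[of j i] i j by linarith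
    qed
    then show ?thesis using i(3) j(3) m by linarith
  qed
  then show ?thesis by blast
qed

text \<open>\<open>osc_le\<close> is applied to all cells of \<open>X\<close> at a common
  refinement. Their descendants are disjoint as index sets, so the variations add up to the
  variation over all descendants of \<open>X\<close>.\<close>

lemma sum_measure_image_le:
  assumes "X \<subseteq> {..<2 ^ l}"
    and c: "\<And>d. Var f (l + d) {k. k div 2 ^ d \<in> X} \<le> c"
  shows "(\<Sum>k\<in>X. measure lborel (f ` cell l k)) \<le> c"
proof (rule field_le_epsilon)
  fix e :: real assume e: "0 < e"
  have fin: "finite X" using assms(1) finite_subset by blast
  define \<eta> where "\<eta> = e / (real (card X) + 1)"
  have \<eta>: "\<eta> > 0" "card X * \<eta> \<le> e" using e by (auto simp: \<eta>_def field_simps)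
  have "\<forall>k\<in>X. \<exists>D. \<forall>d\<ge>D. measure lborel (f ` cell l k) \<le> Var f (l + d) {k * 2 ^ d..<Suc k * 2 ^ d} + \<eta>"
    using osc_le[OF _ \<eta>(1)] assms(1) by blast
  then obtain D where D: "\<And>k d. k \<in> X \<Longrightarrow> D k \<le> d \<Longrightarrow>
      measure lborel (f ` cell l k) \<le> Var f (l + d) {k * 2 ^ d..<Suc k * 2 ^ d} + \<eta>" by metis
  \<comment> \<open>The sum dominates each \<open>D k\<close> with \<open>k\<close> in
    \<open>X\<close>.\<close>
  define d where "d = (\<Sum>k\<in>X. D k)"
  have "(\<Sum>k\<in>X. measure lborel (f ` cell l k)) \<le> (\<Sum>k\<in>X. Var f (l + d) {k * 2 ^ d..<Suc k * 2 ^ d} + \<eta>)"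
    by (intro sum_mono D) (auto simp: d_def fin member_le_sum)
  also have "\<dots> = (\<Sum>k\<in>X. Var f (l + d) {k * 2 ^ d..<Suc k * 2 ^ d}) + card X * \<eta>"
    by (simp add: sum.distrib)
  also have "(\<Sum>k\<in>X. Var f (l + d) {k * 2 ^ d..<Suc k * 2 ^ d}) = Var f (l + d) (\<Union>k\<in>X. {k * 2 ^ d..<Suc k * 2 ^ d})"
  proof (rule sum.UNION_disjoint[symmetric])
    have "i = j" if "x \<in> {i * 2 ^ d..<Suc i * 2 ^ d}" "x \<in> {j * 2 ^ d..<Suc j * 2 ^ d}" for i j x :: nat
    proof -
      have "x div 2 ^ d = i" "x div 2 ^ d = j" using that by (auto intro!: div_nat_eqI simp: mult.commute)
      then show ?thesis by simp
    qed
    then show "\<forall>i\<in>X. \<forall>j\<in>X. i \<noteq> j \<longrightarrow> {i * 2 ^ d..<Suc i * 2 ^ d} \<inter> {j * 2 ^ d..<Suc j * 2 ^ d} = {}"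
      by blast
  qed (auto simp: fin)
  also have "(\<Union>k\<in>X. {k * 2 ^ d..<Suc k * 2 ^ d}) = {k. k div 2 ^ d \<in> X}"
  proof -
    have "x \<in> {k * 2 ^ d..<Suc k * 2 ^ d} \<longleftrightarrow> x div 2 ^ d = k" for x k :: nat
      using dividend_less_div_times[of "2 ^ d" x]
      by (auto intro!: div_nat_eqI simp: mult.commute)
    then show ?thesis by auto
  qed
  finally show "(\<Sum>k\<in>X. measure lborel (f ` cell l k)) \<le> c + e" using c[of d] \<eta>(2) by linarith
qed

lemma div_less_power2: "k' div 2 ^ d < (2::nat) ^ l \<longleftrightarrow> k' < 2 ^ (l + d)"
  by (simp add: div_less_iff_less_mult power_add)

lemma sum_measure_image_le_V: "(\<Sum>k<2 ^ l. measure lborel (f ` cell l k)) \<le> V"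
proof (rule sum_measure_image_le)
  show "Var f (l + d) {k. k div 2 ^ d \<in> {..<2 ^ l}} \<le> V" for d
    using bv[of "l + d"] by (simp add: div_less_power2 lessThan_def)
qed simp

text \<open>Since subcells of good cells are good, the unions increase with the level, and the
  variation over all descendants of good cells is again bounded by \<open>c\<close>. The bound at
  each level then passes to the limit. It is applied to cells inside an open set and to cells lost
  by a cut.\<close>

lemma emeasure_image_good_le:
  assumes her: "\<And>l d k. good l (k div 2 ^ d) \<Longrightarrow> good (l + d) k"
    and c: "\<And>l X. X \<subseteq> {..<2 ^ l} \<Longrightarrow> (\<And>k. k \<in> X \<Longrightarrow> good l k) \<Longrightarrow> Var f l X \<le> c"
  shows "emeasure lborel (\<Union>l. \<Union>k\<in>{k. k < 2 ^ l \<and> good l k}. f ` cell l k) \<le> ennreal c"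
proof -
  define A where "A l = (\<Union>k\<in>{k. k < 2 ^ l \<and> good l k}. f ` cell l k)" for l
  have Ab: "A l \<in> sets lborel" for l unfolding A_def sets_lborel
    by (intro sets.finite_UN image_cell_borel) auto
  have "incseq A"
  proof (rule incseq_SucI, rule subsetI)
    fix l y assume "y \<in> A l"
    then obtain k x where k: "k < 2 ^ l" "good l k" "x \<in> cell l k" "y = f x" by (auto simp: A_def)
    then obtain k' where "k' div 2 ^ 1 = k" "x \<in> cell (l + 1) k'" using cell_sub_ex by blast
    then show "y \<in> A (Suc l)" using k her[of l k' 1] div_less_power2[of k' 1 l]
      by (auto simp: A_def)
  qed
  moreover have "emeasure lborel (A l) \<le> ennreal c" for l
  proof -
    let ?X = "{k. k < 2 ^ l \<and> good l k}"
    have "emeasure lborel (A l) \<le> (\<Sum>k\<in>?X. emeasure lborel (f ` cell l k))"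
      unfolding A_def by (intro emeasure_subadditive_finite) auto
    also have "\<dots> = (\<Sum>k\<in>?X. ennreal (measure lborel (f ` cell l k)))"
      by (intro sum.cong emeasure_image_cell) auto
    also have "\<dots> = ennreal (\<Sum>k\<in>?X. measure lborel (f ` cell l k))" by (simp add: sum_ennreal)
    also have "\<dots> \<le> ennreal c"
    proof (intro ennreal_leI sum_measure_image_le)
      show "Var f (l + d) {k. k div 2 ^ d \<in> ?X} \<le> c" for d
        by (rule c) (auto simp: div_less_power2 her)
    qed auto
    finally show ?thesis .
  qed
  ultimately have "emeasure lborel (\<Union>l. A l) \<le> ennreal c"
    using SUP_emeasure_incseq[of A lborel] Ab by (metis SUP_least image_subset_iff subset_UNIV)
  then show ?thesis by (simp add: A_def)
qed

subsection \<open>The Banach indicatrix\<close>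

abbreviation pre :: "real \<Rightarrow> real set" where "pre y \<equiv> {x \<in> {0..1}. f x = y}"

definition level_count :: "nat \<Rightarrow> real \<Rightarrow> ennreal" where
  "level_count l y = (\<Sum>k<2 ^ l. indicator (f ` cell l k) y)"

text \<open>The liminf prepares for Fatou's lemma. A preimage on the border between two cells is
  counted twice, so the value may exceed the number of preimages; what matters is that it bounds
  that number from above and has a finite integral.\<close>

definition indicatrix :: "real \<Rightarrow> ennreal" where
  "indicatrix y = liminf (\<lambda>l. level_count l y)"

lemma level_count_measurable [measurable]: "level_count l \<in> borel_measurable borel"
  unfolding level_count_def by (intro borel_measurable_sum borel_measurable_indicator image_cell_borel) auto

lemma indicatrix_measurable [measurable]: "indicatrix \<in> borel_measurable borel"
  unfolding indicatrix_def by measurable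

lemma nn_integral_level_count: "(\<integral>\<^sup>+y. level_count l y \<partial>lborel) \<le> ennreal V"
proof -
  have "(\<integral>\<^sup>+y. level_count l y \<partial>lborel) = (\<Sum>k<2 ^ l. emeasure lborel (f ` cell l k))"
    unfolding level_count_def by (subst nn_integral_sum) (auto intro!: sum.cong nn_integral_indicator)
  also have "\<dots> = (\<Sum>k<2 ^ l. ennreal (measure lborel (f ` cell l k)))"
    by (intro sum.cong emeasure_image_cell) auto
  also have "\<dots> \<le> ennreal V" using sum_measure_image_le_V by (simp add: sum_ennreal ennreal_leI)
  finally show ?thesis .
qed

lemma nn_integral_indicatrix: "(\<integral>\<^sup>+y. indicatrix y \<partial>lborel) \<le> ennreal V"
proof -
  have "(\<integral>\<^sup>+y. indicatrix y \<partial>lborel) \<le> liminf (\<lambda>l. \<integral>\<^sup>+y. level_count l y \<partial>lborel)"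
    unfolding indicatrix_def by (intro nn_integral_liminf) auto
  also have "\<dots> \<le> ennreal V"
    using nn_integral_level_count by (intro Liminf_le always_eventually) auto
  finally show ?thesis .
qed

lemma cells_separate:
  assumes "finite A"
  shows "\<exists>m. \<forall>l\<ge>m. \<forall>x\<in>A. \<forall>x'\<in>A. \<forall>k. x \<in> cell l k \<and> x' \<in> cell l k \<longrightarrow> x = x'"
proof -
  \<comment> \<open>The element 1 keeps the set nonempty, so that \<open>Min D\<close> makes sense
    when \<open>A\<close> has at most one point.\<close>
  define D where "D = insert 1 ((\<lambda>p. \<bar>fst p - snd p\<bar>) ` {p \<in> A \<times> A. fst p \<noteq> snd p})"
  have "finite D" using assms by (simp add: D_def)
  then have e: "Min D > 0" "\<And>x x'. x \<in> A \<Longrightarrow> x' \<in> A \<Longrightarrow> \<bar>x - x'\<bar> < Min D \<Longrightarrow> x = x'"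
    by (subst Min_gr_iff, auto simp: D_def)
  obtain m where m: "1 / 2 ^ m < Min D" using pow_half_less[OF e(1), of 0] by blast
  have "x = x'" if "m \<le> l" "x \<in> A" "x' \<in> A" "x \<in> cell l k" "x' \<in> cell l k" for l x x' k
  proof (rule e(2)[OF that(2,3)])
    show "\<bar>x - x'\<bar> < Min D" using cell_dist[OF that(4,5,1)] m by simp
  qed
  then show ?thesis by blast
qed

lemma card_le_indicatrix:
  assumes "finite A" "A \<subseteq> pre y" shows "of_nat (card A) \<le> indicatrix y"
proof -
  obtain m where m: "\<And>l x x' k. m \<le> l \<Longrightarrow> x \<in> A \<Longrightarrow> x' \<in> A \<Longrightarrow> x \<in> cell l k \<Longrightarrow> x' \<in> cell l k \<Longrightarrow> x = x'"
    using cells_separate[OF assms(1)] by blast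
  have "of_nat (card A) \<le> level_count l y" if "m \<le> l" for l
  proof -
    have "\<forall>x\<in>A. \<exists>k<2 ^ l. x \<in> cell l k" using assms(2) cell_ex by blast
    then obtain K where K: "\<And>x. x \<in> A \<Longrightarrow> K x < 2 ^ l" "\<And>x. x \<in> A \<Longrightarrow> x \<in> cell l (K x)" by metis
    have "inj_on K A" using m[OF that] K(2) by (metis inj_onI)
    then have "card A = card (K ` A)" by (simp add: card_image)
    also have "\<dots> \<le> card {k \<in> {..<2 ^ l}. y \<in> f ` cell l k}"
      using K assms(2) by (intro card_mono) auto
    finally have "(of_nat (card A) :: ennreal) \<le> of_nat (card {k \<in> {..<2 ^ l}. y \<in> f ` cell l k})"
      by simp
    also have "\<dots> = level_count l y"
      unfolding level_count_def indicator_def by (simp add: sum.If_cases Int_def)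
    finally show ?thesis .
  qed
  then show ?thesis unfolding indicatrix_def
    by (intro Liminf_bounded) (auto simp: eventually_sequentially)
qed

lemma finite_pre: assumes "indicatrix y < \<infinity>" shows "finite (pre y)"
proof (rule ccontr)
  assume inf: "infinite (pre y)"
  have "of_nat n \<le> indicatrix y" for n
    using infinite_arbitrarily_large[OF inf, of n] card_le_indicatrix by blast
  then have "indicatrix y = \<infinity>"
    using ennreal_Ex_less_of_nat[of "indicatrix y"] by (metis infinity_ennreal_def leD top.not_eq_extremum)
  then show False using assms by simp
qed

lemma AE_indicatrix_finite: "AE y in lborel. indicatrix y < \<infinity>"
proof -
  have "AE y in lborel. indicatrix y \<noteq> \<infinity>"
    using nn_integral_indicatrix by (intro nn_integral_noteq_infinite) (auto simp: top_unique)
  then show ?thesis by (simp add: top.not_eq_extremum)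
qed

lemma infinite_pre_null: "{y. infinite (pre y)} \<in> null_sets lebesgue"
proof -
  have "{y \<in> space borel. \<not> indicatrix y < \<infinity>} \<in> sets borel" by measurable
  then have "{y. \<not> indicatrix y < \<infinity>} \<in> null_sets lborel"
    using AE_indicatrix_finite by (subst AE_iff_null_sets) auto
  moreover have "{y. infinite (pre y)} \<subseteq> {y. \<not> indicatrix y < \<infinity>}" using finite_pre by blast
  ultimately show ?thesis unfolding null_sets_completion_iff2 by blast
qed

section \<open>Level crossings\<close>

definition oseg :: "nat \<Rightarrow> nat \<Rightarrow> real set" where
  "oseg l k = {min (f (real k / 2 ^ l)) (f ((real k + 1) / 2 ^ l)) <..<
     max (f (real k / 2 ^ l)) (f ((real k + 1) / 2 ^ l))}"

lemma oseg_pre: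
  assumes "k < 2 ^ l" "y \<in> oseg l k" shows "\<exists>x\<in>ocell l k. f x = y"
proof -
  let ?a = "real k / 2 ^ l" and ?b = "(real k + 1) / 2 ^ l"
  have ab: "?a < ?b" by (simp add: divide_strict_right_mono)
  have c: "continuous_on {?a..?b} f" using cont_cell[OF assms(1)] by (simp add: cell_def)
  have "\<exists>x. ?a \<le> x \<and> x \<le> ?b \<and> f x = y"
  proof (cases "f ?a \<le> f ?b")
    case True
    then show ?thesis using IVT'[of f ?a y ?b] assms(2) c ab by (auto simp: oseg_def)
  next
    case False
    then show ?thesis using IVT2'[of f ?b y ?a] assms(2) c ab by (auto simp: oseg_def)
  qed
  then obtain x where x: "?a \<le> x" "x \<le> ?b" "f x = y" by blast
  have "x \<noteq> ?a" "x \<noteq> ?b" using x(3) assms(2) by (auto simp: oseg_def)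
  then show ?thesis using x by (intro bexI[of _ x]) (auto simp: ocell_def)
qed

text \<open>Counts open segments between endpoint values rather than images of cells. The length of
  such a segment is exactly \<open>inc f l k\<close>, so the integral equals the variation; and the
  intermediate value theorem puts a preimage into each crossed open cell, so the count stays below
  the indicatrix.\<close>

definition crossings :: "nat \<Rightarrow> nat set \<Rightarrow> real \<Rightarrow> ennreal" where
  "crossings l X y = (\<Sum>k\<in>X. indicator (oseg l k) y)"

lemma crossings_measurable [measurable]: "crossings l X \<in> borel_measurable borel"
  unfolding crossings_def oseg_def by measurable

lemma nn_integral_crossings:
  assumes "finite X" shows "(\<integral>\<^sup>+y. crossings l X y \<partial>lborel) = ennreal (Var f l X)"
proof -
  have "(\<integral>\<^sup>+y. crossings l X y \<partial>lborel) = (\<Sum>k\<in>X. emeasure lborel (oseg l k))"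
    unfolding crossings_def
    by (subst nn_integral_sum) (auto intro!: sum.cong nn_integral_indicator simp: oseg_def)
  also have "\<dots> = (\<Sum>k\<in>X. ennreal (inc f l k))"
    by (intro sum.cong) (auto simp: oseg_def inc_def max_def min_def)
  finally show ?thesis by (simp add: sum_ennreal)
qed

lemma crossings_le_indicatrix:
  assumes "X \<subseteq> {..<2 ^ l}" shows "crossings l X y \<le> indicatrix y"
proof -
  define K where "K = {k \<in> X. y \<in> oseg l k}"
  have fin: "finite X" using assms finite_subset by blast
  have "\<forall>k\<in>K. \<exists>x\<in>ocell l k. f x = y" using oseg_pre assms by (auto simp: K_def)
  then obtain \<xi> where \<xi>: "\<And>k. k \<in> K \<Longrightarrow> \<xi> k \<in> ocell l k" "\<And>k. k \<in> K \<Longrightarrow> f (\<xi> k) = y" by metis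
  have "inj_on \<xi> K" by (rule inj_onI) (metis \<xi>(1) ocell_disjoint)
  then have "card (\<xi> ` K) = card K" by (simp add: card_image)
  moreover have "\<xi> ` K \<subseteq> pre y"
  proof
    fix x assume "x \<in> \<xi> ` K"
    then obtain k where k: "k \<in> K" "x = \<xi> k" by blast
    then have "k < 2 ^ l" using assms by (auto simp: K_def)
    then have "x \<in> {0..1}" using \<xi>(1)[OF k(1)] k(2) ocell_subset_cell cell_subset_unit by blast
    then show "x \<in> pre y" using \<xi>(2)[OF k(1)] k(2) by simp
  qed
  ultimately have "of_nat (card K) \<le> indicatrix y" using card_le_indicatrix[of "\<xi> ` K" y] fin by (simp add: K_def)
  moreover have "crossings l X y = of_nat (card K)"
    unfolding crossings_def indicator_def K_def using fin(1) by (simp add: sum.If_cases Int_def)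
  ultimately show ?thesis by simp
qed

text \<open>
  The crossing counts are dominated by the integrable indicatrix, so their integrals could not stay
  away from zero if almost every \<open>y\<close> were crossed only finitely often.
\<close>

lemma image_limsup_not_null:
  fixes X :: "nat \<Rightarrow> nat set" and l :: "nat \<Rightarrow> nat"
  assumes X: "\<And>i. X i \<subseteq> {..<2 ^ l i}" and c: "c > 0" "\<And>i. Var f (l i) (X i) > c"
  shows "f ` {x \<in> {0..1}. \<exists>\<^sub>\<infinity>i. \<exists>k\<in>X i. x \<in> ocell (l i) k} \<notin> null_sets lebesgue" (is "f ` ?S \<notin> _")
proof
  assume "f ` ?S \<in> null_sets lebesgue"
  then obtain N where N: "N \<in> null_sets lborel" "f ` ?S \<subseteq> N"
    by (auto simp: null_sets_completion_iff2)
  have lim: "(\<lambda>i. crossings (l i) (X i) y) \<longlonglongrightarrow> 0" if y: "y \<notin> N" "indicatrix y < \<infinity>" for y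
  proof -
    have "\<not> (\<exists>\<^sub>\<infinity>i. crossings (l i) (X i) y \<noteq> 0)"
    proof
      \<comment> \<open>Every crossing has a preimage in one of the cells. The fibre is finite, so a
        single preimage accounts for infinitely many indices and lies in \<open>?S\<close>.\<close>
      assume inf: "\<exists>\<^sub>\<infinity>i. crossings (l i) (X i) y \<noteq> 0"
      have "\<exists>x\<in>pre y. \<exists>k\<in>X i. x \<in> ocell (l i) k" if ne: "crossings (l i) (X i) y \<noteq> 0" for i
      proof -
        have "\<exists>k\<in>X i. y \<in> oseg (l i) k"
          using ne unfolding crossings_def by (metis (mono_tags, lifting) indicator_simps(2) sum.neutral)
        then obtain k where k: "k \<in> X i" "y \<in> oseg (l i) k" by blast
        then obtain x where "x \<in> ocell (l i) k" "f x = y" using oseg_pre X by blast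
        then show ?thesis using k X cell_subset_unit ocell_subset_cell by blast
      qed
      then have "{i. crossings (l i) (X i) y \<noteq> 0} \<subseteq> (\<Union>x\<in>pre y. {i. \<exists>k\<in>X i. x \<in> ocell (l i) k})"
        by blast
      then have "infinite (\<Union>x\<in>pre y. {i. \<exists>k\<in>X i. x \<in> ocell (l i) k})"
        using inf infinite_super unfolding INFM_iff_infinite by blast
      then have "\<exists>x\<in>pre y. infinite {i. \<exists>k\<in>X i. x \<in> ocell (l i) k}"
        using finite_UN_I[OF finite_pre[OF y(2)], of "\<lambda>x. {i. \<exists>k\<in>X i. x \<in> ocell (l i) k}"] by blast
      then obtain x where "x \<in> pre y" "infinite {i. \<exists>k\<in>X i. x \<in> ocell (l i) k}" by blast
      then have "y \<in> f ` ?S" by (auto simp: INFM_iff_infinite)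
      then show False using y(1) N(2) by blast
    qed
    then have "\<forall>\<^sub>F i in sequentially. crossings (l i) (X i) y = 0"
      by (simp add: frequently_def cofinite_eq_sequentially)
    then show ?thesis by (rule tendsto_eventually)
  qed
  have "(\<lambda>i. \<integral>\<^sup>+y. crossings (l i) (X i) y \<partial>lborel) \<longlonglongrightarrow> (\<integral>\<^sup>+(y::real). 0 \<partial>lborel)"
  proof (rule nn_integral_dominated_convergence[where w = indicatrix])
    show "AE y in lborel. (\<lambda>i. crossings (l i) (X i) y) \<longlonglongrightarrow> 0"
      using AE_indicatrix_finite AE_not_in[OF N(1)] by eventually_elim (rule lim)
    show "(\<integral>\<^sup>+y. indicatrix y \<partial>lborel) < \<infinity>"
      using nn_integral_indicatrix by (metis ennreal_less_top infinity_ennreal_def order_le_less_trans)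
  qed (auto intro!: AE_I2 crossings_le_indicatrix X)
  moreover have "(\<integral>\<^sup>+y. crossings (l i) (X i) y \<partial>lborel) \<ge> ennreal c" for i
  proof -
    have "finite (X i)" using X finite_subset by blast
    then show ?thesis using c(2)[of i] by (simp add: nn_integral_crossings ennreal_leI)
  qed
  ultimately have "ennreal c \<le> 0"
    by (intro LIMSEQ_le_const) auto
  then show False using c(1) by simp
qed

end

subsection \<open>Uniform approximation of computable functions\<close>

text \<open>Repeated unpairing reads every number as an infinite sequence, without a length. Any
  finite sequence occurs as a prefix (\<open>nthc_ex\<close>), so a number can stand for a finite
  piece of an oracle.\<close>

definition nthc :: "nat \<Rightarrow> nat \<Rightarrow> nat" where
  "nthc s k = fst (prod_decode (((\<lambda>t. snd (prod_decode t)) ^^ k) s))"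

lemma cmp_nthc [cmp_intros]:
  assumes "cmp g a" "cmp g b" shows "cmp g (\<lambda>x. nthc (a x) (b x))"
  unfolding nthc_def by (intro cmp_intros assms)

lemma nthc_0 [simp]: "nthc (prod_encode (a, s)) 0 = a"
  by (simp add: nthc_def)

lemma nthc_Suc [simp]: "nthc (prod_encode (a, s)) (Suc i) = nthc s i"
  unfolding nthc_def funpow_Suc_right by simp

lemma nthc_ex: "\<exists>s. \<forall>i<n. nthc s i = u i"
proof (induction n arbitrary: u)
  case (Suc n)
  obtain s where s: "\<forall>i<n. nthc s i = u (Suc i)" using Suc.IH[of "\<lambda>i. u (Suc i)"] by blast
  have "nthc (prod_encode (u 0, s)) i = u i" if "i < Suc n" for i
    using s that by (cases i) simp_all
  then show ?case by blast
qed simp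

text \<open>Twice the accuracy that \<open>cauchy_name\<close> asks for. The slack is what keeps a
  finite piece of the name valid for all points in a ball around \<open>x\<close>.\<close>

lemma near_rat_num_ex: "\<exists>g. \<forall>i. \<bar>rat_num (g i) - x\<bar> \<le> 1 / 2 ^ Suc i"
proof -
  have "\<exists>q. \<bar>rat_num q - x\<bar> \<le> 1 / 2 ^ Suc i" for i
  proof -
    have "x - 1 / 2 ^ Suc i < x" by simp
    then obtain q where "x - 1 / 2 ^ Suc i < rat_num q" "rat_num q < x" using rat_num_dense by blast
    then show ?thesis by (intro exI[of _ q]) (auto simp: abs_le_iff)
  qed
  then show ?thesis by metis
qed

definition prefix_ball :: "nat \<Rightarrow> nat \<Rightarrow> real set" where
  "prefix_ball \<sigma> s = {x. \<forall>i<s. \<bar>rat_num (nthc \<sigma> i) - x\<bar> \<le> 1 / 2 ^ i}"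

text \<open>A run with bound \<open>s\<close> reads only the first \<open>s\<close> entries of its
  oracle. A string that is valid for \<open>x\<close> so far can therefore be continued to a Cauchy
  name of \<open>x\<close> without changing the output.\<close>

lemma prefix_ball_sound:
  assumes p: "\<And>x g. x \<in> {0..1} \<Longrightarrow> cauchy_name g x \<Longrightarrow>
      \<exists>h. (\<forall>n. run g p n = Some (h n)) \<and> cauchy_name h (f x)"
    and "runs (nthc \<sigma>) s p n = Some v" "x \<in> {0..1}" "x \<in> prefix_ball \<sigma> s"
  shows "\<bar>rat_num v - f x\<bar> \<le> 1 / 2 ^ n"
proof -
  obtain g0 where g0: "\<And>i. \<bar>rat_num (g0 i) - x\<bar> \<le> 1 / 2 ^ Suc i" using near_rat_num_ex by blast
  define g where "g i = (if i < s then nthc \<sigma> i else g0 i)" for i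
  have "\<bar>rat_num (g0 i) - x\<bar> \<le> 1 / 2 ^ i" for i
    by (rule order_trans[OF g0]) (simp add: field_simps)
  then have "cauchy_name g x"
    using assms(4) by (auto simp: cauchy_name_def g_def prefix_ball_def)
  then obtain h where h: "\<And>n. run g p n = Some (h n)" "cauchy_name h (f x)"
    using p assms(3) by blast
  have "runs g s p = runs (nthc \<sigma>) s p" by (rule runs_cong) (simp add: g_def)
  then have "run g p n = Some v" using runs_sound assms(2) by metis
  then show ?thesis using h by (auto simp: cauchy_name_def)
qed

lemma prefix_ball_ex:
  assumes p: "\<And>x g. x \<in> {0..1} \<Longrightarrow> cauchy_name g x \<Longrightarrow>
      \<exists>h. (\<forall>n. run g p n = Some (h n)) \<and> cauchy_name h (f x)"
    and "x \<in> {0..1}"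
  shows "\<exists>\<sigma> s e. e > 0 \<and> runs (nthc \<sigma>) s p n \<noteq> None \<and> ball x e \<subseteq> prefix_ball \<sigma> s"
proof -
  obtain g where g: "\<And>i. \<bar>rat_num (g i) - x\<bar> \<le> 1 / 2 ^ Suc i" using near_rat_num_ex by blast
  have "\<bar>rat_num (g i) - x\<bar> \<le> 1 / 2 ^ i" for i
    by (rule order_trans[OF g]) (simp add: field_simps)
  then have "cauchy_name g x" by (auto simp: cauchy_name_def)
  then obtain v where "run g p n = Some v" using p assms(2) by blast
  from runs_complete[OF this] obtain s where s: "runs g s p n = Some v" by blast
  obtain \<sigma> where \<sigma>: "\<forall>i<s. nthc \<sigma> i = g i" using nthc_ex by blast
  have "runs (nthc \<sigma>) s p n = Some v"
    using s runs_cong[of s "nthc \<sigma>" g p] \<sigma> by simp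
  moreover have "ball x (1 / 2 ^ Suc s) \<subseteq> prefix_ball \<sigma> s"
  proof
    fix y assume y: "y \<in> ball x (1 / 2 ^ Suc s)"
    have "\<bar>rat_num (g i) - y\<bar> \<le> 1 / 2 ^ i" if "i < s" for i
    proof -
      have "1 / 2 ^ Suc s \<le> (1 / 2 ^ Suc i :: real)" using that by (intro frac_le power_increasing) auto
      then show ?thesis using g[of i] y by (simp add: dist_real_def)
    qed
    then show "y \<in> prefix_ball \<sigma> s" using \<sigma> by (simp add: prefix_ball_def)
  qed
  moreover have "1 / 2 ^ Suc s > (0 :: real)" by simp
  ultimately show ?thesis by blast
qed

text \<open>A Lebesgue number for the cover: each small cell fits into a single member, which is
  what a decidable test on one cell can check.\<close>

lemma cells_subordinate:
  assumes "{0..1} \<subseteq> \<Union>C" "\<And>G. G \<in> C \<Longrightarrow> open G"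
  shows "\<exists>m. \<forall>l\<ge>m. \<forall>k<2 ^ l. \<exists>G\<in>C. cell l k \<subseteq> G"
proof -
  have "C \<noteq> {}" using assms(1) by auto
  then obtain \<delta> where \<delta>: "\<delta> > 0" "\<And>T. T \<subseteq> {0..1} \<Longrightarrow> diameter T < \<delta> \<Longrightarrow> \<exists>G\<in>C. T \<subseteq> G"
    using Lebesgue_number_lemma[of "{0..1::real}" C] assms by (metis compact_Icc)
  obtain m where m: "1 / 2 ^ m < \<delta>" using pow_half_less[OF \<delta>(1), of 0] by blast
  have "\<exists>G\<in>C. cell l k \<subseteq> G" if "m \<le> l" "k < 2 ^ l" for l k
  proof (rule \<delta>(2)[OF cell_subset_unit[OF that(2)]])
    have "diameter (cell l k) = 1 / 2 ^ l"
      by (simp add: cell_def divide_right_mono add_divide_distrib)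
    also have "\<dots> \<le> 1 / 2 ^ m" using that(1) by (simp add: frac_le)
    finally show "diameter (cell l k) < \<delta>" using m by simp
  qed
  then show ?thesis by blast
qed

lemma computable_unit_continuous:
  assumes "computable_unit f" shows "continuous_on {0..1} f"
proof -
  obtain p where p: "\<And>x g. x \<in> {0..1} \<Longrightarrow> cauchy_name g x \<Longrightarrow>
      \<exists>h. (\<forall>n. run g p n = Some (h n)) \<and> cauchy_name h (f x)"
    using assms unfolding computable_unit_def by blast
  have "\<exists>d>0. \<forall>y\<in>{0..1}. dist y x < d \<longrightarrow> dist (f y) (f x) < e" if x: "x \<in> {0..1}" and e: "e > 0" for x e
  proof -
    obtain n where n: "1 / 2 ^ n < e / 2" using pow_half_less[of "e / 2" 0] e by auto
    obtain \<sigma> s d where d: "d > 0" "runs (nthc \<sigma>) s p n \<noteq> None" "ball x d \<subseteq> prefix_ball \<sigma> s"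
      using prefix_ball_ex[where f = f and p = p, OF p x] by blast
    obtain v where v: "runs (nthc \<sigma>) s p n = Some v" using d(2) by blast
    have *: "\<bar>rat_num v - f y\<bar> \<le> 1 / 2 ^ n" if "y \<in> {0..1}" "y \<in> ball x d" for y
      using prefix_ball_sound[where f = f and p = p, OF p v that(1)] that(2) d(3) by blast
    have "\<bar>f y - f x\<bar> < e" if "y \<in> {0..1}" "dist y x < d" for y
      using *[OF that(1)] *[OF x] that(2) d(1) n by (simp add: dist_commute)
    then show ?thesis using d(1) by (auto simp: dist_real_def)
  qed
  then show ?thesis unfolding continuous_on_iff by blast
qed

text \<open>For each \<open>n\<close> the search looks for a level and, for every cell of it, a
  string that makes the program answer and is valid for all points of the cell. Compactness makes
  the search succeed. The strings are the only oracle the program sees, so \<open>M\<close> and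
  \<open>F\<close> are computable with every oracle \<open>g\<close>.\<close>

lemma uniform_approximation:
  assumes "computable_unit f"
  obtains M F where "\<And>g. cmp g M" "\<And>g. cmp g (\<lambda>z. F (fst z) (snd z))" "\<And>n. n \<le> M n"
    "\<And>n k x. k < 2 ^ M n \<Longrightarrow> x \<in> cell (M n) k \<Longrightarrow> \<bar>f x - rat_num (F n k)\<bar> \<le> 1 / 2 ^ n"
proof -
  obtain p where p: "\<And>x g. x \<in> {0..1} \<Longrightarrow> cauchy_name g x \<Longrightarrow>
      \<exists>h. (\<forall>n. run g p n = Some (h n)) \<and> cauchy_name h (f x)"
    using assms unfolding computable_unit_def by blast
  define val where "val n d = runs (nthc (fst d)) (snd d) p n" for n d
  define ok where "ok n m k d \<longleftrightarrow> val n d \<noteq> None \<and>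
    (\<forall>i<snd d. rat_num (nthc (fst d) i) - 1 / 2 ^ i \<le> real k / 2 ^ m \<and>
       (real k + 1) / 2 ^ m \<le> rat_num (nthc (fst d) i) + 1 / 2 ^ i)" for n m k d
  \<comment> \<open>The number \<open>w\<close> codes a level together with a list of strings, one
    per cell. Forcing the level to be at least \<open>n\<close> ensures that a cell of level
    \<open>l \<le> n\<close> splits into cells of level \<open>M n\<close>.\<close>
  define good where "good n w \<longleftrightarrow> n \<le> fst (prod_decode w) \<and>
    (\<forall>k<2 ^ fst (prod_decode w). ok n (fst (prod_decode w)) k (prod_decode (nthc (snd (prod_decode w)) k)))"
    for n w
  have cell_ok: "ok n m k d \<longleftrightarrow> val n d \<noteq> None \<and> cell m k \<subseteq> prefix_ball (fst d) (snd d)" for n m k d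
  proof -
    have "real k / 2 ^ m \<le> (real k + 1) / 2 ^ m" by (simp add: divide_right_mono)
    then show ?thesis
      unfolding ok_def prefix_ball_def cell_def by (fastforce simp: abs_le_iff)
  qed
  have good_ex: "\<exists>w. good n w" for n
  proof -
    define C where "C = {B. open B \<and> (\<exists>\<sigma> s. runs (nthc \<sigma>) s p n \<noteq> None \<and> B \<subseteq> prefix_ball \<sigma> s)}"
    have "{0..1} \<subseteq> \<Union>C"
    proof
      fix x :: real assume "x \<in> {0..1}"
      then obtain \<sigma> s e where "e > 0" "runs (nthc \<sigma>) s p n \<noteq> None" "ball x e \<subseteq> prefix_ball \<sigma> s"
        using prefix_ball_ex[where f = f and p = p, OF p] by blast
      then have "ball x e \<in> C" "x \<in> ball x e" unfolding C_def by (blast, simp)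
      then show "x \<in> \<Union>C" by blast
    qed
    moreover have "\<And>G. G \<in> C \<Longrightarrow> open G" by (auto simp: C_def)
    ultimately obtain m0 where m0: "\<And>l k. m0 \<le> l \<Longrightarrow> k < 2 ^ l \<Longrightarrow> \<exists>G\<in>C. cell l k \<subseteq> G"
      using cells_subordinate[of C] by blast
    define m where "m = max n m0"
    have "\<exists>d. ok n m k (prod_decode d)" if k: "k < 2 ^ m" for k
    proof -
      obtain G where "G \<in> C" "cell m k \<subseteq> G" using m0[OF _ k] by (auto simp: m_def)
      then obtain \<sigma> s where "runs (nthc \<sigma>) s p n \<noteq> None" "cell m k \<subseteq> prefix_ball \<sigma> s"
        unfolding C_def by blast
      then show ?thesis by (intro exI[of _ "prod_encode (\<sigma>, s)"]) (simp add: cell_ok val_def)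
    qed
    then obtain D where D: "\<And>k. k < 2 ^ m \<Longrightarrow> ok n m k (prod_decode (D k))" by metis
    obtain \<tau> where "\<forall>k<2 ^ m. nthc \<tau> k = D k" using nthc_ex by blast
    then have "good n (prod_encode (m, \<tau>))" using D by (simp add: good_def m_def)
    then show ?thesis by blast
  qed
  define w where "w n = (LEAST w. good n w)" for n
  have good_w: "good n (w n)" for n unfolding w_def using LeastI_ex[OF good_ex] .
  define M where "M n = fst (prod_decode (w n))" for n
  define F where "F n k = the (val n (prod_decode (nthc (snd (prod_decode (w n))) k)))" for n k
  have cmp_val: "cmp g (\<lambda>x. val (a x) (d x))" if "cmp g a" "cmp g d" for g and a :: "'c::enc \<Rightarrow> nat" and d
  proof -
    have 1: "cmp g (\<lambda>z. nthc (fst z) (snd z))" by (intro cmp_intros)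
    show ?thesis unfolding val_def
      by (intro cmp3[where F = "\<lambda>a b c. runs (nthc a) b p c", OF cmp_runs[where G = nthc, OF 1]]
          cmp_intros that)
  qed
  have "cmp g (\<lambda>z. good (fst z) (snd z))" for g
    unfolding good_def ok_def by (intro cmp_intros cmp_val)
  then have cmp_w: "cmp g w" for g
    unfolding w_def by (intro cmp_Least good_ex)
  show thesis
  proof (rule that)
    show "cmp g M" "cmp g (\<lambda>z. F (fst z) (snd z))" for g
      unfolding M_def F_def by (intro cmp_intros cmp_val cmp_compose[OF cmp_w])+
    show "n \<le> M n" for n using good_w[of n] by (simp add: good_def M_def)
    show "\<bar>f x - rat_num (F n k)\<bar> \<le> 1 / 2 ^ n" if "k < 2 ^ M n" "x \<in> cell (M n) k" for n k x
    proof -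
      define d where "d = prod_decode (nthc (snd (prod_decode (w n))) k)"
      have "ok n (M n) k d" using good_w[of n] that(1) by (auto simp: good_def M_def d_def)
      then have d: "val n d \<noteq> None" "cell (M n) k \<subseteq> prefix_ball (fst d) (snd d)" by (auto simp: cell_ok)
      then have "runs (nthc (fst d)) (snd d) p n = Some (F n k)" by (auto simp: val_def F_def d_def)
      moreover have "x \<in> {0..1}" "x \<in> prefix_ball (fst d) (snd d)"
        using d(2) that(2) cell_subset_unit[OF that(1)] by blast+
      ultimately have "\<bar>rat_num (F n k) - f x\<bar> \<le> 1 / 2 ^ n"
        using prefix_ball_sound[where f = f and p = p, OF p] by blast
      then show ?thesis by (simp add: abs_minus_commute)
    qed
  qed
qed

lemma bounded_variation_Var:
  assumes "bounded_variation_unit f" shows "\<exists>V. \<forall>l. Var f l {..<2 ^ l} \<le> V"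
proof -
  obtain B where B: "\<And>k x. (\<forall>i\<le>k. x i \<in> {0..1}) \<Longrightarrow> (\<forall>i<k. x i < x (Suc i)) \<Longrightarrow>
      (\<Sum>i<k. \<bar>f (x (Suc i)) - f (x i)\<bar>) < B"
    using assms unfolding bounded_variation_unit_def by blast
  have "Var f l {..<2 ^ l} \<le> B" for l
  proof -
    have "(\<Sum>i<2 ^ l. \<bar>f (real (Suc i) / 2 ^ l) - f (real i / 2 ^ l)\<bar>) < B"
    proof (rule B[of "2 ^ l" "\<lambda>i. real i / 2 ^ l"]; intro allI impI)
      fix i :: nat assume "i \<le> 2 ^ l"
      then have "real i \<le> 2 ^ l" by (metis of_nat_le_iff of_nat_numeral of_nat_power)
      then show "real i / 2 ^ l \<in> {0..1}" by simp
    qed (simp add: divide_strict_right_mono)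
    then show ?thesis by (simp add: inc_def add.commute)
  qed
  then show ?thesis by blast
qed

section \<open>Computable neighbourhoods of the image of a cell\<close>

locale computable_bv = bv_fun +
  fixes M :: "nat \<Rightarrow> nat" and F :: "nat \<Rightarrow> nat \<Rightarrow> nat"
  assumes cmp_M0: "\<And>g. cmp g M" and cmp_F0: "\<And>g. cmp g (\<lambda>z. F (fst z) (snd z))"
    and M_ge: "n \<le> M n"
    and approx: "k < 2 ^ M n \<Longrightarrow> x \<in> cell (M n) k \<Longrightarrow> \<bar>f x - rat_num (F n k)\<bar> \<le> 1 / 2 ^ n"
begin

lemmas cmp_MF [cmp_intros] = cmp_compose[OF cmp_M0] cmp2[OF cmp_F0]

text \<open>Approximate values err by at most \<open>1 / 2 ^ n\<close>, so the radius
  \<open>2 / 2 ^ n\<close> leaves room for an open neighbourhood of the image when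
  \<open>l \<le> n\<close>. Together the two bounds keep this neighbourhood within
  \<open>3 / 2 ^ n\<close> of the image.\<close>

definition im_index :: "nat \<Rightarrow> nat \<Rightarrow> nat \<Rightarrow> nat \<Rightarrow> bool" where
  "im_index n l k j \<longleftrightarrow> (\<exists>k'<2 ^ M n. real k / 2 ^ l \<le> real k' / 2 ^ M n \<and>
     (real k' + 1) / 2 ^ M n \<le> (real k + 1) / 2 ^ l \<and>
     rat_num (F n k') - 2 / 2 ^ n \<le> lo j \<and> hi j \<le> rat_num (F n k') + 2 / 2 ^ n)"

definition im_open :: "nat \<Rightarrow> nat \<Rightarrow> nat \<Rightarrow> real set" where
  "im_open n l k = (\<Union>j\<in>{j. im_index n l k j}. basic_open j)"

lemma cmp_im_index [cmp_intros]:
  assumes "cmp g a" "cmp g b" "cmp g c" "cmp g d"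
  shows "cmp g (\<lambda>x. im_index (a x) (b x) (c x) (d x))"
proof (rule cmp4[OF _ assms])
  show "cmp g (\<lambda>p. im_index (fst p) (fst (snd p)) (fst (snd (snd p))) (snd (snd (snd p))))"
    unfolding im_index_def by (intro cmp_intros)
qed

lemma open_im_open [simp]: "open (im_open n l k)"
  unfolding im_open_def by auto

lemma image_cell_subset_im_open:
  assumes "l \<le> n" "k < 2 ^ l" shows "f ` cell l k \<subseteq> im_open n l k"
proof
  fix y assume "y \<in> f ` cell l k"
  then obtain x where x: "x \<in> cell l k" "y = f x" by blast
  define d where "d = M n - l"
  have d: "M n = l + d" using assms(1) M_ge[of n] by (simp add: d_def)
  obtain k' where k': "k' div 2 ^ d = k" "x \<in> cell (M n) k'" using cell_sub_ex[OF x(1), of d] d by auto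
  have k'l: "k' < 2 ^ M n" using k'(1) assms(2) div_less_power2[of k' d l] by (simp add: d)
  have "\<bar>y - rat_num (F n k')\<bar> \<le> 1 / 2 ^ n" using approx[OF k'l k'(2)] x(2) by simp
  also have "\<dots> < 2 / 2 ^ n" by (simp add: divide_strict_right_mono)
  finally have "rat_num (F n k') - 2 / 2 ^ n < y" "y < rat_num (F n k') + 2 / 2 ^ n" by linarith+
  then obtain j where j: "y \<in> basic_open j" "rat_num (F n k') - 2 / 2 ^ n \<le> lo j"
      "hi j \<le> rat_num (F n k') + 2 / 2 ^ n"
    by (rule basic_open_within)
  then have "im_index n l k j"
    using k'l cell_refine(1)[where k' = k' and d = d and l = l]
      cell_refine(2)[where k' = k' and d = d and l = l] k'(1) d
    unfolding im_index_def by auto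
  then show "y \<in> im_open n l k" using j(1) by (auto simp: im_open_def)
qed

lemma im_open_near:
  assumes "y \<in> im_open n l k" shows "\<exists>x\<in>cell l k. \<bar>f x - y\<bar> \<le> 3 / 2 ^ n"
proof -
  obtain j k' where j: "y \<in> basic_open j" "k' < 2 ^ M n" "real k / 2 ^ l \<le> real k' / 2 ^ M n"
     "(real k' + 1) / 2 ^ M n \<le> (real k + 1) / 2 ^ l"
     "rat_num (F n k') - 2 / 2 ^ n \<le> lo j" "hi j \<le> rat_num (F n k') + 2 / 2 ^ n"
    using assms unfolding im_open_def im_index_def by blast
  have x: "real k' / 2 ^ M n \<in> cell (M n) k'" by (rule cell_endpoints)
  then have "\<bar>f (real k' / 2 ^ M n) - rat_num (F n k')\<bar> \<le> 1 / 2 ^ n" by (rule approx[OF j(2)])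
  moreover have "\<bar>rat_num (F n k') - y\<bar> \<le> 2 / 2 ^ n" using j(1,5,6) by (auto simp: basic_open_eq)
  moreover have "3 / 2 ^ n = 1 / 2 ^ n + (2 / 2 ^ n :: real)" by simp
  ultimately have "\<bar>f (real k' / 2 ^ M n) - y\<bar> \<le> 3 / 2 ^ n" by linarith
  moreover have "real k' / 2 ^ M n \<in> cell l k" using x j(3,4) by (auto simp: cell_def)
  ultimately show ?thesis by blast
qed

end

subsection \<open>Luzin's condition implies reflection of Kurtz randomness\<close>

lemma luzin_N_image_null:
  assumes "luzin_N f" "S \<in> null_sets lebesgue" shows "f ` (S \<inter> {0..1}) \<in> null_sets lebesgue"
  using assms unfolding luzin_N_def by (metis Int_lower1 Int_lower2 null_sets_completion_subset)

context computable_bv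
begin

lemma luzin_N_reflects_kurtz:
  assumes "luzin_N f" shows "reflects (kurtz_random Z) f"
  unfolding reflects_def kurtz_random_def
proof (intro ballI impI allI notI, elim conjE)
  fix x S assume x: "x \<in> {0..1}" "x \<in> S"
    and fx: "\<forall>T. eff_closed Z T \<and> T \<in> null_sets lebesgue \<longrightarrow> f x \<notin> T"
    and S: "eff_closed Z S" "S \<in> null_sets lebesgue"
  obtain W where W: "ce_in Z W" "S = - (\<Union>i\<in>W. basic_open i)" using S(1) unfolding eff_closed_def by blast
  obtain R where R: "cmp (char_fun Z) (\<lambda>p. R (fst p) (snd p))" "W = {n. \<exists>s::nat. R n s}"
    "\<And>n s t. R n s \<Longrightarrow> s \<le> t \<Longrightarrow> R n t" using ce_inE[OF W(1)] by blast
  \<comment> \<open>At precision \<open>n\<close> and stage \<open>t\<close>, cell \<open>k\<close>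
    is no obstacle to the interval \<open>j\<close>: either it is already seen to lie in one
    interval of the complement of \<open>S\<close>, or the values of \<open>f\<close> on it avoid
    \<open>j\<close>. If no cell is an obstacle, \<open>j\<close> is disjoint from the
    image.\<close>
  define Q where "Q n t j k \<longleftrightarrow>
      (\<exists>i<t. R i t \<and> lo i < real k / 2 ^ M n \<and> (real k + 1) / 2 ^ M n < hi i) \<or>
      hi j \<le> rat_num (F n k) - 1 / 2 ^ n \<or> rat_num (F n k) + 1 / 2 ^ n \<le> lo j" for n t j k
  define W' where "W' = {j. \<exists>s. \<forall>k<2 ^ M (fst s). Q (fst s) (snd s) j k}"
  have "ce_in Z W'"
    unfolding W'_def Q_def by (intro ce_inI cmp_intros cmp2[OF R(1)])
  then have closed: "eff_closed Z (- (\<Union>j\<in>W'. basic_open j))" unfolding eff_closed_def by blast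
  let ?K = "S \<inter> {0..1}"
  have "closed S" unfolding W(2) by (intro closed_Compl) (rule open_UN, simp)
  then have K: "compact ?K" by (simp add: closed_Int_compact)
  then have fK: "compact (f ` ?K)"
    by (intro compact_continuous_image continuous_on_subset[OF cont]) auto
  have disj: "y \<notin> basic_open j" if j: "j \<in> W'" and y: "y \<in> f ` ?K" for y j
  proof
    assume yj: "y \<in> basic_open j"
    obtain u where u: "u \<in> S" "u \<in> {0..1}" "y = f u" using y by blast
    obtain n t where nt: "\<And>k. k < 2 ^ M n \<Longrightarrow> Q n t j k" using j unfolding W'_def by auto
    obtain k where k: "k < 2 ^ M n" "u \<in> cell (M n) k" using cell_ex[OF u(2)] by blast
    have "\<not> (\<exists>i<t. R i t \<and> lo i < real k / 2 ^ M n \<and> (real k + 1) / 2 ^ M n < hi i)"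
    proof
      assume "\<exists>i<t. R i t \<and> lo i < real k / 2 ^ M n \<and> (real k + 1) / 2 ^ M n < hi i"
      then obtain i where "i \<in> W" "lo i < real k / 2 ^ M n" "(real k + 1) / 2 ^ M n < hi i"
        using R(2) by blast
      then have "i \<in> W" "u \<in> basic_open i" using k(2) by (auto simp: cell_def basic_open_eq)
      then show False using u(1) W(2) by blast
    qed
    then have "hi j \<le> rat_num (F n k) - 1 / 2 ^ n \<or> rat_num (F n k) + 1 / 2 ^ n \<le> lo j"
      using nt[OF k(1)] unfolding Q_def by blast
    then show False using yj approx[OF k] u(3) by (auto simp: basic_open_eq)
  qed
  have cover: "\<exists>j\<in>W'. y \<in> basic_open j" if y: "y \<notin> f ` ?K" for y
  proof -
    obtain e where e: "e > 0" "\<And>u. u \<in> ?K \<Longrightarrow> e \<le> \<bar>f u - y\<bar>"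
    proof -
      have "open (- (f ` ?K))" using fK by (simp add: compact_imp_closed open_Compl)
      then obtain e where e: "e > 0" "\<And>z. dist z y < e \<Longrightarrow> z \<notin> f ` ?K"
        using y unfolding open_dist by blast
      have "e \<le> \<bar>f u - y\<bar>" if "u \<in> ?K" for u
        using e(2)[of "f u"] that by (force simp: dist_real_def)
      then show thesis using that e(1) by blast
    qed
    \<comment> \<open>Inside the unit interval these are the points whose value is farther than
      \<open>e/2\<close> from \<open>y\<close>. With the intervals from \<open>W\<close> they cover
      it, and small cells lie in a single member of the cover, as \<open>Q\<close> demands.\<close>
    define A where "A = - ({0..1} \<inter> f -` {y - e/2..y + e/2})"
    have "closed ({0..1} \<inter> f -` {y - e/2..y + e/2})"
      by (rule continuous_closed_preimage[OF cont]) auto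
    then have "open A" unfolding A_def by (rule open_Compl)
    have "{0..1} \<subseteq> \<Union>(insert A (basic_open ` W))"
    proof
      fix u :: real assume u: "u \<in> {0..1}"
      show "u \<in> \<Union>(insert A (basic_open ` W))"
      proof (cases "u \<in> S")
        case True
        then have "e \<le> \<bar>f u - y\<bar>" using e(2) u by blast
        then have "u \<in> A" using e(1) by (auto simp: A_def abs_if split: if_splits)
        then show ?thesis by blast
      qed (use W(2) in blast)
    qed
    moreover have "\<And>G. G \<in> insert A (basic_open ` W) \<Longrightarrow> open G" using \<open>open A\<close> by auto
    ultimately obtain m where "\<forall>l\<ge>m. \<forall>k<2 ^ l. \<exists>G\<in>insert A (basic_open ` W). cell l k \<subseteq> G"
      using cells_subordinate[of "insert A (basic_open ` W)"] by blast
    then have m: "cell l k \<subseteq> A \<or> (\<exists>i\<in>W. cell l k \<subseteq> basic_open i)" if "m \<le> l" "k < 2 ^ l" for l k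
      using that by blast
    \<comment> \<open>On cells inside \<open>A\<close> the sampled value is more than
      \<open>e/2\<close> away from \<open>y\<close>. Passing to the approximate value costs less
      than \<open>e/8\<close>, and so does the margin in \<open>Q\<close>; the remaining
      \<open>e/4\<close> is the radius allowed for \<open>j\<close>.\<close>
    obtain n where n: "m \<le> n" "1 / 2 ^ n < e / 8" using pow_half_less[of "e / 8" m] e(1) by auto
    obtain j where j: "y \<in> basic_open j" and j': "y - e/4 \<le> lo j" "hi j \<le> y + e/4"
      using basic_open_within[of "y - e/4" y "y + e/4"] e(1) by auto
    \<comment> \<open>Only finitely many cells are involved and \<open>R\<close> is monotone, so one
      stage \<open>t\<close> serves all of them.\<close>
    have "\<forall>\<^sub>F t in sequentially. \<forall>k\<in>{..<2 ^ M n}. Q n t j k"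
    proof (rule eventually_ball_finite, simp, rule ballI)
      fix k assume "k \<in> {..<(2::nat) ^ M n}"
      then have k: "k < 2 ^ M n" by simp
      have c: "real k / 2 ^ M n \<in> cell (M n) k" "(real k + 1) / 2 ^ M n \<in> cell (M n) k"
        by (rule cell_endpoints)+
      have "cell (M n) k \<subseteq> A \<or> (\<exists>i\<in>W. cell (M n) k \<subseteq> basic_open i)"
        using m[OF _ k] M_ge[of n] n(1) by simp
      then show "\<forall>\<^sub>F t in sequentially. Q n t j k"
      proof
        assume "cell (M n) k \<subseteq> A"
        then have "f (real k / 2 ^ M n) < y - e/2 \<or> f (real k / 2 ^ M n) > y + e/2"
          using c(1) cell_subset_unit[OF k] unfolding A_def by fastforce
        moreover have "\<bar>f (real k / 2 ^ M n) - rat_num (F n k)\<bar> \<le> 1 / 2 ^ n" by (rule approx[OF k c(1)])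
        ultimately have "hi j \<le> rat_num (F n k) - 1 / 2 ^ n \<or> rat_num (F n k) + 1 / 2 ^ n \<le> lo j"
          using j' n(2) by linarith
        then have "Q n t j k" for t by (simp add: Q_def)
        then show ?thesis by simp
      next
        assume "\<exists>i\<in>W. cell (M n) k \<subseteq> basic_open i"
        then obtain i where i: "i \<in> W" "cell (M n) k \<subseteq> basic_open i" by blast
        then obtain s where s: "R i s" using R(2) by blast
        have "lo i < real k / 2 ^ M n" "(real k + 1) / 2 ^ M n < hi i"
          using i(2) c by (auto simp: basic_open_eq)
        then have "Q n t j k" if "max s (Suc i) \<le> t" for t
          using R(3)[OF s, of t] that unfolding Q_def by auto
        then show ?thesis unfolding eventually_sequentially by blast
      qed
    qed
    then obtain t where "\<And>k. k < 2 ^ M n \<Longrightarrow> Q n t j k"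
      unfolding eventually_sequentially by (meson lessThan_iff order_refl)
    then have "j \<in> W'" unfolding W'_def by (intro CollectI exI[of _ "(n, t)"]) simp
    then show ?thesis using j by blast
  qed
  have "- (\<Union>j\<in>W'. basic_open j) = f ` ?K" using disj cover by blast
  moreover have "f ` ?K \<in> null_sets lebesgue" by (rule luzin_N_image_null[OF assms S(2)])
  ultimately have "f x \<notin> f ` ?K" using fx closed by metis
  then show False using x by blast
qed

subsection \<open>Luzin's condition implies reflection of weak 2-randomness\<close>

text \<open>The image of a cell is an interval, so a neighbourhood of radius
  \<open>3 / 2 ^ n\<close> exceeds it by at most two strips of that width.\<close>

lemma emeasure_im_open_diff:
  assumes "k < 2 ^ l"
  shows "emeasure lborel (im_open n l k - f ` cell l k) \<le> ennreal (6 / 2 ^ n)"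
proof -
  obtain a b where ab: "a \<in> cell l k" "b \<in> cell l k" "f ` cell l k = {f a .. f b}" "f a \<le> f b"
    using interval_image[OF cont_cell[OF assms]] by auto
  have "im_open n l k - f ` cell l k \<subseteq> {f a - 3 / 2 ^ n .. f a} \<union> {f b .. f b + 3 / 2 ^ n}"
  proof
    fix y assume y: "y \<in> im_open n l k - f ` cell l k"
    then obtain x where x: "x \<in> cell l k" "\<bar>f x - y\<bar> \<le> 3 / 2 ^ n" using im_open_near by blast
    then have "f x \<in> {f a .. f b}" using ab(3) by blast
    moreover have "y \<notin> {f a .. f b}" using y ab(3) by blast
    ultimately show "y \<in> {f a - 3 / 2 ^ n .. f a} \<union> {f b .. f b + 3 / 2 ^ n}"
      using x(2) by auto
  qed
  then have "emeasure lborel (im_open n l k - f ` cell l k)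
      \<le> emeasure lborel ({f a - 3 / 2 ^ n .. f a} \<union> {f b .. f b + 3 / 2 ^ n})"
    by (intro emeasure_mono) auto
  also have "\<dots> \<le> emeasure lborel {f a - 3 / 2 ^ n .. f a} + emeasure lborel {f b .. f b + 3 / 2 ^ n}"
    by (intro emeasure_subadditive) auto
  also have "\<dots> = ennreal (3 / 2 ^ n) + ennreal (3 / 2 ^ n)" by simp
  also have "\<dots> = ennreal (6 / 2 ^ n)" by (subst ennreal_plus[symmetric]) auto
  finally show ?thesis .
qed

text \<open>Images of open sets need not be open, so the test for \<open>f x\<close> uses the
  neighbourhoods \<open>im_open\<close> of images of cells. At level \<open>m\<close> these add at
  most \<open>12 / 2 ^ m\<close> of measure: the 6 of \<open>emeasure_im_open_diff\<close>, doubled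
  by a geometric series.\<close>

lemma luzin_N_reflects_weak2:
  assumes "luzin_N f" shows "reflects weak2_random f"
  unfolding reflects_def weak2_random_def
proof (intro ballI impI allI notI, elim conjE)
  fix x S assume x: "x \<in> {0..1}" "x \<in> S"
    and fx: "\<forall>T. Pi02 T \<and> T \<in> null_sets lebesgue \<longrightarrow> f x \<notin> T"
    and S: "Pi02 S" "S \<in> null_sets lebesgue"
  obtain W where W: "ce_in {} W" "S = (\<Inter>n. \<Union>i\<in>{i. prod_encode (n, i) \<in> W}. basic_open i)"
    using S(1) unfolding Pi02_def by blast
  obtain R where R: "cmp (char_fun {}) (\<lambda>p. R (fst p) (snd p))" "W = {n. \<exists>s::nat. R n s}"
    "\<And>n s t. R n s \<Longrightarrow> s \<le> t \<Longrightarrow> R n t" using ce_inE[OF W(1)] by blast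
  define lev :: "nat \<Rightarrow> nat" where "lev e = fst (prod_decode (snd (prod_decode e)))" for e
  define pos :: "nat \<Rightarrow> nat" where "pos e = snd (prod_decode (snd (prod_decode e)))" for e
  define stg :: "nat \<Rightarrow> nat" where "stg e = fst (prod_decode e)" for e
  \<comment> \<open>A number \<open>e\<close> names a stage and a cell that is seen at this stage
    inside one interval from each of the first \<open>m + 1\<close> open sets. Asking for all of
    them makes \<open>Am\<close> decreasing even when the given open sets are not.\<close>
  define cert where "cert m e \<longleftrightarrow> pos e < 2 ^ lev e \<and> (\<forall>n<Suc m. \<exists>i<stg e.
      R (prod_encode (n, i)) (stg e) \<and> lo i < real (pos e) / 2 ^ lev e \<and>
      (real (pos e) + 1) / 2 ^ lev e < hi i)" for m e
  \<comment> \<open>Here \<open>lev e\<close> makes \<open>image_cell_subset_im_open\<close>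
    applicable, \<open>e\<close> makes the errors summable over all certificates, and
    \<open>m\<close> sends their sum to zero.\<close>
  define prec where "prec m e = lev e + e + m" for m e
  define W' where "W' = {w. \<exists>e::nat. cert (fst (prod_decode w)) e \<and>
      im_index (prec (fst (prod_decode w)) e) (lev e) (pos e) (snd (prod_decode w))}"
  have "ce_in {} W'"
    unfolding W'_def cert_def prec_def lev_def pos_def stg_def
    by (intro ce_inI cmp_intros cmp2[OF R(1)])
  define Vm where "Vm m = (\<Union>e\<in>{e. cert m e}. im_open (prec m e) (lev e) (pos e))" for m
  define T where "T = (\<Inter>m. Vm m)"
  have "(\<Union>j\<in>{j. prod_encode (m, j) \<in> W'}. basic_open j) = Vm m" for m
    unfolding W'_def Vm_def im_open_def by auto
  then have "Pi02 T" unfolding T_def Pi02_def using \<open>ce_in {} W'\<close> by (intro exI[of _ W']) simp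
  define Am where "Am m = (\<Union>e\<in>{e. cert m e}. f ` cell (lev e) (pos e))" for m
  have cert_lt: "cert m e \<Longrightarrow> pos e < 2 ^ lev e" for m e by (simp add: cert_def)
  have cert_in: "\<exists>i. prod_encode (n, i) \<in> W \<and> u \<in> basic_open i"
    if ce: "cert m e" "n \<le> m" "u \<in> cell (lev e) (pos e)" for m e n u
  proof -
    obtain i where "R (prod_encode (n, i)) (stg e)" "lo i < real (pos e) / 2 ^ lev e"
        "(real (pos e) + 1) / 2 ^ lev e < hi i"
      using ce(1,2) unfolding cert_def by (auto simp: less_Suc_eq_le)
    then show ?thesis using ce(3) R(2) by (intro exI[of _ i]) (auto simp: basic_open_eq cell_def)
  qed
  have fS: "f u \<in> Am m" "f u \<in> Vm m" if u: "u \<in> S" "u \<in> {0..1}" for u m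
  proof -
    have "\<forall>n. \<exists>i. prod_encode (n, i) \<in> W \<and> u \<in> basic_open i" using u(1) W(2) by auto
    then obtain I where I: "\<And>n. prod_encode (n, I n) \<in> W" "\<And>n. u \<in> basic_open (I n)" by metis
    have "open (\<Inter>n\<in>{..m}. basic_open (I n))" by (intro open_INT) auto
    moreover have "u \<in> (\<Inter>n\<in>{..m}. basic_open (I n))" using I(2) by blast
    ultimately have "\<exists>l0. \<forall>l\<ge>l0. \<forall>k. u \<in> cell l k \<longrightarrow> cell l k \<subseteq> (\<Inter>n\<in>{..m}. basic_open (I n))"
      using u(2) by (rule cell_around)
    then obtain l where "\<forall>l'\<ge>l. \<forall>k. u \<in> cell l' k \<longrightarrow> cell l' k \<subseteq> (\<Inter>n\<in>{..m}. basic_open (I n))" ..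
    then have l: "u \<in> cell l k \<Longrightarrow> cell l k \<subseteq> (\<Inter>n\<in>{..m}. basic_open (I n))" for k
      by (meson order_refl)
    obtain k where k: "k < 2 ^ l" "u \<in> cell l k" using cell_ex[OF u(2)] by blast
    have "\<forall>\<^sub>F t in sequentially. \<forall>n\<in>{..m}. I n < t \<and> R (prod_encode (n, I n)) t"
    proof (rule eventually_ball_finite, simp, rule ballI)
      fix n
      obtain s where "R (prod_encode (n, I n)) s" using I(1) R(2) by blast
      then have "I n < t \<and> R (prod_encode (n, I n)) t" if "max s (Suc (I n)) \<le> t" for t
        using R(3) that by auto
      then show "\<forall>\<^sub>F t in sequentially. I n < t \<and> R (prod_encode (n, I n)) t"
        unfolding eventually_sequentially by blast
    qed
    then obtain t where t: "\<And>n. n \<le> m \<Longrightarrow> I n < t \<and> R (prod_encode (n, I n)) t"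
      unfolding eventually_sequentially by (meson atMost_iff order_refl)
    define e where "e = prod_encode (t, prod_encode (l, k))"
    have e: "stg e = t" "lev e = l" "pos e = k" by (auto simp: e_def stg_def lev_def pos_def)
    have c: "real k / 2 ^ l \<in> cell l k" "(real k + 1) / 2 ^ l \<in> cell l k"
      by (rule cell_endpoints)+
    have "cert m e" unfolding cert_def e
    proof (intro conjI allI impI k(1))
      fix n assume "n < Suc m"
      then have "n \<le> m" by simp
      then have "cell l k \<subseteq> basic_open (I n)" using l[OF k(2)] by blast
      then have "lo (I n) < real k / 2 ^ l" "(real k + 1) / 2 ^ l < hi (I n)"
        using c by (auto simp: basic_open_eq)
      then show "\<exists>i<t. R (prod_encode (n, i)) t \<and> lo i < real k / 2 ^ l \<and> (real k + 1) / 2 ^ l < hi i"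
        using t[OF \<open>n \<le> m\<close>] by blast
    qed
    moreover have "f u \<in> f ` cell (lev e) (pos e)" using k(2) e by simp
    moreover have "f u \<in> im_open (prec m e) (lev e) (pos e)"
      using image_cell_subset_im_open[of l "prec m e" k] k e by (auto simp: prec_def)
    ultimately show "f u \<in> Am m" "f u \<in> Vm m" unfolding Am_def Vm_def by blast+
  qed
  have Am_borel [measurable]: "Am m \<in> sets borel" for m
    unfolding Am_def by (intro sets.countable_UN') (auto intro!: image_cell_borel dest: cert_lt)
  have "cert m e" if "cert (Suc m) e" for m e using that by (auto simp: cert_def)
  then have dec: "decseq Am" by (intro decseq_SucI) (auto simp: Am_def)
  have "(\<Inter>m. Am m) \<subseteq> f ` (S \<inter> {0..1}) \<union> {y. infinite (pre y)}"
  proof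
    fix y assume y: "y \<in> (\<Inter>m. Am m)"
    show "y \<in> f ` (S \<inter> {0..1}) \<union> {y. infinite (pre y)}"
    proof (cases "finite (pre y)")
      case True
      have "\<exists>u\<in>pre y. \<forall>n\<le>m. \<exists>i. prod_encode (n, i) \<in> W \<and> u \<in> basic_open i" for m
      proof -
        obtain e u where eu: "cert m e" "u \<in> cell (lev e) (pos e)" "y = f u" using y unfolding Am_def by blast
        then have "u \<in> pre y" using cell_subset_unit[OF cert_lt] by blast
        then show ?thesis using cert_in eu by blast
      qed
      then obtain U where U: "\<And>m. U m \<in> pre y"
        "\<And>m n. n \<le> m \<Longrightarrow> \<exists>i. prod_encode (n, i) \<in> W \<and> U m \<in> basic_open i" by metis
      have "finite (range U)" using U(1) True finite_subset[of "range U" "pre y"] by blast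
      then obtain m0 where m0: "infinite {m. U m = U m0}"
        using pigeonhole_infinite[of "UNIV :: nat set" U] by auto
      have "\<exists>i. prod_encode (n, i) \<in> W \<and> U m0 \<in> basic_open i" for n
      proof -
        obtain m where "m \<in> {m. U m = U m0}" "n \<le> m" using m0 infinite_nat_iff_unbounded_le by blast
        then have "U m = U m0" by simp
        then show ?thesis using U(2)[OF \<open>n \<le> m\<close>] by simp
      qed
      then have "U m0 \<in> S" unfolding W(2) by blast
      then show ?thesis using U(1)[of m0] by blast
    qed simp
  qed
  moreover have "f ` (S \<inter> {0..1}) \<in> null_sets lebesgue" by (rule luzin_N_image_null[OF assms S(2)])
  ultimately have "(\<Inter>m. Am m) \<in> null_sets lebesgue"
    using infinite_pre_null null_sets_completion_subset null_sets.Un by blast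
  then have "emeasure lborel (\<Inter>m. Am m) = 0"
    by (simp add: null_sets_def emeasure_completion)
  moreover have "(\<lambda>m. emeasure lborel (Am m)) \<longlonglongrightarrow> emeasure lborel (\<Inter>m. Am m)"
  proof (rule Lim_emeasure_decseq[OF _ dec])
    have "Am m \<subseteq> f ` {0..1}" for m unfolding Am_def using cell_subset_unit[OF cert_lt] by blast
    moreover have "compact (f ` {0..1})" by (intro compact_continuous_image cont) auto
    ultimately show "emeasure lborel (Am m) \<noteq> \<infinity>" for m
      using emeasure_mono[of "Am m" "f ` {0..1}" lborel] emeasure_compact_finite[of "f ` {0..1}"]
      by (simp add: borel_compact)
  qed auto
  ultimately have lim: "(\<lambda>m. emeasure lborel (Am m)) \<longlonglongrightarrow> 0" by simp
  have Vm_le: "emeasure lborel (Vm m) \<le> emeasure lborel (Am m) + ennreal (12 / 2 ^ m)" for m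
  proof -
    define D where "D e = (if cert m e then im_open (prec m e) (lev e) (pos e) - f ` cell (lev e) (pos e) else {})" for e
    have Db [measurable]: "D e \<in> sets borel" for e
      unfolding D_def by (auto intro!: image_cell_borel dest: cert_lt)
    have "Vm m \<subseteq> Am m \<union> (\<Union>e. D e)" unfolding Vm_def Am_def D_def by auto
    then have "emeasure lborel (Vm m) \<le> emeasure lborel (Am m \<union> (\<Union>e. D e))"
      by (intro emeasure_mono) auto
    also have "\<dots> \<le> emeasure lborel (Am m) + emeasure lborel (\<Union>e. D e)"
      by (intro emeasure_subadditive) auto
    also have "emeasure lborel (\<Union>e. D e) \<le> (\<Sum>e. emeasure lborel (D e))"
      by (intro emeasure_subadditive_countably) auto
    also have "\<dots> \<le> (\<Sum>e. ennreal ((6 / 2 ^ m) * (1/2) ^ e))"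
    proof (intro suminf_le)
      fix e
      have "6 / 2 ^ prec m e \<le> 6 / (2 ^ (e + m) :: real)"
        unfolding prec_def by (intro frac_le power_increasing) auto
      also have "\<dots> = (6 / 2 ^ m) * (1/2) ^ e" by (simp add: power_add power_one_over)
      finally have "ennreal (6 / 2 ^ prec m e) \<le> ennreal ((6 / 2 ^ m) * (1/2) ^ e)" by (rule ennreal_leI)
      then show "emeasure lborel (D e) \<le> ennreal ((6 / 2 ^ m) * (1/2) ^ e)"
        using order_trans[OF emeasure_im_open_diff[OF cert_lt, of m e "prec m e"]]
        unfolding D_def by (cases "cert m e") simp_all
    qed auto
    also have "(\<Sum>e. ennreal ((6 / 2 ^ m) * (1/2) ^ e)) = ennreal (12 / 2 ^ m)"
    proof (rule suminf_ennreal_eq)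
      have "(\<lambda>e. (1/2 :: real) ^ e) sums 2" using geometric_sums[of "1/2 :: real"] by simp
      from sums_mult[OF this, of "6 / 2 ^ m"] show "(\<lambda>e. (6 / 2 ^ m) * (1/2 :: real) ^ e) sums (12 / 2 ^ m)"
        by simp
    qed auto
    finally show ?thesis by (simp add: add_left_mono)
  qed
  have "(\<lambda>m. ennreal (12 * (1/2) ^ m)) \<longlonglongrightarrow> ennreal (12 * 0)"
    by (intro tendsto_ennrealI tendsto_mult tendsto_const LIMSEQ_power_zero) auto
  then have "(\<lambda>m. emeasure lborel (Am m) + ennreal (12 / 2 ^ m)) \<longlonglongrightarrow> 0"
    using tendsto_add[OF lim] by (simp add: power_one_over)
  then have "emeasure lborel T \<le> 0"
  proof (rule LIMSEQ_le_const, intro exI allI impI)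
    fix m
    have "Vm m \<in> sets lborel" unfolding Vm_def sets_lborel by (intro borel_open open_UN ballI) auto
    then have "emeasure lborel T \<le> emeasure lborel (Vm m)" unfolding T_def by (intro emeasure_mono) auto
    then show "emeasure lborel T \<le> emeasure lborel (Am m) + ennreal (12 / 2 ^ m)" using Vm_le[of m] by simp
  qed
  moreover have "T \<in> sets borel"
    unfolding T_def Vm_def by (intro sets.countable_INT' borel_open open_UN ballI) auto
  ultimately have "T \<in> null_sets lebesgue"
    by (intro null_sets_completionI) (auto simp: null_sets_def)
  then have "f x \<notin> T" using fx \<open>Pi02 T\<close> by blast
  moreover have "f x \<in> T" using fS(2)[OF x(2,1)] by (simp add: T_def)
  ultimately show False by blast
qed

end

subsection \<open>Borel codes\<close>

definition code_Un :: "(nat \<Rightarrow> nat \<Rightarrow> nat) \<Rightarrow> nat \<Rightarrow> nat" where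
  "code_Un C k = (case k of 0 \<Rightarrow> 2 | Suc m \<Rightarrow> C (fst (prod_decode m)) (snd (prod_decode m)))"

definition code_Compl :: "(nat \<Rightarrow> nat) \<Rightarrow> nat \<Rightarrow> nat" where
  "code_Compl c k = (case k of 0 \<Rightarrow> 1 | Suc m \<Rightarrow> c m)"

definition code_basic_open :: "nat \<Rightarrow> nat \<Rightarrow> nat" where
  "code_basic_open j k = (if k = 0 then 0 else j)"

definition code_Inter :: "(nat \<Rightarrow> nat \<Rightarrow> nat) \<Rightarrow> nat \<Rightarrow> nat" where
  "code_Inter C = code_Compl (code_Un (\<lambda>n. code_Compl (C n)))"

definition code_Int :: "(nat \<Rightarrow> nat) \<Rightarrow> (nat \<Rightarrow> nat) \<Rightarrow> nat \<Rightarrow> nat" where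
  "code_Int c d = code_Inter (\<lambda>n m. if n = 0 then c m else d m)"

text \<open>The constant code \<open>0\<close> codes the empty set, because the basic open set with index \<open>0\<close> is empty.\<close>

definition code_if :: "bool \<Rightarrow> (nat \<Rightarrow> nat) \<Rightarrow> nat \<Rightarrow> nat" where
  "code_if b c k = (if b then c k else 0)"

lemma borel_code_Un:
  assumes "\<And>n. borel_code (C n) (S n)" shows "borel_code (code_Un C) (\<Union>n. S n)"
proof (rule borel_code.code_union)
  show "borel_code (\<lambda>k. code_Un C (Suc (prod_encode (n, k)))) (S n)" for n
    using assms[of n] by (simp add: code_Un_def)
qed (simp add: code_Un_def)

lemma borel_code_Compl:
  assumes "borel_code c S" shows "borel_code (code_Compl c) (- S)"
proof (rule borel_code.code_compl)
  show "borel_code (\<lambda>k. code_Compl c (Suc k)) S" using assms by (simp add: code_Compl_def)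
qed (simp add: code_Compl_def)

lemma borel_code_basic_open: "borel_code (code_basic_open j) (basic_open j)"
  using borel_code.code_basic[of "code_basic_open j"] by (simp add: code_basic_open_def)

lemma borel_code_empty: "borel_code (\<lambda>k. 0) {}"
  using borel_code.code_basic[of "\<lambda>k. 0"] by simp

lemma borel_code_Inter:
  assumes "\<And>n. borel_code (C n) (S n)" shows "borel_code (code_Inter C) (\<Inter>n. S n)"
proof -
  have "borel_code (code_Inter C) (- (\<Union>n. - S n))"
    unfolding code_Inter_def by (intro borel_code_Compl borel_code_Un assms)
  then show ?thesis by simp
qed

lemma borel_code_Int:
  assumes "borel_code c S" "borel_code d T" shows "borel_code (code_Int c d) (S \<inter> T)"
proof -
  have "borel_code (code_Int c d) (\<Inter>n::nat. if n = 0 then S else T)"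
    unfolding code_Int_def
  proof (rule borel_code_Inter)
    show "borel_code (\<lambda>m. if n = 0 then c m else d m) (if n = 0 then S else T)" for n :: nat
      using assms by (cases n) simp_all
  qed
  moreover have "(\<Inter>n::nat. if n = 0 then S else T) = S \<inter> T"
    by (auto split: if_splits)
  ultimately show ?thesis by simp
qed

lemma borel_code_if:
  assumes "b \<Longrightarrow> borel_code c S" shows "borel_code (code_if b c) (if b then S else {})"
  unfolding code_if_def using assms borel_code_empty by (cases b) simp_all

lemma cmp_code_Un [cmp_intros]:
  assumes "cmp g k" "cmp g (\<lambda>p. C (fst p) (fst (snd p)) (snd (snd p)))"
  shows "cmp g (\<lambda>x. code_Un (C x) (k x))"
  unfolding code_Un_def by (intro cmp_intros assms(1) cmp3[OF assms(2)])

lemma cmp_code_Compl [cmp_intros]: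
  assumes "cmp g k" "cmp g (\<lambda>p. c (fst p) (snd p))"
  shows "cmp g (\<lambda>x. code_Compl (c x) (k x))"
  unfolding code_Compl_def by (intro cmp_intros assms(1) cmp2[OF assms(2)])

lemma cmp_code_basic_open [cmp_intros]:
  assumes "cmp g k" "cmp g j" shows "cmp g (\<lambda>x. code_basic_open (j x) (k x))"
  unfolding code_basic_open_def by (intro cmp_intros assms)

lemma cmp_code_Inter [cmp_intros]:
  assumes "cmp g k" "cmp g (\<lambda>p. C (fst p) (fst (snd p)) (snd (snd p)))"
  shows "cmp g (\<lambda>x. code_Inter (C x) (k x))"
  unfolding code_Inter_def by (intro cmp_intros assms(1) cmp3[OF assms(2)])

lemma cmp_code_Int [cmp_intros]:
  assumes "cmp g k" "cmp g (\<lambda>p. c (fst p) (snd p))" "cmp g (\<lambda>p. d (fst p) (snd p))"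
  shows "cmp g (\<lambda>x. code_Int (c x) (d x) (k x))"
  unfolding code_Int_def by (intro cmp_intros assms(1) cmp2[OF assms(2)] cmp2[OF assms(3)])

lemma cmp_code_if [cmp_intros]:
  assumes "cmp g k" "cmp g b" "cmp g (\<lambda>p. c (fst p) (snd p))"
  shows "cmp g (\<lambda>x. code_if (b x) (c x) (k x))"
  unfolding code_if_def by (intro cmp_intros assms(1,2) cmp2[OF assms(3)])

section \<open>Substitution at the leaves of a Borel code\<close>

function subst_leaves :: "(nat \<Rightarrow> nat \<Rightarrow> nat) \<Rightarrow> (nat \<Rightarrow> nat) \<Rightarrow> nat \<Rightarrow> nat" where
  "subst_leaves L c k =
     (if c 0 = 0 then L (c 1) k
      else case k of 0 \<Rightarrow> c 0
        | Suc m \<Rightarrow> if c 0 = 1 then subst_leaves L (\<lambda>i. c (Suc i)) m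
            else subst_leaves L (\<lambda>i. c (Suc (prod_encode (fst (prod_decode m), i)))) (snd (prod_decode m)))"
  by pat_completeness auto

lemma snd_prod_decode_le: "snd (prod_decode m) \<le> m"
  using le_prod_encode_2[of "snd (prod_decode m)" "fst (prod_decode m)"] by simp

termination
  \<comment> \<open>The recursion follows the position that is read, which drops at every step, and
    not the code; so it ends even for functions that code nothing.\<close>
  by (relation "Wellfounded.measure (\<lambda>(L, c, k). k)") (auto simp: less_Suc_eq_le snd_prod_decode_le)

declare subst_leaves.simps [simp del]

text \<open>Preimages under \<open>h\<close> commute with complements and unions, so replacing each
  leaf by a code of its preimage yields a code of the preimage of \<open>S\<close>. Only points of
  \<open>Y\<close> are controlled: a complement in the code may bring in arbitrary points outside
  \<open>Y\<close>.\<close>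

lemma borel_code_subst_leaves:
  assumes "borel_code c S"
    and L: "\<And>j. borel_code (L j) (TL j)" "\<And>j y. y \<in> Y \<Longrightarrow> y \<in> TL j \<longleftrightarrow> h y \<in> basic_open j"
  shows "\<exists>T. borel_code (subst_leaves L c) T \<and> (\<forall>y\<in>Y. y \<in> T \<longleftrightarrow> h y \<in> S)"
  using assms(1)
proof (induction rule: borel_code.induct)
  case (code_basic c)
  then have "subst_leaves L c = L (c 1)" by (intro ext) (simp add: subst_leaves.simps)
  then show ?case using L by (intro exI[of _ "TL (c 1)"]) simp
next
  case (code_compl c S)
  then obtain T where T: "borel_code (subst_leaves L (\<lambda>k. c (Suc k))) T" "\<forall>y\<in>Y. y \<in> T \<longleftrightarrow> h y \<in> S"
    by blast
  have "borel_code (subst_leaves L c) (- T)"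
  proof (rule borel_code.code_compl)
    show "subst_leaves L c 0 = 1" using code_compl(1) by (simp add: subst_leaves.simps)
    have "(\<lambda>k. subst_leaves L c (Suc k)) = subst_leaves L (\<lambda>k. c (Suc k))"
      using code_compl(1) by (intro ext) (subst subst_leaves.simps, simp)
    then show "borel_code (\<lambda>k. subst_leaves L c (Suc k)) T" using T(1) by simp
  qed
  then show ?case using T(2) by blast
next
  case (code_union c S)
  then obtain T where T: "\<And>n. borel_code (subst_leaves L (\<lambda>k. c (Suc (prod_encode (n, k))))) (T n)"
    "\<And>n. \<forall>y\<in>Y. y \<in> T n \<longleftrightarrow> h y \<in> S n" by metis
  have "borel_code (subst_leaves L c) (\<Union>n. T n)"
  proof (rule borel_code.code_union)
    show "2 \<le> subst_leaves L c 0" using code_union(1) by (simp add: subst_leaves.simps)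
    have "(\<lambda>k. subst_leaves L c (Suc (prod_encode (n, k))))
        = subst_leaves L (\<lambda>k. c (Suc (prod_encode (n, k))))" for n
      using code_union(1) by (intro ext) (subst subst_leaves.simps, simp)
    then show "borel_code (\<lambda>k. subst_leaves L c (Suc (prod_encode (n, k)))) (T n)" for n
      using T(1) by simp
  qed
  then show ?case using T(2) by blast
qed

text \<open>
  A path through a code is a list of steps, the last step first; \<open>path_addr w k\<close> is the position in
  the whole code of position \<open>k\<close> of the subcode at the end of \<open>w\<close>.
\<close>

definition step_addr :: "nat \<Rightarrow> nat \<Rightarrow> nat" where
  "step_addr s k = (case s of 0 \<Rightarrow> Suc k | Suc n \<Rightarrow> Suc (prod_encode (n, k)))"

function path_addr :: "nat \<Rightarrow> nat \<Rightarrow> nat" where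
  "path_addr 0 k = k"
| "path_addr (Suc v) k = path_addr (snd (prod_decode v)) (step_addr (fst (prod_decode v)) k)"
  by pat_completeness auto

termination
  by (relation "Wellfounded.measure fst") (auto simp: less_Suc_eq_le snd_prod_decode_le)

text \<open>The recursion becomes an iteration on pairs. As the code of the path drops at each step
  and 0 is left fixed, as many iterations as the code itself suffice.\<close>

lemma cmp_path_addr [cmp_intros]:
  assumes "cmp g a" "cmp g b" shows "cmp g (\<lambda>x. path_addr (a x) (b x))"
proof -
  define F where "F s = (case fst s of 0 \<Rightarrow> s
     | Suc v \<Rightarrow> (snd (prod_decode v), step_addr (fst (prod_decode v)) (snd s)))" for s :: "nat \<times> nat"
  have F: "w \<le> n \<Longrightarrow> snd ((F ^^ n) (w, k)) = path_addr w k" for n w k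
  proof (induction n arbitrary: w k)
    case (Suc n)
    show ?case
    proof (cases w)
      case 0
      then have "F (w, k) = (w, k)" by (simp add: F_def)
      then show ?thesis using Suc.IH[of w k] 0 by (simp add: funpow_Suc_right del: funpow.simps)
    next
      case (Suc v)
      then have "F (w, k) = (snd (prod_decode v), step_addr (fst (prod_decode v)) k)" by (simp add: F_def)
      moreover have "snd (prod_decode v) \<le> n" using Suc.prems Suc snd_prod_decode_le[of v] by simp
      ultimately show ?thesis using Suc.IH Suc by (simp add: funpow_Suc_right del: funpow.simps)
    qed
  qed simp
  have "cmp g (\<lambda>x. snd ((F ^^ a x) (a x, b x)))"
    unfolding F_def step_addr_def by (intro cmp_intros assms)
  then show ?thesis by (simp add: F)
qed

text \<open>The recursion of \<open>subst_leaves\<close> changes its function argument, which no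
  number can store. Every subcode is read from \<open>c\<close> along a path, however, so a state
  consisting of a path and a position is enough.\<close>

lemma cmp_subst_leaves:
  assumes "cmp g k" "cmp g (\<lambda>p. L (fst p) (fst (snd p)) (snd (snd p)))" "cmp g c"
  shows "cmp g (\<lambda>x. subst_leaves (L x) c (k x))"
proof -
  define tag where "tag s = c (path_addr (fst s) 0)" for s :: "nat \<times> nat"
  \<comment> \<open>States at a leaf or at position 0 are left fixed, so the \<open>k\<close>
    iterations allowed may exceed those needed.\<close>
  define G where "G s = (if tag s = 0 \<or> snd s = 0 then s
     else if tag s = 1 then (Suc (prod_encode (0, fst s)), snd s - 1)
     else (Suc (prod_encode (Suc (fst (prod_decode (snd s - 1))), fst s)), snd (prod_decode (snd s - 1))))"
    for s :: "nat \<times> nat"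
  define out where "out x s = (if tag s = 0 then L x (c (path_addr (fst s) 1)) (snd s) else tag s)" for x s
  have fixpt: "G s = s \<Longrightarrow> (G ^^ n) s = s" for s n by (induction n) auto
  have G: "k \<le> n \<Longrightarrow> out x ((G ^^ n) (w, k)) = subst_leaves (L x) (\<lambda>i. c (path_addr w i)) k" for x n w k
  proof (induction n arbitrary: w k)
    case 0
    then show ?case by (subst subst_leaves.simps) (simp add: out_def tag_def)
  next
    case (Suc n)
    have un: "(G ^^ Suc n) (w, k) = (G ^^ n) (G (w, k))" by (simp add: funpow_Suc_right del: funpow.simps)
    show ?case
    proof (cases "tag (w, k) = 0 \<or> k = 0")
      case True
      then have "G (w, k) = (w, k)" by (simp add: G_def)
      then have "(G ^^ Suc n) (w, k) = (w, k)" by (rule fixpt)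
      then show ?thesis using True by (subst subst_leaves.simps) (auto simp: out_def tag_def)
    next
      case False
      then obtain m where m: "k = Suc m" by (cases k) auto
      have "m \<le> n" using Suc.prems m by simp
      show ?thesis
      proof (cases "tag (w, k) = 1")
        case True
        then have "G (w, k) = (Suc (prod_encode (0, w)), m)" using False m by (simp add: G_def)
        then have "out x ((G ^^ Suc n) (w, k))
            = subst_leaves (L x) (\<lambda>i. c (path_addr (Suc (prod_encode (0, w))) i)) m"
          using Suc.IH[OF \<open>m \<le> n\<close>] un by simp
        also have "\<dots> = subst_leaves (L x) (\<lambda>i. c (path_addr w i)) k"
          using True m by (subst (2) subst_leaves.simps) (simp add: tag_def step_addr_def)
        finally show ?thesis .
      next
        case F1: False
        define a b where "a = fst (prod_decode m)" and "b = snd (prod_decode m)"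
        have "G (w, k) = (Suc (prod_encode (Suc a, w)), b)" using False F1 m by (simp add: G_def a_def b_def)
        moreover have "b \<le> n" using snd_prod_decode_le[of m] \<open>m \<le> n\<close> by (simp add: b_def)
        ultimately have "out x ((G ^^ Suc n) (w, k))
            = subst_leaves (L x) (\<lambda>i. c (path_addr (Suc (prod_encode (Suc a, w))) i)) b"
          using Suc.IH un by simp
        also have "\<dots> = subst_leaves (L x) (\<lambda>i. c (path_addr w i)) k"
          using False F1 m
          by (subst (2) subst_leaves.simps) (simp add: tag_def step_addr_def a_def b_def)
        finally show ?thesis .
      qed
    qed
  qed
  have "cmp g (\<lambda>x. out x ((G ^^ k x) (0, k x)))"
    unfolding out_def G_def tag_def
    by (intro cmp_intros assms(1) cmp_compose[OF assms(3)] cmp3[OF assms(2)])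
  then show ?thesis by (simp add: G)
qed

section \<open>Codes for images, and values taken once in a cell\<close>

context computable_bv
begin

text \<open>The image of a cell is compact, hence the intersection of its shrinking neighbourhoods.
  Precisions start at \<open>l\<close>, as \<open>image_cell_subset_im_open\<close>
  requires.\<close>

definition code_image :: "nat \<Rightarrow> nat \<Rightarrow> nat \<Rightarrow> nat" where
  "code_image l k = code_Inter (\<lambda>i. code_Un (\<lambda>j. code_basic_open (if im_index (l + i) l k j then j else 0)))"

lemma cmp_code_image [cmp_intros]:
  assumes "cmp g a" "cmp g b" "cmp g c" shows "cmp g (\<lambda>x. code_image (a x) (b x) (c x))"
  by (rule cmp3[OF _ assms]) (unfold code_image_def, intro cmp_intros)

lemma borel_code_image:
  assumes "k < 2 ^ l" shows "borel_code (code_image l k) (f ` cell l k)"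
proof -
  have "borel_code (code_image l k) (\<Inter>i. \<Union>j. basic_open (if im_index (l + i) l k j then j else 0))"
    unfolding code_image_def by (intro borel_code_Inter borel_code_Un borel_code_basic_open)
  moreover have "(\<Union>j. basic_open (if im_index (l + i) l k j then j else 0)) = im_open (l + i) l k" for i
    unfolding im_open_def by (auto split: if_splits)
  moreover have "(\<Inter>i. im_open (l + i) l k) = f ` cell l k"
  proof
    show "f ` cell l k \<subseteq> (\<Inter>i. im_open (l + i) l k)"
      by (intro INT_greatest image_cell_subset_im_open assms) simp
    show "(\<Inter>i. im_open (l + i) l k) \<subseteq> f ` cell l k"
    proof
      fix y assume y: "y \<in> (\<Inter>i. im_open (l + i) l k)"
      have "y \<in> closure (f ` cell l k)" unfolding closure_approachable
      proof (intro allI impI)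
        fix e :: real assume "0 < e"
        then obtain n where n: "1 / 2 ^ n < e / 3" using pow_half_less[of "e / 3" 0] by auto
        obtain x where x: "x \<in> cell l k" "\<bar>f x - y\<bar> \<le> 3 / 2 ^ (l + n)" using im_open_near y by blast
        have "3 / 2 ^ (l + n) \<le> (3 / 2 ^ n :: real)" by (intro frac_le power_increasing) auto
        also have "\<dots> < e" using n by simp
        finally have "dist (f x) y < e" using x(2) by (simp add: dist_real_def)
        then show "\<exists>z\<in>f ` cell l k. dist z y < e" using x(1) by blast
      qed
      then show "y \<in> f ` cell l k"
        using compact_imp_closed[OF compact_image_cell[OF assms]] by simp
    qed
  qed
  ultimately show ?thesis by simp
qed

definition subcell :: "nat \<Rightarrow> nat \<Rightarrow> nat \<times> nat \<Rightarrow> bool" where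
  "subcell l k p \<longleftrightarrow> snd p < 2 ^ fst p \<and> real k / 2 ^ l \<le> real (snd p) / 2 ^ fst p \<and>
     (real (snd p) + 1) / 2 ^ fst p \<le> (real k + 1) / 2 ^ l"

lemma subcell_subset: "subcell l k p \<Longrightarrow> cell (fst p) (snd p) \<subseteq> cell l k"
  unfolding subcell_def cell_def by auto

lemma subcell_ex:
  assumes "k < 2 ^ l" "x \<in> cell l k" "open G" "x \<in> G"
  shows "\<exists>p. subcell l k p \<and> x \<in> cell (fst p) (snd p) \<and> cell (fst p) (snd p) \<subseteq> G"
proof -
  have "x \<in> {0..1}" using assms(1,2) cell_subset_unit by blast
  then obtain m where m: "\<And>l' k'. m \<le> l' \<Longrightarrow> x \<in> cell l' k' \<Longrightarrow> cell l' k' \<subseteq> G"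
    using cell_around[OF assms(3,4)] by metis
  obtain k' where k': "k' div 2 ^ m = k" "x \<in> cell (l + m) k'" using cell_sub_ex[OF assms(2)] by blast
  have "k' < 2 ^ (l + m)" using k'(1) assms(1) div_less_power2[of k' m l] by simp
  then have "subcell l k (l + m, k')"
    using cell_refine(1)[where k' = k' and d = m and l = l]
      cell_refine(2)[where k' = k' and d = m and l = l] k'(1) by (auto simp: subcell_def)
  moreover have "cell (l + m) k' \<subseteq> G" by (rule m[OF _ k'(2)]) simp
  ultimately show ?thesis using k'(2) by (intro exI[of _ "(l + m, k')"]) simp
qed

text \<open>The part of a cell inside an open interval need not be compact, but it is the union of
  the subcells lying in the interval, and images commute with unions.\<close>

definition code_leaf :: "nat \<Rightarrow> nat \<Rightarrow> nat \<Rightarrow> nat \<Rightarrow> nat" where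
  "code_leaf l k j = code_Un (\<lambda>e. code_if (subcell l k (prod_decode e) \<and>
     lo j < real (snd (prod_decode e)) / 2 ^ fst (prod_decode e) \<and>
     (real (snd (prod_decode e)) + 1) / 2 ^ fst (prod_decode e) < hi j)
     (code_image (fst (prod_decode e)) (snd (prod_decode e))))"

lemma cmp_code_leaf [cmp_intros]:
  assumes "cmp g a" "cmp g b" "cmp g c" "cmp g d"
  shows "cmp g (\<lambda>x. code_leaf (a x) (b x) (c x) (d x))"
  by (rule cmp4[OF _ assms]) (unfold code_leaf_def subcell_def, intro cmp_intros)

lemma borel_code_leaf:
  assumes "k < 2 ^ l" shows "borel_code (code_leaf l k j) (f ` (cell l k \<inter> basic_open j))"
proof -
  define P where "P p \<longleftrightarrow> subcell l k p \<and> lo j < real (snd p) / 2 ^ fst p \<and>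
     (real (snd p) + 1) / 2 ^ fst p < hi j" for p :: "nat \<times> nat"
  have "borel_code (code_leaf l k j)
      (\<Union>e. if P (prod_decode e) then f ` cell (fst (prod_decode e)) (snd (prod_decode e)) else {})"
    unfolding code_leaf_def
  proof (rule borel_code_Un, fold P_def)
    show "borel_code (code_if (P (prod_decode e)) (code_image (fst (prod_decode e)) (snd (prod_decode e))))
      (if P (prod_decode e) then f ` cell (fst (prod_decode e)) (snd (prod_decode e)) else {})" for e
      by (intro borel_code_if borel_code_image) (simp add: P_def subcell_def)
  qed
  moreover have "(\<Union>e. if P (prod_decode e) then f ` cell (fst (prod_decode e)) (snd (prod_decode e)) else {})
      = f ` (cell l k \<inter> basic_open j)" (is "?L = ?R")
  proof
    have sub: "f ` cell (fst p) (snd p) \<subseteq> ?R" if "P p" for p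
    proof -
      have "cell (fst p) (snd p) \<subseteq> cell l k" using that subcell_subset unfolding P_def by blast
      moreover have "cell (fst p) (snd p) \<subseteq> basic_open j"
        using that unfolding P_def basic_open_eq cell_def by auto
      ultimately show ?thesis by blast
    qed
    show "?L \<subseteq> ?R" by (rule UN_least) (simp add: sub)
    show "?R \<subseteq> ?L"
    proof
      fix y assume "y \<in> ?R"
      then obtain x where x: "x \<in> cell l k" "x \<in> basic_open j" "y = f x" by blast
      obtain p where p: "subcell l k p" "x \<in> cell (fst p) (snd p)" "cell (fst p) (snd p) \<subseteq> basic_open j"
        using subcell_ex[OF assms x(1) open_basic_open x(2)] by blast
      have "real (snd p) / 2 ^ fst p \<in> cell (fst p) (snd p)"
        "(real (snd p) + 1) / 2 ^ fst p \<in> cell (fst p) (snd p)"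
        by (rule cell_endpoints)+
      then have "P p" using p(1,3) unfolding P_def by (auto simp: basic_open_eq)
      then have "y \<in> (if P (prod_decode (prod_encode p)) then f ` cell (fst (prod_decode (prod_encode p))) (snd (prod_decode (prod_encode p))) else {})"
        using p(2) x(3) by simp
      then show "y \<in> ?L" by blast
    qed
  qed
  ultimately show ?thesis by simp
qed

definition multi :: "nat \<Rightarrow> nat \<Rightarrow> real set" where
  "multi l k = {y. \<exists>x\<in>cell l k. \<exists>x'\<in>cell l k. x < x' \<and> f x = y \<and> f x' = y}"

text \<open>Two different preimages can be enclosed in subcells of which one lies strictly to the
  left of the other. This presents \<open>multi l k\<close> as a countable union of intersections of
  two compact images.\<close>

definition code_multi :: "nat \<Rightarrow> nat \<Rightarrow> nat \<Rightarrow> nat" where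
  "code_multi l k = code_Un (\<lambda>e. code_Un (\<lambda>e'. code_if (subcell l k (prod_decode e) \<and> subcell l k (prod_decode e') \<and>
     (real (snd (prod_decode e)) + 1) / 2 ^ fst (prod_decode e)
       < real (snd (prod_decode e')) / 2 ^ fst (prod_decode e'))
     (code_Int (code_image (fst (prod_decode e)) (snd (prod_decode e)))
       (code_image (fst (prod_decode e')) (snd (prod_decode e'))))))"

lemma cmp_code_multi [cmp_intros]:
  assumes "cmp g a" "cmp g b" "cmp g c" shows "cmp g (\<lambda>x. code_multi (a x) (b x) (c x))"
  by (rule cmp3[OF _ assms]) (unfold code_multi_def subcell_def, intro cmp_intros)

lemma borel_code_multi:
  assumes "k < 2 ^ l" shows "borel_code (code_multi l k) (multi l k)"
proof -
  define P where "P p q \<longleftrightarrow> subcell l k p \<and> subcell l k q \<and>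
    (real (snd p) + 1) / 2 ^ fst p < real (snd q) / 2 ^ fst q" for p q :: "nat \<times> nat"
  define I where "I p = f ` cell (fst p) (snd p)" for p :: "nat \<times> nat"
  have "borel_code (code_multi l k) (\<Union>e. \<Union>e'. if P (prod_decode e) (prod_decode e') then I (prod_decode e) \<inter> I (prod_decode e') else {})"
    unfolding code_multi_def
  proof (rule borel_code_Un, rule borel_code_Un, fold P_def)
    show "borel_code (code_if (P (prod_decode e) (prod_decode e'))
        (code_Int (code_image (fst (prod_decode e)) (snd (prod_decode e)))
          (code_image (fst (prod_decode e')) (snd (prod_decode e')))))
      (if P (prod_decode e) (prod_decode e') then I (prod_decode e) \<inter> I (prod_decode e') else {})" for e e'
      unfolding I_def by (intro borel_code_if borel_code_Int borel_code_image) (auto simp: P_def subcell_def)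
  qed
  moreover have "(\<Union>e. \<Union>e'. if P (prod_decode e) (prod_decode e') then I (prod_decode e) \<inter> I (prod_decode e') else {}) = multi l k" (is "?L = _")
  proof
    show "?L \<subseteq> multi l k"
    proof
      fix y assume "y \<in> ?L"
      then obtain e e' where e: "y \<in> (if P (prod_decode e) (prod_decode e')
          then I (prod_decode e) \<inter> I (prod_decode e') else {})" by blast
      define p q where "p = prod_decode e" and "q = prod_decode e'"
      have pq: "P p q" "y \<in> I p" "y \<in> I q" using e by (auto simp: p_def q_def split: if_splits)
      then obtain x x' where x: "x \<in> cell (fst p) (snd p)" "x' \<in> cell (fst q) (snd q)" "f x = y" "f x' = y"
        by (auto simp: I_def)
      have "x < x'" using pq(1) x(1,2) by (auto simp: P_def cell_def)
      moreover have "x \<in> cell l k" "x' \<in> cell l k"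
        using pq(1) x(1,2) subcell_subset unfolding P_def by blast+
      ultimately show "y \<in> multi l k" using x(3,4) by (auto simp: multi_def)
    qed
    show "multi l k \<subseteq> ?L"
    proof
      fix y assume "y \<in> multi l k"
      then obtain x x' where x: "x \<in> cell l k" "x' \<in> cell l k" "x < x'" "f x = y" "f x' = y"
        by (auto simp: multi_def)
      define z where "z = (x + x') / 2"
      obtain p where p: "subcell l k p" "x \<in> cell (fst p) (snd p)" "cell (fst p) (snd p) \<subseteq> {..<z}"
        using subcell_ex[OF assms x(1), of "{..<z}"] x(3) by (auto simp: z_def)
      obtain q where q: "subcell l k q" "x' \<in> cell (fst q) (snd q)" "cell (fst q) (snd q) \<subseteq> {z<..}"
        using subcell_ex[OF assms x(2), of "{z<..}"] x(3) by (auto simp: z_def)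
      have "(real (snd p) + 1) / 2 ^ fst p \<in> cell (fst p) (snd p)"
        "real (snd q) / 2 ^ fst q \<in> cell (fst q) (snd q)"
        by (rule cell_endpoints)+
      then have "P p q" using p(1,3) q(1,3) unfolding P_def by force
      then have "y \<in> (if P (prod_decode (prod_encode p)) (prod_decode (prod_encode q)) then I (prod_decode (prod_encode p)) \<inter> I (prod_decode (prod_encode q)) else {})"
        using imageI[OF p(2), of f] imageI[OF q(2), of f] x(4,5) by (simp add: I_def)
      then show "y \<in> ?L" by blast
    qed
  qed
  ultimately show ?thesis by simp
qed

definition once :: "nat \<Rightarrow> nat \<Rightarrow> real set" where
  "once l k = f ` cell l k \<inter> - multi l k"

lemma once_unique:
  assumes "y \<in> once l k" shows "\<exists>!x. x \<in> cell l k \<and> f x = y"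
proof (rule ex_ex1I)
  show "\<exists>x. x \<in> cell l k \<and> f x = y" using assms unfolding once_def by blast
  fix x x' assume "x \<in> cell l k \<and> f x = y" "x' \<in> cell l k \<and> f x' = y"
  then have "\<not> x < x'" "\<not> x' < x" using assms unfolding once_def multi_def by blast+
  then show "x = x'" by simp
qed

text \<open>Values with infinite fibres form a null set, but a random value is only known to avoid
  null sets that have a code. This subset has one, and avoiding it yields a level at which no cell
  contains two preimages of the value.\<close>

definition everywhere_multi :: "real set" where
  "everywhere_multi = (\<Inter>n. \<Union>k. if k < 2 ^ n then multi n k else {})"

lemma everywhere_multi_null: "everywhere_multi \<in> null_sets lebesgue"
proof -
  have "infinite (pre y)" if y: "y \<in> everywhere_multi" for y
  proof
    assume "finite (pre y)"
    then obtain m where m: "\<And>l x x' k. m \<le> l \<Longrightarrow> x \<in> pre y \<Longrightarrow> x' \<in> pre y \<Longrightarrow> x \<in> cell l k \<Longrightarrow>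
        x' \<in> cell l k \<Longrightarrow> x = x'" using cells_separate[OF \<open>finite (pre y)\<close>] by blast
    obtain k where k: "k < 2 ^ m" "y \<in> multi m k"
      using y unfolding everywhere_multi_def by (auto split: if_splits)
    then obtain x x' where x: "x \<in> cell m k" "x' \<in> cell m k" "x < x'" "f x = y" "f x' = y"
      by (auto simp: multi_def)
    moreover have "x \<in> pre y" "x' \<in> pre y" using x cell_subset_unit[OF k(1)] by blast+
    ultimately show False using m[of m x x' k] by simp
  qed
  then show ?thesis by (intro null_sets_completion_subset[OF _ infinite_pre_null]) blast
qed

lemma luzin_N_reflects_Delta11:
  assumes "luzin_N f" shows "reflects (Delta11_random Z) f"
  unfolding reflects_def Delta11_random_def
proof (intro ballI impI allI notI, elim conjE)
  fix x S assume x: "x \<in> {0..1}" "x \<in> S"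
    and fx: "\<forall>T. Delta11 Z T \<and> T \<in> null_sets lebesgue \<longrightarrow> f x \<notin> T"
    and S: "Delta11 Z S" "S \<in> null_sets lebesgue"
  obtain a H c where H: "hset Z a H" "cmp (char_fun H) c" and c: "borel_code c S"
    using S(1) unfolding Delta11_def hyperarithmetic_in_def computable_in_iff by blast
  \<comment> \<open>\<open>H\<close> computes the given code of \<open>S\<close>. All codes built
    below are computed from the same \<open>H\<close>, which makes them hyperarithmetic in
    \<open>Z\<close>.\<close>
  have avoid: "f x \<notin> T" if "borel_code d T" "cmp (char_fun H) d" "T \<in> null_sets lebesgue" for d T
  proof -
    have "Delta11 Z T"
      using that(1,2) H(1) unfolding Delta11_def hyperarithmetic_in_def computable_in_iff by blast
    then show ?thesis using fx that(3) by blast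
  qed
  have "borel_code (code_Inter (\<lambda>n. code_Un (\<lambda>k. code_if (k < 2 ^ n) (code_multi n k)))) everywhere_multi"
    unfolding everywhere_multi_def
    by (intro borel_code_Inter borel_code_Un borel_code_if borel_code_multi)
  moreover have "cmp (char_fun H) (code_Inter (\<lambda>n. code_Un (\<lambda>k. code_if (k < 2 ^ n) (code_multi n k))))"
    by (intro cmp_code_Inter[where k = "\<lambda>x. x"] cmp_intros)
  ultimately have "f x \<notin> everywhere_multi" using everywhere_multi_null by (rule avoid)
  then obtain n where n: "\<And>k. k < 2 ^ n \<Longrightarrow> f x \<notin> multi n k"
    unfolding everywhere_multi_def by (auto split: if_splits)
  obtain k where k: "k < 2 ^ n" "x \<in> cell n k" using cell_ex[OF x(1)] by blast
  have fxo: "f x \<in> once n k" using n[OF k(1)] k(2) by (simp add: once_def)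
  \<comment> \<open>The inverse branch of \<open>f\<close> on the cell: for \<open>y\<close> in
    \<open>once n k\<close>, lying in the image of the part of \<open>S\<close> inside the cell
    means \<open>h y \<in> S\<close>, a preimage condition that respects all Borel
    operations.\<close>
  define h where "h y = (THE u. u \<in> cell n k \<and> f u = y)" for y
  have h: "h y \<in> cell n k" "f (h y) = y" if "y \<in> once n k" for y
    using theI'[OF once_unique[OF that]] unfolding h_def by auto
  have h_eq: "h (f u) = u" if "u \<in> cell n k" "f u \<in> once n k" for u
    using the1_equality[OF once_unique[OF that(2)]] that(1) unfolding h_def by blast
  have "\<exists>T. borel_code (subst_leaves (code_leaf n k) c) T \<and> (\<forall>y\<in>once n k. y \<in> T \<longleftrightarrow> h y \<in> S)"
  proof (rule borel_code_subst_leaves[OF c borel_code_leaf[OF k(1)]])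
    fix j y assume y: "y \<in> once n k"
    show "y \<in> f ` (cell n k \<inter> basic_open j) \<longleftrightarrow> h y \<in> basic_open j"
      using h[OF y] h_eq y by (metis (no_types, lifting) IntE IntI image_iff)
  qed
  then obtain T where T: "borel_code (subst_leaves (code_leaf n k) c) T"
    "\<And>y. y \<in> once n k \<Longrightarrow> y \<in> T \<longleftrightarrow> h y \<in> S" by blast
  \<comment> \<open>\<open>T\<close> is controlled on \<open>once n k\<close> only, hence the
    intersection with that set before nullness is claimed.\<close>
  have "borel_code (code_Int (code_Int (code_image n k) (code_Compl (code_multi n k)))
      (subst_leaves (code_leaf n k) c)) (once n k \<inter> T)"
    unfolding once_def
    by (intro borel_code_Int borel_code_image borel_code_Compl borel_code_multi T(1) k(1))
  moreover have "cmp (char_fun H) (code_Int (code_Int (code_image n k) (code_Compl (code_multi n k)))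
      (subst_leaves (code_leaf n k) c))"
    by (intro cmp_code_Int[where k = "\<lambda>x. x"] cmp_subst_leaves H(2) cmp_intros)
  moreover have "once n k \<inter> T \<in> null_sets lebesgue"
  proof (rule null_sets_completion_subset, rule subsetI)
    fix y assume "y \<in> once n k \<inter> T"
    then have "h y \<in> S" "h y \<in> {0..1}" "f (h y) = y" using T(2) h cell_subset_unit[OF k(1)] by blast+
    then show "y \<in> f ` (S \<inter> {0..1})" by force
  next
    show "f ` (S \<inter> {0..1}) \<in> null_sets lebesgue" by (rule luzin_N_image_null[OF assms S(2)])
  qed
  ultimately have "f x \<notin> once n k \<inter> T" by (rule avoid)
  moreover have "f x \<in> T" using T(2)[OF fxo] h_eq[OF k(2) fxo] x(2) by simp
  ultimately show False using fxo by blast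
qed

end

subsection \<open>Failure of Luzin's condition\<close>

text \<open>The binary digits of \<open>X\<close> select cells, so that a search over finite sets of
  cells is a search over numbers.\<close>

definition col :: "nat \<Rightarrow> nat \<Rightarrow> nat set" where
  "col l X = {k. k < 2 ^ l \<and> odd (X div 2 ^ k)}"

lemma col_subset: "col l X \<subseteq> {..<2 ^ l}" and finite_col [simp]: "finite (col l X)"
  by (auto simp: col_def)

lemma col_ex: assumes "A \<subseteq> {..<2 ^ l}" shows "\<exists>X. col l X = A"
proof -
  have "finite A" using assms finite_subset by blast
  then have "set_decode (set_encode A) = A" by simp
  then have "k \<in> A \<longleftrightarrow> odd (set_encode A div 2 ^ k)" for k by (auto simp: set_decode_def)
  then have "col l (set_encode A) = A" using assms by (auto simp: col_def)
  then show ?thesis by blast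
qed

lemma card_ocells_le:
  assumes "A \<subseteq> {..<2 ^ l}" "(\<Union>k\<in>A. ocell l k) \<subseteq> G" "open G" "emeasure lborel G < ennreal (1 / 2 ^ m)"
  shows "card A * 2 ^ m < 2 ^ l"
proof -
  have fin: "finite A" using assms(1) finite_subset by blast
  have em: "emeasure lborel (ocell l k) = ennreal (1 / 2 ^ l)" for k
    unfolding ocell_def by (subst emeasure_lborel_Ioo) (simp_all add: divide_right_mono add_divide_distrib)
  have "(\<Sum>k\<in>A. emeasure lborel (ocell l k)) = ennreal (\<Sum>k\<in>A. 1 / 2 ^ l)"
    unfolding em by (rule sum_ennreal) simp
  then have "ennreal (card A * (1 / 2 ^ l)) = (\<Sum>k\<in>A. emeasure lborel (ocell l k))"
    by simp
  also have "\<dots> = emeasure lborel (\<Union>k\<in>A. ocell l k)"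
  proof (rule sum_emeasure[OF _ _ fin])
    show "disjoint_family_on (ocell l) A"
      unfolding disjoint_family_on_def using ocell_disjoint by blast
  qed (auto simp: ocell_def)
  also have "\<dots> \<le> emeasure lborel G" using assms(2,3) by (intro emeasure_mono) auto
  also have "\<dots> < ennreal (1 / 2 ^ m)" by (rule assms(4))
  finally have "real (card A) * (1 / 2 ^ l) < 1 / 2 ^ m" by (subst (asm) ennreal_less_iff) auto
  then have "real (card A * 2 ^ m) < real (2 ^ l)" by (simp add: field_simps)
  then show ?thesis by (simp only: of_nat_less_iff)
qed

lemma emeasure_cells_le:
  assumes "finite A" shows "emeasure lborel (\<Union>k\<in>A. cell l k) \<le> ennreal (card A / 2 ^ l)"
proof -
  have em: "emeasure lborel (cell l k) = ennreal (1 / 2 ^ l)" for k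
    unfolding cell_def by (subst emeasure_lborel_Icc) (simp_all add: divide_right_mono add_divide_distrib)
  have "emeasure lborel (\<Union>k\<in>A. cell l k) \<le> (\<Sum>k\<in>A. emeasure lborel (cell l k))"
    using assms by (intro emeasure_subadditive_finite) (auto simp: cell_def)
  also have "\<dots> = ennreal (\<Sum>k\<in>A. 1 / 2 ^ l)" unfolding em by (rule sum_ennreal) simp
  also have "\<dots> = ennreal (card A / 2 ^ l)" by simp
  finally show ?thesis .
qed

text \<open>The image of a null set need not be measurable, so its failure to be null is expressed
  by a lower bound on the measure of all Borel supersets.\<close>

lemma outer_measure_pos:
  fixes A :: "real set"
  assumes "A \<notin> null_sets lebesgue"
  shows "\<exists>e>0. \<forall>B\<in>sets borel. A \<subseteq> B \<longrightarrow> ennreal e \<le> emeasure lborel B"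
proof (rule ccontr)
  assume "\<not> ?thesis"
  then have "\<forall>e>0. \<exists>B. B \<in> sets borel \<and> A \<subseteq> B \<and> emeasure lborel B < ennreal e"
    by (force simp: not_le)
  then have "\<forall>n::nat. \<exists>B. B \<in> sets borel \<and> A \<subseteq> B \<and> emeasure lborel B < ennreal ((1/2) ^ n)" by simp
  then obtain B where B: "\<And>n. B n \<in> sets borel" "\<And>n. A \<subseteq> B n" "\<And>n. emeasure lborel (B n) < ennreal ((1/2) ^ n)"
    by metis
  have "emeasure lborel (\<Inter>n. B n) \<le> ennreal 0"
  proof (rule LIMSEQ_le_const)
    show "(\<lambda>n. ennreal ((1/2) ^ n)) \<longlonglongrightarrow> ennreal 0"
      by (intro tendsto_ennrealI LIMSEQ_power_zero) auto
    have "emeasure lborel (\<Inter>n. B n) \<le> ennreal ((1/2) ^ n)" for n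
      using emeasure_mono[of "\<Inter>n. B n" "B n" lborel] B(1) B(3)[of n] by (auto intro: order_trans less_imp_le)
    then show "\<exists>N. \<forall>n\<ge>N. emeasure lborel (\<Inter>n. B n) \<le> ennreal ((1/2) ^ n)" by blast
  qed
  moreover have "(\<Inter>n. B n) \<in> sets borel" using B(1) by auto
  ultimately have "(\<Inter>n. B n) \<in> null_sets lborel" by (simp add: null_sets_def)
  then have "A \<in> null_sets lebesgue" using B(2) unfolding null_sets_completion_iff2 by blast
  then show False using assms by simp
qed

context computable_bv
begin

text \<open>Otherwise cover a null set \<open>E\<close>, whose image has outer measure above 2^-r,
  by an open \<open>G\<close> of measure below 2^-m. Any cells of one level inside \<open>G\<close>
  are few enough to have variation at most 2^-r, and \<open>emeasure_image_good_le\<close> turns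
  this into a Borel superset of the image of \<open>E\<close> that is too small.\<close>

lemma not_luzin_N_Var:
  assumes "\<not> luzin_N f"
  shows "\<exists>r. \<forall>m. \<exists>l X. card (col l X) * 2 ^ m < 2 ^ l \<and> Var f l (col l X) > 1 / 2 ^ r"
proof (rule ccontr)
  assume neg: "\<not> ?thesis"
  obtain E where E: "E \<subseteq> {0..1}" "E \<in> null_sets lebesgue" "f ` E \<notin> null_sets lebesgue"
    using assms unfolding luzin_N_def by blast
  obtain e where e: "e > 0" "\<And>B. B \<in> sets borel \<Longrightarrow> f ` E \<subseteq> B \<Longrightarrow> ennreal e \<le> emeasure lborel B"
    using outer_measure_pos[OF E(3)] by blast
  obtain r where r: "1 / 2 ^ r < e" using pow_half_less[OF e(1), of 0] by blast
  obtain m where m: "\<And>l X. card (col l X) * 2 ^ m < 2 ^ l \<Longrightarrow> Var f l (col l X) \<le> 1 / 2 ^ r"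
    using neg by (metis not_le)
  obtain N where N: "N \<in> null_sets lborel" "E \<subseteq> N" using E(2) unfolding null_sets_completion_iff2 by blast
  then have Nb: "N \<in> sets borel" "emeasure lborel N = 0" by (auto simp: null_sets_def)
  obtain G where G: "open G" "N \<subseteq> G" "emeasure lborel (G - N) < ennreal (1 / 2 ^ m)"
    using outer_regular_lborel[OF Nb(1), of "1 / 2 ^ m"] by auto
  have "emeasure lborel G \<le> emeasure lborel N + emeasure lborel (G - N)"
    using G(1,2) Nb(1) emeasure_subadditive[of N lborel "G - N"] by (simp add: Un_absorb1)
  then have Gm: "emeasure lborel G < ennreal (1 / 2 ^ m)" using G(3) Nb(2) by simp
  let ?B = "\<Union>l. \<Union>k\<in>{k. k < 2 ^ l \<and> cell l k \<subseteq> G}. f ` cell l k"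
  have "emeasure lborel ?B \<le> ennreal (1 / 2 ^ r)"
  proof (rule emeasure_image_good_le)
    show "cell (l + d) k \<subseteq> G" if "cell l (k div 2 ^ d) \<subseteq> G" for l d k
      using that cell_refine_subset by blast
    fix l and A :: "nat set" assume A: "A \<subseteq> {..<2 ^ l}" "\<And>k. k \<in> A \<Longrightarrow> cell l k \<subseteq> G"
    obtain X where X: "col l X = A" using col_ex[OF A(1)] by blast
    have "(\<Union>k\<in>A. ocell l k) \<subseteq> G" using A(2) ocell_subset_cell by blast
    then have "card A * 2 ^ m < 2 ^ l" by (rule card_ocells_le[OF A(1) _ G(1) Gm])
    then show "Var f l A \<le> 1 / 2 ^ r" using m[of l X] X by simp
  qed
  moreover have "ennreal e \<le> emeasure lborel ?B"
  proof (rule e(2))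
    show "?B \<in> sets borel" by (intro sets.countable_UN sets.finite_UN) auto
    show "f ` E \<subseteq> ?B"
    proof
      fix y assume "y \<in> f ` E"
      then obtain x where x: "x \<in> E" "y = f x" by blast
      then have x1: "x \<in> {0..1}" "x \<in> G" using E(1) N(2) G(2) by auto
      obtain l where l: "\<forall>l'\<ge>l. \<forall>k. x \<in> cell l' k \<longrightarrow> cell l' k \<subseteq> G"
        using cell_around[OF G(1) x1(2,1)] ..
      obtain k where "k < 2 ^ l" "x \<in> cell l k" using cell_ex[OF x1(1)] by blast
      then show "y \<in> ?B" using l x(2) by blast
    qed
  qed
  ultimately have "ennreal e \<le> ennreal (1 / 2 ^ r)" by (rule order_trans[rotated])
  then have "e \<le> 1 / 2 ^ r" by (subst (asm) ennreal_le_iff) auto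
  then show False using r by simp
qed

section \<open>Searching for large variation\<close>

definition ainc :: "nat \<Rightarrow> nat \<Rightarrow> nat \<Rightarrow> real" where
  "ainc n l k = \<bar>rat_num (F n (Suc k * 2 ^ (M n - l) - 1)) - rat_num (F n (k * 2 ^ (M n - l)))\<bar>"

definition avar :: "nat \<Rightarrow> nat \<Rightarrow> nat \<Rightarrow> real" where
  "avar n l X = (\<Sum>k<2 ^ l. if odd (X div 2 ^ k) then ainc n l k else 0)"

text \<open>Each of the \<open>2 ^ l\<close> cells contributes an error of at most
  \<open>2 / 2 ^ n\<close>, which explains the margin. The test is decidable for rational
  \<open>c\<close>, and the variation exceeds \<open>c\<close> exactly when the test succeeds for
  some \<open>n\<close>.\<close>

definition Var_gt :: "real \<Rightarrow> nat \<Rightarrow> nat \<Rightarrow> nat \<Rightarrow> bool" where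
  "Var_gt c n l X \<longleftrightarrow> l \<le> n \<and> c + 2 * 2 ^ l / 2 ^ n < avar n l X"

lemma cmp_Var_gt [cmp_intros]:
  assumes "cmp g a" "cmp g b" "cmp g d" "crat g c"
  shows "cmp g (\<lambda>x. Var_gt (c x) (a x) (b x) (d x))"
  unfolding Var_gt_def avar_def ainc_def
  by (intro cmp_intros assms cmp_compose[OF assms(1)] cmp_compose[OF assms(2)] cmp_compose[OF assms(3)])

text \<open>At level \<open>M n\<close> the left endpoint is sampled in the first descendant of the
  cell and the right endpoint in the last one. The index \<open>Suc k * 2 ^ (M n - l)\<close>
  without the subtraction would be out of range for the last cell. Each endpoint costs
  \<open>1 / 2 ^ n\<close>.\<close>

lemma ainc_close:
  assumes "l \<le> n" "k < 2 ^ l" shows "\<bar>ainc n l k - inc f l k\<bar> \<le> 2 / 2 ^ n"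
proof -
  define d where "d = M n - l"
  have d: "M n = l + d" using assms(1) M_ge[of n] by (simp add: d_def)
  have k1: "Suc k * 2 ^ d \<le> 2 ^ M n"
  proof -
    have "Suc k * 2 ^ d \<le> 2 ^ l * 2 ^ d" using assms(2) by (intro mult_le_mono1) simp
    then show ?thesis by (simp add: d power_add)
  qed
  have "0 < Suc k * 2 ^ d" by simp
  then have "Suc (Suc k * 2 ^ d - 1) = Suc k * 2 ^ d" by linarith
  then have i1: "Suc k * 2 ^ d - 1 < 2 ^ M n" "real (Suc k * 2 ^ d - 1) + 1 = real (Suc k * 2 ^ d)"
    using k1 by (linarith, metis of_nat_Suc add.commute)
  have "k * 2 ^ d < Suc k * 2 ^ d" by simp
  then have i0: "k * 2 ^ d < 2 ^ M n" using k1 by linarith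
  have "real k / 2 ^ l = real (k * 2 ^ d) / 2 ^ M n" by (simp add: d power_add)
  then have "real k / 2 ^ l \<in> cell (M n) (k * 2 ^ d)" by (simp add: cell_def divide_right_mono)
  from approx[OF i0 this] have a: "\<bar>f (real k / 2 ^ l) - rat_num (F n (k * 2 ^ d))\<bar> \<le> 1 / 2 ^ n" .
  have "(real k + 1) / 2 ^ l = (real (Suc k * 2 ^ d - 1) + 1) / 2 ^ M n"
    unfolding i1(2) by (simp add: d power_add field_simps)
  then have "(real k + 1) / 2 ^ l \<in> cell (M n) (Suc k * 2 ^ d - 1)" by (simp add: cell_def divide_right_mono)
  from approx[OF i1(1) this]
  have b: "\<bar>f ((real k + 1) / 2 ^ l) - rat_num (F n (Suc k * 2 ^ d - 1))\<bar> \<le> 1 / 2 ^ n" .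
  have "2 / 2 ^ n = 1 / 2 ^ n + (1 / 2 ^ n :: real)" by simp
  then show ?thesis using a b unfolding ainc_def inc_def d_def[symmetric] by linarith
qed

lemma avar_close:
  assumes "l \<le> n" shows "\<bar>avar n l X - Var f l (col l X)\<bar> \<le> 2 * 2 ^ l / 2 ^ n"
proof -
  have col: "col l X = {k \<in> {..<2 ^ l}. odd (X div 2 ^ k)}" by (auto simp: col_def)
  have "Var f l (col l X) = (\<Sum>k<2 ^ l. if odd (X div 2 ^ k) then inc f l k else 0)"
    unfolding col by (rule sum.inter_filter) simp
  then have "avar n l X - Var f l (col l X)
      = (\<Sum>k<2 ^ l. if odd (X div 2 ^ k) then ainc n l k - inc f l k else 0)"
    unfolding avar_def by (simp add: sum_subtractf[symmetric] if_distrib cong: if_cong)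
  also have "\<bar>\<dots>\<bar> \<le> (\<Sum>k<(2::nat) ^ l. 2 / 2 ^ n)"
    by (rule order_trans[OF sum_abs], rule sum_mono) (use ainc_close[OF assms] in auto)
  also have "\<dots> = 2 * 2 ^ l / 2 ^ n" by simp
  finally show ?thesis .
qed

lemma Var_gt_sound: "Var_gt c n l X \<Longrightarrow> Var f l (col l X) > c"
  unfolding Var_gt_def using avar_close[of l n X] by linarith

lemma Var_gt_complete: assumes "Var f l (col l X) > c" shows "\<exists>n. Var_gt c n l X"
proof -
  \<comment> \<open>When \<open>1 / 2 ^ n\<close> is below this, the gap exceeds twice the margin:
    once for the error of \<open>avar\<close> and once for the margin in the test.\<close>
  define e where "e = (Var f l (col l X) - c) / (4 * 2 ^ l)"
  have "e > 0" using assms by (simp add: e_def)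
  then obtain n where n: "l \<le> n" "1 / 2 ^ n < e" using pow_half_less by blast
  have "4 * 2 ^ l * (1 / 2 ^ n) < 4 * 2 ^ l * e" using n(2) by (intro mult_strict_left_mono) auto
  then have "4 * 2 ^ l / 2 ^ n < Var f l (col l X) - c" by (simp add: e_def)
  moreover have "4 * 2 ^ l / 2 ^ n = 2 * 2 ^ l / 2 ^ n + (2 * 2 ^ l / 2 ^ n :: real)" by simp
  ultimately have "c + 2 * 2 ^ l / 2 ^ n < avar n l X" using avar_close[OF n(1), of X] by linarith
  then show ?thesis using n(1) unfolding Var_gt_def by blast
qed

text \<open>For every \<open>m\<close> a level, a set of cells and a precision passing a decidable
  test exist, so the least code of such a triple is computable from \<open>m\<close>. The bound has
  the form \<open>1 / 2 ^ r\<close> to keep the comparison rational.\<close>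

lemma singular_sequence:
  assumes "\<not> luzin_N f"
  obtains c lv xs where "c > 0" "\<And>g. cmp g lv" "\<And>g. cmp g xs"
    "\<And>m. card (col (lv m) (xs m)) * 2 ^ m < 2 ^ lv m" "\<And>m. Var f (lv m) (col (lv m) (xs m)) > c"
proof -
  obtain r where r: "\<And>m. \<exists>l X. card (col l X) * 2 ^ m < 2 ^ l \<and> Var f l (col l X) > 1 / 2 ^ r"
    using not_luzin_N_Var[OF assms] by blast
  define P where "P m w \<longleftrightarrow> (\<Sum>k<2 ^ fst w. if odd (fst (snd w) div 2 ^ k) then 1 else 0) * 2 ^ m < (2::nat) ^ fst w \<and>
      Var_gt (1 / 2 ^ r) (snd (snd w)) (fst w) (fst (snd w))" for m and w :: "nat \<times> nat \<times> nat"
  have card: "card (col l X) = (\<Sum>k<2 ^ l. if odd (X div 2 ^ k) then 1 else 0)" for l X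
  proof -
    have "col l X = {k \<in> {..<2 ^ l}. odd (X div 2 ^ k)}" by (auto simp: col_def)
    then show ?thesis by (simp add: sum.inter_filter[symmetric])
  qed
  have ex: "\<exists>w. P m (dec w)" for m
  proof -
    obtain l X where lX: "card (col l X) * 2 ^ m < 2 ^ l" "Var f l (col l X) > 1 / 2 ^ r" using r by blast
    obtain n where "Var_gt (1 / 2 ^ r) n l X" using Var_gt_complete[OF lX(2)] by blast
    then have "P m (l, X, n)" using lX(1) by (simp add: P_def card)
    then show ?thesis by (intro exI[of _ "enc (l, X, n)"]) simp
  qed
  define w where "w m = (LEAST w. P m (dec w))" for m
  have Pw: "P m (dec (w m))" for m unfolding w_def by (rule LeastI_ex[OF ex])
  have "cmp g (\<lambda>z. P (fst z) (dec (snd z)))" for g unfolding P_def by (intro cmp_intros)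
  then have cmp_w: "cmp g w" for g unfolding w_def by (intro cmp_Least ex)
  define lv where "lv m = fst (dec (w m) :: nat \<times> nat \<times> nat)" for m
  define xs where "xs m = fst (snd (dec (w m) :: nat \<times> nat \<times> nat))" for m
  show thesis
  proof (rule that[of "1 / 2 ^ r" lv xs])
    show "cmp g lv" "cmp g xs" for g unfolding lv_def xs_def by (intro cmp_intros cmp_w)+
    show "card (col (lv m) (xs m)) * 2 ^ m < 2 ^ lv m" for m
      using Pw[of m] unfolding P_def card lv_def xs_def by blast
    show "1 / 2 ^ r < Var f (lv m) (col (lv m) (xs m))" for m
      using Pw[of m] Var_gt_sound unfolding P_def lv_def xs_def by blast
  qed simp
qed

end

section \<open>A null limsup with an image that is not null\<close>

locale singular_bv = computable_bv +
  fixes c :: real and lv xs :: "nat \<Rightarrow> nat"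
  assumes c_pos: "c > 0"
    and cmp_lv0: "\<And>g. cmp g lv" and cmp_xs0: "\<And>g. cmp g xs"
    and small: "card (col (lv m) (xs m)) * 2 ^ m < 2 ^ lv m"
    and large: "Var f (lv m) (col (lv m) (xs m)) > c"
begin

lemmas cmp_lv_xs [cmp_intros] = cmp_compose[OF cmp_lv0] cmp_compose[OF cmp_xs0]

definition closed_part :: "nat \<Rightarrow> real set" where
  "closed_part n = (\<Union>k\<in>col (lv n) (xs n). cell (lv n) k)"

definition open_part :: "nat \<Rightarrow> real set" where
  "open_part n = (\<Union>k\<in>col (lv n) (xs n). ocell (lv n) k)"

lemma open_part_subset: "open_part n \<subseteq> closed_part n"
  using ocell_subset_cell by (auto simp: open_part_def closed_part_def)

lemma closed_part_unit: "closed_part n \<subseteq> {0..1}"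
  unfolding closed_part_def by (intro UN_least cell_subset_unit) (simp add: col_def)

lemma closed_closed_part: "closed (closed_part n)"
  unfolding closed_part_def by (intro closed_UN) (auto simp: cell_def)

text \<open>By \<open>small\<close> the measure of \<open>closed_part n\<close> is at most 2^-n, so
  the Borel-Cantelli lemma applies.\<close>

lemma limsup_closed_part_null: "{x. \<exists>\<^sub>\<infinity>n. x \<in> closed_part n} \<in> null_sets lebesgue"
proof -
  have em: "emeasure lborel (closed_part n) \<le> ennreal ((1/2) ^ n)" for n
  proof -
    have "real (card (col (lv n) (xs n)) * 2 ^ n) \<le> real (2 ^ lv n)"
      using small[of n] unfolding of_nat_le_iff by simp
    then have "card (col (lv n) (xs n)) / 2 ^ lv n \<le> (1/2) ^ n"
      by (simp add: field_simps power_one_over)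
    then have "ennreal (card (col (lv n) (xs n)) / 2 ^ lv n) \<le> ennreal ((1/2) ^ n)" by (rule ennreal_leI)
    then show ?thesis unfolding closed_part_def by (rule order_trans[OF emeasure_cells_le[OF finite_col]])
  qed
  have "limsup closed_part \<in> null_sets lborel"
  proof (rule borel_cantelli_limsup1)
    show "closed_part n \<in> sets lborel" for n using closed_closed_part by simp
    show "emeasure lborel (closed_part n) < \<infinity>" for n
      using em[of n] by (simp add: order_le_less_trans)
    show "summable (\<lambda>n. measure lborel (closed_part n))"
    proof (rule summable_comparison_test'[of "\<lambda>n. (1/2) ^ n" 0])
      show "norm (measure lborel (closed_part n)) \<le> (1/2) ^ n" for n
        using em[of n] by (simp add: measure_def enn2real_leI)
    qed (simp add: summable_geometric)
  qed
  moreover have "{x. \<exists>\<^sub>\<infinity>n. x \<in> closed_part n} \<subseteq> limsup closed_part"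
    by (auto simp: limsup_INF_SUP INFM_nat_le)
  ultimately show ?thesis unfolding null_sets_completion_iff2 by blast
qed

definition sing :: "real set" where
  "sing = {x. \<exists>\<^sub>\<infinity>n. x \<in> open_part n}"

lemma sing_unit: "sing \<subseteq> {0..1}"
  using open_part_subset closed_part_unit unfolding sing_def by (auto dest!: INFM_EX)

lemma sing_null: "sing \<in> null_sets lebesgue"
proof (rule null_sets_completion_subset[OF _ limsup_closed_part_null])
  show "sing \<subseteq> {x. \<exists>\<^sub>\<infinity>n. x \<in> closed_part n}"
    using open_part_subset unfolding sing_def by (auto elim!: INFM_mono)
qed

lemma image_sing_not_null: "f ` sing \<notin> null_sets lebesgue"
proof -
  have "f ` {x \<in> {0..1}. \<exists>\<^sub>\<infinity>i. \<exists>k\<in>col (lv i) (xs i). x \<in> ocell (lv i) k} \<notin> null_sets lebesgue"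
    by (rule image_limsup_not_null[OF col_subset c_pos large])
  moreover have "{x \<in> {0..1}. \<exists>\<^sub>\<infinity>i. \<exists>k\<in>col (lv i) (xs i). x \<in> ocell (lv i) k} = sing"
    using sing_unit unfolding sing_def open_part_def by auto
  ultimately show ?thesis by simp
qed

lemma ocell_eq_Union_basic_open:
  "ocell l k = (\<Union>j\<in>{j. real k / 2 ^ l \<le> lo j \<and> hi j \<le> (real k + 1) / 2 ^ l}. basic_open j)"
proof
  show "ocell l k \<subseteq> (\<Union>j\<in>{j. real k / 2 ^ l \<le> lo j \<and> hi j \<le> (real k + 1) / 2 ^ l}. basic_open j)"
  proof
    fix x assume "x \<in> ocell l k"
    then obtain j where "x \<in> basic_open j" "real k / 2 ^ l \<le> lo j" "hi j \<le> (real k + 1) / 2 ^ l"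
      using basic_open_within[of "real k / 2 ^ l" x "(real k + 1) / 2 ^ l"] by (auto simp: ocell_def)
    then show "x \<in> (\<Union>j\<in>{j. real k / 2 ^ l \<le> lo j \<and> hi j \<le> (real k + 1) / 2 ^ l}. basic_open j)"
      by blast
  qed
qed (auto simp: basic_open_eq ocell_def)

lemma sing_Pi02: "Pi02 sing"
proof -
  define W where "W = {w. \<exists>p. fst (prod_decode w) \<le> fst p \<and> snd p < 2 ^ lv (fst p) \<and>
    odd (xs (fst p) div 2 ^ snd p) \<and> real (snd p) / 2 ^ lv (fst p) \<le> lo (snd (prod_decode w)) \<and>
    hi (snd (prod_decode w)) \<le> (real (snd p) + 1) / 2 ^ lv (fst p)}"
  have "ce_in {} W" unfolding W_def by (intro ce_inI cmp_intros)
  moreover have "(\<Union>j\<in>{j. prod_encode (m, j) \<in> W}. basic_open j) = (\<Union>n\<in>{m..}. open_part n)" for m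
    unfolding W_def open_part_def col_def ocell_eq_Union_basic_open by auto
  then have "sing = (\<Inter>m. \<Union>j\<in>{j. prod_encode (m, j) \<in> W}. basic_open j)"
    unfolding sing_def INFM_nat_le by auto
  ultimately show ?thesis unfolding Pi02_def by blast
qed

lemma sing_Delta11: "Delta11 Z sing"
proof -
  define P where "P m e j \<longleftrightarrow> m \<le> fst (prod_decode e) \<and>
    snd (prod_decode e) < 2 ^ lv (fst (prod_decode e)) \<and>
    odd (xs (fst (prod_decode e)) div 2 ^ snd (prod_decode e)) \<and>
    real (snd (prod_decode e)) / 2 ^ lv (fst (prod_decode e)) \<le> lo j \<and>
    hi j \<le> (real (snd (prod_decode e)) + 1) / 2 ^ lv (fst (prod_decode e))" for m e j
  let ?c = "code_Inter (\<lambda>m. code_Un (\<lambda>e. code_Un (\<lambda>j. code_if (P m e j) (code_basic_open j))))"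
  have "cmp (char_fun Z) ?c"
    unfolding P_def by (intro cmp_code_Inter[where k = "\<lambda>x. x"] cmp_intros)
  then have hyp: "hyperarithmetic_in Z ?c"
    unfolding hyperarithmetic_in_def computable_in_iff using hset.hset_zero by blast
  have code: "borel_code ?c (\<Inter>m. \<Union>e. \<Union>j. if P m e j then basic_open j else {})"
    by (intro borel_code_Inter borel_code_Un borel_code_if borel_code_basic_open)
  have "(\<Union>e. \<Union>j. if P m e j then basic_open j else {}) = (\<Union>n\<in>{m..}. open_part n)" for m
  proof
    have "basic_open j \<subseteq> (\<Union>n\<in>{m..}. open_part n)" if "P m e j" for e j
      using that unfolding P_def open_part_def col_def ocell_eq_Union_basic_open by blast
    then show "(\<Union>e. \<Union>j. if P m e j then basic_open j else {}) \<subseteq> (\<Union>n\<in>{m..}. open_part n)"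
      by (intro UN_least) simp
    show "(\<Union>n\<in>{m..}. open_part n) \<subseteq> (\<Union>e. \<Union>j. if P m e j then basic_open j else {})"
    proof
      fix x assume "x \<in> (\<Union>n\<in>{m..}. open_part n)"
      then obtain n k j where "m \<le> n" "k < 2 ^ lv n" "odd (xs n div 2 ^ k)" "x \<in> basic_open j"
        "real k / 2 ^ lv n \<le> lo j" "hi j \<le> (real k + 1) / 2 ^ lv n"
        unfolding open_part_def col_def ocell_eq_Union_basic_open by blast
      then have "x \<in> (if P m (prod_encode (n, k)) j then basic_open j else {})" by (simp add: P_def)
      then show "x \<in> (\<Union>e. \<Union>j. if P m e j then basic_open j else {})" by blast
    qed
  qed
  then have "(\<Inter>m. \<Union>e. \<Union>j. if P m e j then basic_open j else {}) = sing"
    unfolding sing_def INFM_nat_le by auto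
  then have "borel_code ?c sing" using code by (simp only:)
  then show ?thesis unfolding Delta11_def using hyp by (intro exI[of _ ?c] conjI)
qed

section \<open>Cutting the limsup with the halting problem\<close>

definition inside :: "nat \<Rightarrow> nat \<Rightarrow> nat \<Rightarrow> nat \<Rightarrow> bool" where
  "inside m b l k \<longleftrightarrow> (\<exists>n<b. m \<le> n \<and> (\<exists>k'<2 ^ lv n. odd (xs n div 2 ^ k') \<and>
     real k' / 2 ^ lv n < real k / 2 ^ l \<and> (real k + 1) / 2 ^ l < (real k' + 1) / 2 ^ lv n))"

definition off :: "nat \<Rightarrow> nat \<Rightarrow> nat \<Rightarrow> nat \<Rightarrow> bool" where
  "off m N l k \<longleftrightarrow> (\<forall>n<Suc N. m \<le> n \<longrightarrow> (\<forall>k'<2 ^ lv n. odd (xs n div 2 ^ k') \<longrightarrow>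
     (real k + 1) / 2 ^ l < real k' / 2 ^ lv n \<or> (real k' + 1) / 2 ^ lv n < real k / 2 ^ l))"

lemma inside_iff: "(\<exists>b. inside m b l k) \<longleftrightarrow> (\<exists>n\<ge>m. \<exists>k'\<in>col (lv n) (xs n). cell l k \<subseteq> ocell (lv n) k')"
proof -
  have "real k / 2 ^ l \<le> (real k + 1) / 2 ^ l" by (simp add: divide_right_mono)
  then have "cell l k \<subseteq> ocell (lv n) k' \<longleftrightarrow>
     real k' / 2 ^ lv n < real k / 2 ^ l \<and> (real k + 1) / 2 ^ l < (real k' + 1) / 2 ^ lv n" for n k'
    unfolding cell_def ocell_def by auto
  then show ?thesis unfolding inside_def col_def by auto
qed

lemma off_iff: "off m N l k \<longleftrightarrow> (\<forall>n. m \<le> n \<and> n \<le> N \<longrightarrow> cell l k \<inter> closed_part n = {})"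
proof -
  have "cell l k \<inter> cell l' k' = {} \<longleftrightarrow>
     (real k + 1) / 2 ^ l < real k' / 2 ^ l' \<or> (real k' + 1) / 2 ^ l' < real k / 2 ^ l" for l' k'
  proof -
    have "real k / 2 ^ l \<le> (real k + 1) / 2 ^ l" "real k' / 2 ^ l' \<le> (real k' + 1) / 2 ^ l'"
      by (simp_all add: divide_right_mono)
    then show ?thesis unfolding cell_def by auto
  qed
  note cells = this
  have "cell l k \<inter> closed_part n = {} \<longleftrightarrow> (\<forall>k'<2 ^ lv n. odd (xs n div 2 ^ k') \<longrightarrow> cell l k \<inter> cell (lv n) k' = {})" for n
    unfolding closed_part_def col_def by blast
  then show ?thesis unfolding off_def cells[symmetric] less_Suc_eq_le by metis
qed

lemma inside_mono: "inside m b l k \<Longrightarrow> b \<le> b' \<Longrightarrow> inside m b' l k"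
  unfolding inside_def by (meson less_le_trans)

text \<open>A good cell lies in an open part of some stage from \<open>m\<close> on but misses the
  closed parts of stages \<open>m\<close> to \<open>N\<close>: it belongs to what is lost when the
  tail from \<open>m\<close> is cut at \<open>N\<close>.\<close>

definition good :: "nat \<Rightarrow> nat \<Rightarrow> nat \<Rightarrow> nat \<Rightarrow> bool" where
  "good m N l k \<longleftrightarrow> (\<exists>b. inside m b l k) \<and> off m N l k"

lemma good_refine: "good m N l (k div 2 ^ d) \<Longrightarrow> good m N (l + d) k"
  unfolding good_def inside_iff off_iff using cell_refine_subset[of l d k] by blast

text \<open>A search over a decidable condition: the witness holds a level and a set of cells, a
  precision for \<open>Var_gt\<close>, and one bound for \<open>inside\<close> that serves all the
  cells. The threshold is summable in \<open>m\<close>, with total \<open>2 / 2 ^ q\<close>.\<close>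

definition much_left :: "nat \<Rightarrow> nat \<Rightarrow> nat \<Rightarrow> bool" where
  "much_left q m N \<longleftrightarrow> (\<exists>w :: (nat \<times> nat) \<times> (nat \<times> nat).
     Var_gt (1 / 2 ^ (m + q)) (fst (snd w)) (fst (fst w)) (snd (fst w)) \<and>
     (\<forall>k<2 ^ fst (fst w). odd (snd (fst w) div 2 ^ k) \<longrightarrow>
        inside m (snd (snd w)) (fst (fst w)) k \<and> off m N (fst (fst w)) k))"

lemma much_left_iff:
  "much_left q m N \<longleftrightarrow> (\<exists>l X. (\<forall>k\<in>col l X. good m N l k) \<and> Var f l (col l X) > 1 / 2 ^ (m + q))"
proof
  assume "much_left q m N"
  then obtain l X n b where w: "Var_gt (1 / 2 ^ (m + q)) n l X"
     "\<And>k. k < 2 ^ l \<Longrightarrow> odd (X div 2 ^ k) \<Longrightarrow> inside m b l k \<and> off m N l k"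
    unfolding much_left_def by auto
  then have "\<forall>k\<in>col l X. good m N l k" unfolding good_def col_def by blast
  then show "\<exists>l X. (\<forall>k\<in>col l X. good m N l k) \<and> Var f l (col l X) > 1 / 2 ^ (m + q)"
    using Var_gt_sound[OF w(1)] by blast
next
  assume "\<exists>l X. (\<forall>k\<in>col l X. good m N l k) \<and> Var f l (col l X) > 1 / 2 ^ (m + q)"
  then obtain l X where lX: "\<And>k. k \<in> col l X \<Longrightarrow> good m N l k" "Var f l (col l X) > 1 / 2 ^ (m + q)" by blast
  obtain n where n: "Var_gt (1 / 2 ^ (m + q)) n l X" using Var_gt_complete[OF lX(2)] by blast
  obtain b where b: "\<And>k. k \<in> col l X \<Longrightarrow> inside m (b k) l k" using lX(1) unfolding good_def by metis
  have "inside m (\<Sum>k\<in>col l X. b k) l k" if "k \<in> col l X" for k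
    by (rule inside_mono[OF b[OF that]]) (use that in \<open>auto intro: member_le_sum\<close>)
  then show "much_left q m N" unfolding much_left_def
    using n lX(1) by (intro exI[of _ "((l, X), (n, \<Sum>k\<in>col l X. b k))"]) (auto simp: good_def col_def)
qed

lemma cmp_much_left: "cmp (char_fun (jump {})) (\<lambda>p. much_left q (fst p) (snd p))"
proof -
  define W where "W = {v. much_left q (fst (prod_decode v)) (snd (prod_decode v))}"
  have "ce_in {} W"
    unfolding W_def much_left_def inside_def off_def by (intro ce_inI cmp_intros)
  then have "cmp (char_fun (jump {})) (\<lambda>v. v \<in> W)" by (rule ce_decidable_jump)
  then have "cmp (char_fun (jump {})) (\<lambda>p. prod_encode p \<in> W)"
    by (rule cmp_compose) (intro cmp_intros)
  then show ?thesis by (simp add: W_def)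
qed

text \<open>If every cut lost much, \<open>image_limsup_not_null\<close> would give a point in the
  lost cells for infinitely many \<open>N\<close>. Such a point lies in some
  \<open>closed_part n\<close> with \<open>n \<ge> m\<close>, yet for \<open>N \<ge> n\<close> the
  lost cells avoid that set.\<close>

lemma ex_not_much_left: "\<exists>N. \<not> much_left q m N"
proof (rule ccontr)
  assume "\<not> ?thesis"
  then have "\<forall>N. \<exists>l X. (\<forall>k\<in>col l X. good m N l k) \<and> Var f l (col l X) > 1 / 2 ^ (m + q)"
    unfolding much_left_iff by blast
  then obtain l X where lX: "\<And>N k. k \<in> col (l N) (X N) \<Longrightarrow> good m N (l N) k"
    "\<And>N. Var f (l N) (col (l N) (X N)) > 1 / 2 ^ (m + q)" by metis
  have "f ` {x \<in> {0..1}. \<exists>\<^sub>\<infinity>N. \<exists>k\<in>col (l N) (X N). x \<in> ocell (l N) k} \<notin> null_sets lebesgue"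
    by (rule image_limsup_not_null[where c = "1 / 2 ^ (m + q)", OF col_subset _ lX(2)]) simp
  then have "{x \<in> {0..1}. \<exists>\<^sub>\<infinity>N. \<exists>k\<in>col (l N) (X N). x \<in> ocell (l N) k} \<noteq> {}"
    by (metis image_empty null_sets.empty_sets)
  then obtain x where x: "\<exists>\<^sub>\<infinity>N. \<exists>k\<in>col (l N) (X N). x \<in> ocell (l N) k" by blast
  then obtain N k where "k \<in> col (l N) (X N)" "x \<in> ocell (l N) k" by (auto dest!: INFM_EX)
  then have "good m N (l N) k" "x \<in> cell (l N) k" using lX(1) ocell_subset_cell by blast+
  then obtain n where n: "m \<le> n" "x \<in> closed_part n"
    unfolding good_def inside_iff closed_part_def using ocell_subset_cell by blast
  obtain N' k' where N': "n \<le> N'" "k' \<in> col (l N') (X N')" "x \<in> ocell (l N') k'"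
    using x unfolding INFM_nat_le by blast
  then have "off m N' (l N') k'" "x \<in> cell (l N') k'" using lX(1) ocell_subset_cell unfolding good_def by blast+
  then show False using n N'(1) unfolding off_iff by blast
qed

definition cut :: "nat \<Rightarrow> nat \<Rightarrow> nat" where
  "cut q m = (LEAST N. \<not> much_left q m N)"

lemma cmp_cut: "cmp (char_fun (jump {})) (cut q)"
  unfolding cut_def by (intro cmp_Least ex_not_much_left cmp_not cmp_much_left)

text \<open>Each union is finite, so the intersection is closed; and a point that meets some stage
  from \<open>m\<close> on for every \<open>m\<close> lies in infinitely many closed parts, so the
  set is still null.\<close>

definition core :: "nat \<Rightarrow> real set" where
  "core q = (\<Inter>m. \<Union>n\<in>{m..cut q m}. closed_part n)"

lemma core_unit: "core q \<subseteq> {0..1}"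
  using closed_part_unit unfolding core_def by blast

lemma core_null: "core q \<in> null_sets lebesgue"
proof (rule null_sets_completion_subset[OF _ limsup_closed_part_null])
  show "core q \<subseteq> {x. \<exists>\<^sub>\<infinity>n. x \<in> closed_part n}" unfolding core_def INFM_nat_le by fastforce
qed

lemma core_eff_closed: "eff_closed (jump {}) (core q)"
proof -
  \<comment> \<open>The disjunct \<open>hi j \<le> lo j\<close> accounts for indices of the empty
    interval.\<close>
  define Q where "Q m j \<longleftrightarrow> (\<forall>n<Suc (cut q m). m \<le> n \<longrightarrow> (\<forall>k<2 ^ lv n. odd (xs n div 2 ^ k) \<longrightarrow>
     hi j \<le> real k / 2 ^ lv n \<or> (real k + 1) / 2 ^ lv n \<le> lo j \<or> hi j \<le> lo j))" for m j
  have Q: "Q m j \<longleftrightarrow> basic_open j \<inter> (\<Union>n\<in>{m..cut q m}. closed_part n) = {}" for m j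
  proof -
    have "hi j \<le> real k / 2 ^ l \<or> (real k + 1) / 2 ^ l \<le> lo j \<or> hi j \<le> lo j \<longleftrightarrow> basic_open j \<inter> cell l k = {}" for l k
    proof
      assume e: "basic_open j \<inter> cell l k = {}"
      show "hi j \<le> real k / 2 ^ l \<or> (real k + 1) / 2 ^ l \<le> lo j \<or> hi j \<le> lo j"
      proof (rule ccontr)
        assume "\<not> ?thesis"
        then have "max (lo j) (real k / 2 ^ l) < min (hi j) ((real k + 1) / 2 ^ l)"
          by (simp add: divide_strict_right_mono)
        then obtain x where "max (lo j) (real k / 2 ^ l) < x" "x < min (hi j) ((real k + 1) / 2 ^ l)"
          using dense by blast
        then have "x \<in> basic_open j \<inter> cell l k" by (simp add: basic_open_eq cell_def)
        then show False using e by blast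
      qed
    qed (auto simp: basic_open_eq cell_def)
    note cells = this
    have "basic_open j \<inter> closed_part n = {} \<longleftrightarrow>
        (\<forall>k<2 ^ lv n. odd (xs n div 2 ^ k) \<longrightarrow> basic_open j \<inter> cell (lv n) k = {})" for n
      unfolding closed_part_def col_def by blast
    then have "Q m j \<longleftrightarrow> (\<forall>n. n \<le> cut q m \<longrightarrow> m \<le> n \<longrightarrow> basic_open j \<inter> closed_part n = {})"
      unfolding Q_def cells less_Suc_eq_le by blast
    also have "\<dots> \<longleftrightarrow> basic_open j \<inter> (\<Union>n\<in>{m..cut q m}. closed_part n) = {}"
      by (auto simp: disjoint_iff)
    finally show ?thesis .
  qed
  define W where "W = {j. \<exists>m. Q m j}"
  have "ce_in (jump {}) W"
    unfolding W_def Q_def by (intro ce_inI cmp_intros cmp_compose[OF cmp_cut])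
  moreover have "core q = - (\<Union>j\<in>W. basic_open j)"
  proof
    show "core q \<subseteq> - (\<Union>j\<in>W. basic_open j)" unfolding core_def W_def Q by blast
    show "- (\<Union>j\<in>W. basic_open j) \<subseteq> core q"
    proof (rule subsetI, rule ccontr)
      fix x assume x: "x \<in> - (\<Union>j\<in>W. basic_open j)" "x \<notin> core q"
      then obtain m where m: "x \<notin> (\<Union>n\<in>{m..cut q m}. closed_part n)" unfolding core_def by blast
      have "open (- (\<Union>n\<in>{m..cut q m}. closed_part n))"
        by (intro open_Compl closed_UN ballI closed_closed_part) auto
      then obtain j where "x \<in> basic_open j" "basic_open j \<subseteq> - (\<Union>n\<in>{m..cut q m}. closed_part n)"
        using basic_open_around m by (metis ComplI)
      then have "j \<in> W" "x \<in> basic_open j" unfolding W_def Q by blast+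
      then show False using x(1) by blast
    qed
  qed
  ultimately show ?thesis unfolding eff_closed_def by blast
qed

text \<open>If all these images were null, the image of \<open>sing\<close> would be covered, up to
  a null set, by the images of the cells lost at the cuts, whose total measure is too small for
  large \<open>q\<close>.\<close>

lemma image_core_not_null: "\<exists>q. f ` core q \<notin> null_sets lebesgue"
proof (rule ccontr)
  assume "\<not> ?thesis"
  then have null: "f ` core q \<in> null_sets lebesgue" for q by blast
  obtain e where e: "e > 0" "\<And>B. B \<in> sets borel \<Longrightarrow> f ` sing \<subseteq> B \<Longrightarrow> ennreal e \<le> emeasure lborel B"
    using outer_measure_pos[OF image_sing_not_null] by blast
  \<comment> \<open>The losses sum to \<open>2 / 2 ^ q\<close>, which must stay below
    \<open>e\<close>. As \<open>e\<close> comes from \<open>sing\<close> alone, \<open>q\<close> may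
    be chosen after it.\<close>
  obtain q where q: "1 / 2 ^ q < e / 2" using pow_half_less[of "e / 2" 0] e(1) by auto
  obtain N where N: "N \<in> null_sets lborel" "f ` core q \<subseteq> N"
    using null[of q] unfolding null_sets_completion_iff2 by blast
  then have Nb [measurable]: "N \<in> sets borel" and N0: "emeasure lborel N = 0" by (auto simp: null_sets_def)
  define B where "B m = (\<Union>l. \<Union>k\<in>{k. k < 2 ^ l \<and> good m (cut q m) l k}. f ` cell l k)" for m
  have Bb [measurable]: "B m \<in> sets borel" for m
    unfolding B_def by (intro sets.countable_UN sets.finite_UN) auto
  have B_le: "emeasure lborel (B m) \<le> ennreal (1 / 2 ^ (m + q))" for m
    unfolding B_def
  proof (rule emeasure_image_good_le)
    show "good m (cut q m) (l + d) k" if "good m (cut q m) l (k div 2 ^ d)" for l d k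
      using that by (rule good_refine)
    fix l and A :: "nat set" assume A: "A \<subseteq> {..<2 ^ l}" "\<And>k. k \<in> A \<Longrightarrow> good m (cut q m) l k"
    obtain X where X: "col l X = A" using col_ex[OF A(1)] by blast
    have "\<not> much_left q m (cut q m)" unfolding cut_def by (rule LeastI_ex[OF ex_not_much_left])
    then show "Var f l A \<le> 1 / 2 ^ (m + q)" using A(2) X unfolding much_left_iff by (metis not_le)
  qed
  have "f ` sing \<subseteq> N \<union> (\<Union>m. B m)"
  proof
    fix y assume "y \<in> f ` sing"
    then obtain x where x: "x \<in> sing" "y = f x" by blast
    show "y \<in> N \<union> (\<Union>m. B m)"
    proof (cases "x \<in> core q")
      case False
      then obtain m where m: "x \<notin> (\<Union>n\<in>{m..cut q m}. closed_part n)" unfolding core_def by blast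
      obtain n where n: "m \<le> n" "x \<in> open_part n" using x(1) unfolding sing_def INFM_nat_le by blast
      then obtain k' where k': "k' \<in> col (lv n) (xs n)" "x \<in> ocell (lv n) k'" unfolding open_part_def by blast
      \<comment> \<open>The point is in \<open>open_part n\<close> for some \<open>n \<ge> m\<close>
        and outside the finitely many closed parts kept for \<open>m\<close>; a small cell around it
        inside \<open>U\<close> is thus good.\<close>
      define U where "U = ocell (lv n) k' \<inter> - (\<Union>n\<in>{m..cut q m}. closed_part n)"
      have U: "open U" unfolding U_def
        by (intro open_Int open_Compl closed_UN ballI closed_closed_part) (auto simp: ocell_def)
      have "x \<in> U" using k'(2) m by (simp add: U_def)
      have x1: "x \<in> {0..1}" using sing_unit x(1) by blast
      obtain l where l: "\<forall>l'\<ge>l. \<forall>k. x \<in> cell l' k \<longrightarrow> cell l' k \<subseteq> U"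
        using cell_around[OF U \<open>x \<in> U\<close> x1] ..
      obtain k where k: "k < 2 ^ l" "x \<in> cell l k" using cell_ex[OF x1] by blast
      then have "cell l k \<subseteq> U" using l by blast
      then have sub: "cell l k \<subseteq> ocell (lv n) k'" "cell l k \<inter> (\<Union>i\<in>{m..cut q m}. closed_part i) = {}"
        unfolding U_def by blast+
      have "cell l k \<inter> closed_part i = {}" if "m \<le> i" "i \<le> cut q m" for i
        using sub(2) that by (auto simp: disjoint_iff)
      then have "good m (cut q m) l k"
        unfolding good_def inside_iff off_iff using n(1) k'(1) sub(1) by blast
      then have "y \<in> B m" using k x(2) unfolding B_def by blast
      then show ?thesis by blast
    qed (use N(2) x(2) in blast)
  qed
  then have "ennreal e \<le> emeasure lborel (N \<union> (\<Union>m. B m))" by (intro e(2)) auto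
  also have "\<dots> \<le> emeasure lborel N + emeasure lborel (\<Union>m. B m)"
    by (intro emeasure_subadditive) auto
  also have "\<dots> = emeasure lborel (\<Union>m. B m)" by (simp add: N0)
  also have "\<dots> \<le> (\<Sum>m. emeasure lborel (B m))" by (intro emeasure_subadditive_countably) auto
  also have "\<dots> \<le> (\<Sum>m. ennreal ((1 / 2 ^ q) * (1/2) ^ m))"
    using B_le by (intro suminf_le) (auto simp: power_add power_one_over mult.commute)
  also have "\<dots> = ennreal (2 / 2 ^ q)"
  proof (rule suminf_ennreal_eq)
    have "(\<lambda>m. (1/2 :: real) ^ m) sums 2" using geometric_sums[of "1/2 :: real"] by simp
    from sums_mult[OF this, of "1 / 2 ^ q"] show "(\<lambda>m. (1 / 2 ^ q) * (1/2 :: real) ^ m) sums (2 / 2 ^ q)" by simp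
  qed auto
  finally have "e \<le> 2 / 2 ^ q" by (subst (asm) ennreal_le_iff) auto
  then show False using q by simp
qed

end

subsection \<open>Almost every real is random\<close>

lemma nonrandom_null:
  assumes "countable {S. Q S}"
  shows "{y. \<exists>S. Q S \<and> S \<in> null_sets lebesgue \<and> y \<in> S} \<in> null_sets (lebesgue :: real measure)"
proof -
  have "countable {S. Q S \<and> S \<in> null_sets lebesgue}"
    by (rule countable_subset[OF _ assms]) blast
  then have "(\<Union>S\<in>{S. Q S \<and> S \<in> null_sets lebesgue}. S) \<in> null_sets lebesgue"
    by (rule null_sets_UN') blast
  moreover have "(\<Union>S\<in>{S. Q S \<and> S \<in> null_sets lebesgue}. S)
      = {y. \<exists>S. Q S \<and> S \<in> null_sets lebesgue \<and> y \<in> S}" by blast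
  ultimately show ?thesis by simp
qed

text \<open>Reflection would make every value of \<open>f\<close> on \<open>L\<close> non-random,
  since no point of \<open>L\<close> is random. Countably many tests leave only a null set of
  non-random reals, which the image of \<open>L\<close> exceeds.\<close>

lemma not_reflects:
  assumes "countable {S. Q S}" "Q L" "L \<in> null_sets lebesgue" "L \<subseteq> {0..1}" "f ` L \<notin> null_sets lebesgue"
  shows "\<not> reflects (\<lambda>x. \<forall>S. Q S \<and> S \<in> null_sets lebesgue \<longrightarrow> x \<notin> S) f"
proof
  assume R: "reflects (\<lambda>x. \<forall>S. Q S \<and> S \<in> null_sets lebesgue \<longrightarrow> x \<notin> S) f"
  have "f ` L \<subseteq> {y. \<exists>S. Q S \<and> S \<in> null_sets lebesgue \<and> y \<in> S}"
    using R assms(2-4) unfolding reflects_def by blast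
  then have "f ` L \<in> null_sets lebesgue"
    by (rule null_sets_completion_subset[OF _ nonrandom_null[OF assms(1)]])
  then show False using assms(5) by simp
qed

lemma countable_ce_in: "countable {W. ce_in Z W}"
proof -
  have "{W. ce_in Z W} = range (\<lambda>e. {n. phi Z e n \<noteq> None})" unfolding ce_in_def by auto
  then show ?thesis by simp
qed

lemma countable_eff_closed: "countable {S. eff_closed Z S}"
proof -
  have "{S. eff_closed Z S} = (\<lambda>W. - (\<Union>i\<in>W. basic_open i)) ` {W. ce_in Z W}"
    unfolding eff_closed_def by auto
  then show ?thesis using countable_ce_in by simp
qed

lemma countable_Pi02: "countable {S. Pi02 S}"
proof -
  have "{S. Pi02 S} = (\<lambda>W. \<Inter>n. \<Union>i\<in>{i. prod_encode (n, i) \<in> W}. basic_open i) ` {W. ce_in {} W}"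
    unfolding Pi02_def by auto
  then show ?thesis using countable_ce_in by simp
qed

section \<open>Uniqueness of iterated jumps and of coded sets\<close>

lemma kleene_O_nonzero: "kleene_O Z a \<Longrightarrow> a \<noteq> 0"
  by (erule kleene_O.cases) auto

lemma power2_neq_3_mult_power5: "(2 :: nat) ^ a \<noteq> 3 * 5 ^ e"
proof (cases a)
  case (Suc b)
  then have "even (2 ^ a :: nat)" by simp
  moreover have "odd (3 * 5 ^ e :: nat)" by simp
  ultimately show ?thesis by metis
next
  case 0
  have "1 < 3 * (5 :: nat) ^ e" by (simp add: Suc_lessI)
  then show ?thesis using 0 by simp
qed

text \<open>The three forms of a notation never overlap: powers of 2 differ from
  \<open>3 * 5 ^ e\<close>, and \<open>2 ^ a\<close> is 1 only for \<open>a = 0\<close>, which is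
  not a notation. So the last rule of a derivation is determined by the notation.\<close>

lemma hset_unique: "hset Z a H \<Longrightarrow> hset Z a H' \<Longrightarrow> H = H'"
proof (induction arbitrary: H' rule: hset.induct)
  case hset_zero
  from hset_zero show ?case
  proof (cases rule: hset.cases)
    case (hset_suc b H)
    then have "b = 0" by (cases b) auto
    then show ?thesis using hset_suc(3) kleene_O_nonzero by blast
  next
    case (hset_lim e h H)
    then show ?thesis using power2_neq_3_mult_power5[of 0 e] by simp
  qed simp
next
  case (hset_suc a H)
  from hset_suc.prems show ?case
  proof (cases rule: hset.cases)
    case hset_zero
    then have "a = 0" by (cases a) auto
    then show ?thesis using hset_suc.hyps kleene_O_nonzero by blast
  next
    case (hset_suc b K)
    then have "b = a" by simp
    then show ?thesis using hset_suc(2,4) \<open>\<And>H'. hset Z a H' \<Longrightarrow> H = H'\<close> by blast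
  next
    case (hset_lim e h K)
    then show ?thesis using power2_neq_3_mult_power5[of a e] by simp
  qed
next
  case (hset_lim e h H)
  note hyps = hset_lim.hyps hset_lim.IH
  from hset_lim.prems show ?case
  proof (cases rule: hset.cases)
    case hset_zero
    then show ?thesis using power2_neq_3_mult_power5[of 0 e] by simp
  next
    case (hset_suc b K)
    then show ?thesis using power2_neq_3_mult_power5[of b e] by simp
  next
    case (hset_lim e' h' K)
    then have "e' = e" by simp
    then have "h' = h" using hset_lim(4) hyps(2) by (metis ext option.inject)
    then have "K n = H n" for n using hset_lim(5)[of n] hyps(4)[of n "K n"] by simp
    then show ?thesis using hset_lim(2) by simp
  qed
qed

lemma borel_code_unique: "borel_code c S \<Longrightarrow> borel_code c T \<Longrightarrow> S = T"
proof (induction arbitrary: T rule: borel_code.induct)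
  case (code_basic c)
  note c0 = code_basic.hyps
  from code_basic.prems show ?case
  proof (cases rule: borel_code.cases)
    case code_basic
    then show ?thesis by simp
  next
    case (code_compl S)
    then show ?thesis using c0 by linarith
  next
    case (code_union S)
    then show ?thesis using c0 by linarith
  qed
next
  case (code_compl c S)
  note c1 = code_compl.hyps(1) and IH = code_compl.IH
  from code_compl.prems show ?case
  proof (cases rule: borel_code.cases)
    case code_basic
    then show ?thesis using c1 by linarith
  next
    case (code_compl S')
    then show ?thesis using IH[of S'] by simp
  next
    case (code_union S')
    then show ?thesis using c1 by linarith
  qed
next
  case (code_union c S)
  note c2 = code_union.hyps(1) and IH = code_union.IH
  from code_union.prems show ?case
  proof (cases rule: borel_code.cases)
    case code_basic
    then show ?thesis using c2 by linarith
  next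
    case (code_compl S')
    then show ?thesis using c2 by linarith
  next
    case (code_union S')
    then have "S n = S' n" for n using IH[of n "S' n"] by simp
    then show ?thesis using code_union(1) by simp
  qed
qed

text \<open>A notation determines the iterated jump, an index relative to it determines the code,
  and the code determines the set; so pairs of numbers exhaust these sets.\<close>

lemma countable_Delta11: "countable {S. Delta11 Z S}"
proof -
  define P where "P p S \<longleftrightarrow> (\<exists>H c. hset Z (fst p) H \<and> (\<forall>n. phi H (snd p) n = Some (c n)) \<and> borel_code c S)"
    for p :: "nat \<times> nat" and S
  have uniq: "S = T" if S: "P p S" and T: "P p T" for p S T
  proof -
    obtain H c where H: "hset Z (fst p) H" "\<And>n. phi H (snd p) n = Some (c n)" "borel_code c S"
      using S unfolding P_def by blast
    obtain H' c' where H': "hset Z (fst p) H'" "\<And>n. phi H' (snd p) n = Some (c' n)" "borel_code c' T"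
      using T unfolding P_def by blast
    have "H' = H" using hset_unique[OF H'(1) H(1)] .
    then have "c' n = c n" for n using H(2)[of n] H'(2)[of n] by simp
    then have "c' = c" by (rule ext)
    then show ?thesis using borel_code_unique[OF H(3)] H'(3) by simp
  qed
  have "{S. Delta11 Z S} \<subseteq> range (\<lambda>p. THE S. P p S)"
  proof
    fix S assume "S \<in> {S. Delta11 Z S}"
    then obtain a H c e where "hset Z a H" "\<And>n. phi H e n = Some (c n)" "borel_code c S"
      unfolding Delta11_def hyperarithmetic_in_def computable_in_def by blast
    then have S: "P (a, e) S" unfolding P_def by auto
    have "(THE S. P (a, e) S) = S" by (rule the_equality[where P = "P (a, e)", OF S uniq[OF _ S]])
    then show "S \<in> range (\<lambda>p. THE S. P p S)" by (metis rangeI)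
  qed
  then show ?thesis by (rule countable_subset) simp
qed

theorem theorem5p6:
  fixes f :: "real \<Rightarrow> real"
  assumes "computable_unit f" and "bounded_variation_unit f"
  shows "(luzin_N f \<longleftrightarrow> reflects weak2_random f)
    \<and> (luzin_N f \<longleftrightarrow> reflects (kurtz_random (jump {})) f)
    \<and> (luzin_N f \<longleftrightarrow> reflects (Delta11_random KleeneO) f)
    \<and> (luzin_N f \<longleftrightarrow> (\<forall>Z. turing_le (jump {}) Z \<longrightarrow> reflects (kurtz_random Z) f))"
proof -
  obtain V where V: "\<And>l. Var f l {..<2 ^ l} \<le> V"
    using bounded_variation_Var[OF assms(2)] by blast
  obtain M F where MF: "\<And>g. cmp g M" "\<And>g. cmp g (\<lambda>z. F (fst z) (snd z))" "\<And>n. n \<le> M n"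
    "\<And>n k x. k < 2 ^ M n \<Longrightarrow> x \<in> cell (M n) k \<Longrightarrow> \<bar>f x - rat_num (F n k)\<bar> \<le> 1 / 2 ^ n"
    by (rule uniform_approximation[OF assms(1)]) (rule that)
  interpret computable_bv f V M F
    by unfold_locales (use computable_unit_continuous[OF assms(1)] V MF in auto)
  have fails: "\<not> reflects weak2_random f \<and> \<not> reflects (kurtz_random (jump {})) f
      \<and> \<not> reflects (Delta11_random KleeneO) f" if not_N: "\<not> luzin_N f"
  proof -
    obtain c lv xs where seq: "c > 0" "\<And>g. cmp g lv" "\<And>g. cmp g xs"
      "\<And>m. card (col (lv m) (xs m)) * 2 ^ m < 2 ^ lv m" "\<And>m. Var f (lv m) (col (lv m) (xs m)) > c"
      by (rule singular_sequence[OF not_N]) (rule that)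
    interpret singular_bv f V M F c lv xs
      by unfold_locales (use seq in auto)
    obtain q where q: "f ` core q \<notin> null_sets lebesgue" using image_core_not_null by blast
    have "\<not> reflects weak2_random f"
      using not_reflects[where Q = Pi02, OF countable_Pi02 sing_Pi02 sing_null sing_unit image_sing_not_null]
      unfolding weak2_random_def .
    moreover have "\<not> reflects (kurtz_random (jump {})) f"
      using not_reflects[where Q = "eff_closed (jump {})",
          OF countable_eff_closed core_eff_closed core_null core_unit q]
      unfolding kurtz_random_def .
    moreover have "\<not> reflects (Delta11_random KleeneO) f"
      using not_reflects[where Q = "Delta11 KleeneO",
          OF countable_Delta11 sing_Delta11 sing_null sing_unit image_sing_not_null]
      unfolding Delta11_random_def .
    ultimately show ?thesis by blast
  qed
  \<comment> \<open>In the last equivalence the failure of (N) is used against the oracle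
    \<open>jump {}\<close> itself, which is admissible by \<open>turing_le_refl\<close>.\<close>
  show ?thesis
    using fails luzin_N_reflects_kurtz luzin_N_reflects_weak2 luzin_N_reflects_Delta11
      turing_le_refl[of "jump {}"] by blast
qed

end
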